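(* Let $n\ge 3$ and let $F=u\,\phi(x^0,r,s,z)$ be a cylindrically symmetric Finsler metric on $I\times\mathbb{B}^n(\rho)$ as in the context. Then $F$ has vanishing Douglas curvature if and only if $\phi$ satisfies $$z\Psi\Big(\frac{U_s}{z}\Big)=0,\quad z\Psi\Big(\frac{U_z}{z}\Big)=0,\quad U_{zzz}=0,$$ $$z\Psi\Big(\frac{R_s}{z}\Big)=0,\quad z\Psi\Big(\frac{R_z}{z}\Big)=0,\quad R_{zzz}=0,$$ $$z\Psi\Big(\frac{T}{z}\Big)=0,\quad T_{zz}=0.$$
   Context: $\rho>0$, $I\subset\mathbb{R}$ an open interval, $\mathbb{B}^n(\rho)$ the open Euclidean ball of radius $\rho$ at $0$ in $\mathbb{R}^n$. Points $x=(x^0,\overline{x})$, tangent vectors $y=(y^0,\overline{y})$; $u=|\overline{y}|$, $r=|\overline{x}|$, $s=\langle\overline{x},\overline{y}\rangle/u$, $z=y^0/u$. $F=u\,\phi(x^0,r,s,z)$ with $\phi>0$ smooth and $F$ a Finsler metric. Subscripts denote partial derivatives. $\Omega=\phi-s\phi_s-z\phi_z$, $\Lambda=\Omega\phi_{zz}+(r^2-s^2)(\phi_{ss}\phi_{zz}-\phi_{sz}^2)$, $\varphi=z\phi_{x^0}+\frac sr\phi_r+\phi_s$, $U=\frac{1}{2\Lambda}\{(\varphi_s-\frac2r\phi_r)\phi_{zz}-(\varphi_z-2\phi_{x^0})\phi_{sz}\}$, $V=\frac{1}{2\Lambda}\{(\varphi_s-\frac2r\phi_r)\phi_{sz}-(\varphi_z-2\phi_{x^0})\phi_{ss}\}$,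 $L=\frac{\Omega}{2\Lambda}(\varphi_z-2\phi_{x^0})-(r^2-s^2)V$, $R=L-\frac{z}{n+2}[L_z-(n-1)sU+(r^2-s^2)U_s]$, $T=\frac1{n+2}\{3sU+L_z+(r^2-s^2)U_s\}$. For a function $\Theta(x^0,r,s,z)$, $\Psi(\Theta)=-s\Theta_s-z\Theta_z$. The Douglas curvature of $F$ is $D^A_{BCD}=\frac{\partial^3}{\partial y^B\partial y^C\partial y^D}\big(G^A-\frac{1}{n+2}\sum_{E=0}^n\frac{\partial G^E}{\partial y^E}y^A\big)$, $A,B,C,D\in\{0,\dots,n\}$, where $G^A=\frac14g^{AB}\{[F^2]_{x^Cy^B}y^C-[F^2]_{x^B}\}$ are the geodesic coefficients ($g_{AB}=\frac12[F^2]_{y^Ay^B}$, summation convention); "vanishing Douglas curvature" means all $D^A_{BCD}=0$. *)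

theory Defs
  imports "HOL-Analysis.Analysis"
begin

text \<open>Points and tangent vectors of the (n+1)-dimensional space are vectors indexed by
  the type 'n option: the index None is the coordinate x^0, the indices Some i
  (i :: 'n, CARD('n) = n) are the coordinates of the bar-part.\<close>

type_synonym ('n) pt = "real ^ ('n option)"

definition bar :: "('n::finite) pt \<Rightarrow> real ^ 'n" where
  "bar x = (\<chi> i. x $ Some i)"

definition ex :: "('n::finite) option \<Rightarrow> 'n pt" where
  "ex A = axis A 1"

definition cyl_domain :: "real set \<Rightarrow> real \<Rightarrow> ('n::finite) pt set" where
  "cyl_domain I \<rho> = {x. x $ None \<in> I \<and> norm (bar x) < \<rho>}"

definition pd :: "'a::real_normed_vector \<Rightarrow> ('a \<Rightarrow> real) \<Rightarrow> 'a \<Rightarrow> real" where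
  "pd v f p = deriv (\<lambda>t. f (p + t *\<^sub>R v)) 0"

coinductive smooth_on :: "'a::euclidean_space set \<Rightarrow> ('a \<Rightarrow> real) \<Rightarrow> bool" for S where
  "continuous_on S f \<Longrightarrow>
   (\<forall>v\<in>Basis. \<forall>p\<in>S. (\<lambda>t. f (p + t *\<^sub>R v)) differentiable (at 0)) \<Longrightarrow>
   (\<forall>v\<in>Basis. smooth_on S (pd v f)) \<Longrightarrow> smooth_on S f"

type_synonym 'n fn = "'n pt \<Rightarrow> 'n pt \<Rightarrow> real"

definition dX :: "('n::finite) option \<Rightarrow> 'n fn \<Rightarrow> 'n fn" where
  "dX A H = (\<lambda>x y. deriv (\<lambda>t. H (x + t *\<^sub>R ex A) y) 0)"

definition dY :: "('n::finite) option \<Rightarrow> 'n fn \<Rightarrow> 'n fn" where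
  "dY A H = (\<lambda>x y. deriv (\<lambda>t. H x (y + t *\<^sub>R ex A)) 0)"

definition Fsq :: "('n::finite) fn \<Rightarrow> 'n fn" where
  "Fsq F = (\<lambda>x y. (F x y)\<^sup>2)"

definition gmat :: "('n::finite) fn \<Rightarrow> 'n pt \<Rightarrow> 'n pt \<Rightarrow> real ^ ('n option) ^ ('n option)" where
  "gmat F x y = (\<chi> A B. (1/2) * dY A (dY B (Fsq F)) x y)"

definition finsler_metric :: "('n::finite) pt set \<Rightarrow> 'n fn \<Rightarrow> bool" where
  "finsler_metric M F \<longleftrightarrow>
     open M \<and>
     smooth_on (M \<times> (UNIV - {0})) (\<lambda>(x, y). F x y) \<and>
     (\<forall>x\<in>M. \<forall>y. \<forall>l>0. F x (l *\<^sub>R y) = l * F x y) \<and>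
     (\<forall>x\<in>M. \<forall>y. y \<noteq> 0 \<longrightarrow> F x y > 0) \<and>
     (\<forall>x\<in>M. \<forall>y. y \<noteq> 0 \<longrightarrow>
        (\<forall>v. v \<noteq> 0 \<longrightarrow> (\<Sum>A\<in>UNIV. \<Sum>B\<in>UNIV. gmat F x y $ A $ B * v $ A * v $ B) > 0))"

definition geod :: "('n::finite) fn \<Rightarrow> 'n option \<Rightarrow> 'n fn" where
  "geod F A = (\<lambda>x y. ((1/4) *\<^sub>R (matrix_inv (gmat F x y) *v
      (\<chi> B. (\<Sum>C\<in>UNIV. dX C (dY B (Fsq F)) x y * y $ C) - dX B (Fsq F) x y))) $ A)"

definition douglas :: "('n::finite) fn \<Rightarrow> 'n option \<Rightarrow> 'n option \<Rightarrow> 'n option \<Rightarrow> 'n option \<Rightarrow> 'n fn" where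
  "douglas F A B C D =
     dY D (dY C (dY B (\<lambda>x y. geod F A x y
        - (1 / (real CARD('n) + 2)) * (\<Sum>E\<in>UNIV. dY E (geod F E) x y) * y $ A)))"

definition vanishing_douglas :: "('n::finite) pt set \<Rightarrow> 'n fn \<Rightarrow> bool" where
  "vanishing_douglas M F \<longleftrightarrow>
     (\<forall>x\<in>M. \<forall>y. y \<noteq> 0 \<longrightarrow> (\<forall>A B C D. douglas F A B C D x y = 0))"

type_synonym fn4 = "real \<Rightarrow> real \<Rightarrow> real \<Rightarrow> real \<Rightarrow> real"

definition d0 :: "fn4 \<Rightarrow> fn4" where "d0 f = (\<lambda>t r s z. deriv (\<lambda>a. f a r s z) t)"
definition dr :: "fn4 \<Rightarrow> fn4" where "dr f = (\<lambda>t r s z. deriv (\<lambda>a. f t a s z) r)"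
definition ds :: "fn4 \<Rightarrow> fn4" where "ds f = (\<lambda>t r s z. deriv (\<lambda>a. f t r a z) s)"
definition dz :: "fn4 \<Rightarrow> fn4" where "dz f = (\<lambda>t r s z. deriv (\<lambda>a. f t r s a) z)"

definition Omega :: "fn4 \<Rightarrow> fn4" where
  "Omega \<phi> = (\<lambda>t r s z. \<phi> t r s z - s * ds \<phi> t r s z - z * dz \<phi> t r s z)"

definition Lam :: "fn4 \<Rightarrow> fn4" where
  "Lam \<phi> = (\<lambda>t r s z. Omega \<phi> t r s z * dz (dz \<phi>) t r s z
     + (r\<^sup>2 - s\<^sup>2) * (ds (ds \<phi>) t r s z * dz (dz \<phi>) t r s z - (ds (dz \<phi>) t r s z)\<^sup>2))"

definition vphi :: "fn4 \<Rightarrow> fn4" where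
  "vphi \<phi> = (\<lambda>t r s z. z * d0 \<phi> t r s z + s / r * dr \<phi> t r s z + ds \<phi> t r s z)"

definition Uf :: "fn4 \<Rightarrow> fn4" where
  "Uf \<phi> = (\<lambda>t r s z. 1 / (2 * Lam \<phi> t r s z) *
     ((ds (vphi \<phi>) t r s z - 2 / r * dr \<phi> t r s z) * dz (dz \<phi>) t r s z
      - (dz (vphi \<phi>) t r s z - 2 * d0 \<phi> t r s z) * ds (dz \<phi>) t r s z))"

definition Vf :: "fn4 \<Rightarrow> fn4" where
  "Vf \<phi> = (\<lambda>t r s z. 1 / (2 * Lam \<phi> t r s z) *
     ((ds (vphi \<phi>) t r s z - 2 / r * dr \<phi> t r s z) * ds (dz \<phi>) t r s z
      - (dz (vphi \<phi>) t r s z - 2 * d0 \<phi> t r s z) * ds (ds \<phi>) t r s z))"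

definition Lf :: "fn4 \<Rightarrow> fn4" where
  "Lf \<phi> = (\<lambda>t r s z. Omega \<phi> t r s z / (2 * Lam \<phi> t r s z) *
     (dz (vphi \<phi>) t r s z - 2 * d0 \<phi> t r s z) - (r\<^sup>2 - s\<^sup>2) * Vf \<phi> t r s z)"

definition Rf :: "real \<Rightarrow> fn4 \<Rightarrow> fn4" where
  "Rf n \<phi> = (\<lambda>t r s z. Lf \<phi> t r s z - z / (n + 2) *
     (dz (Lf \<phi>) t r s z - (n - 1) * s * Uf \<phi> t r s z + (r\<^sup>2 - s\<^sup>2) * ds (Uf \<phi>) t r s z))"

definition Tf :: "real \<Rightarrow> fn4 \<Rightarrow> fn4" where
  "Tf n \<phi> = (\<lambda>t r s z. 1 / (n + 2) *
     (3 * s * Uf \<phi> t r s z + dz (Lf \<phi>) t r s z + (r\<^sup>2 - s\<^sup>2) * ds (Uf \<phi>) t r s z))"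

definition Psi :: "fn4 \<Rightarrow> fn4" where
  "Psi \<Theta> = (\<lambda>t r s z. - s * ds \<Theta> t r s z - z * dz \<Theta> t r s z)"

definition overz :: "fn4 \<Rightarrow> fn4" where
  "overz \<Theta> = (\<lambda>t r s z. \<Theta> t r s z / z)"

text \<open>Open region of (x^0,r,s,z) values attained with xbar, ybar nonzero and not parallel.\<close>
definition phi_region :: "real set \<Rightarrow> real \<Rightarrow> (real \<times> real \<times> real \<times> real) set" where
  "phi_region I \<rho> = {(t, r, s, z). t \<in> I \<and> 0 < r \<and> r < \<rho> \<and> \<bar>s\<bar> < r}"

end

theory Submission
  imports Defs
begin

text \<open>
  Write \<open>u\<close> for the norm of the bar-part of \<open>y\<close>. Where the bar-parts of \<open>x\<close> and \<open>y\<close> are linearly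
  independent, the spray is \<open>G = H + u W y\<close> with \<open>H\<^sup>0 = u\<^sup>2 (L + z s U)\<close> and \<open>H\<^sup>i = u\<^sup>2 U x\<^sup>i\<close>;
  this is checked by inserting it into the linear system with matrix \<open>g\<close>, which splits into
  \<open>F\<^bsub>AB\<^esub> H\<^sup>B = (F\<^bsub>x\<^sup>C y\<^sup>A\<^esub> y\<^sup>C - F\<^bsub>x\<^sup>A\<^esub>) / 2\<close> and a scalar equation for \<open>W\<close>. The term \<open>u W y\<close>
  does not contribute to the Douglas tensor, which is therefore the third \<open>y\<close>-derivative of \<open>K\<close> with
  \<open>K\<^sup>0 = u\<^sup>2 R\<close> and \<open>K\<^sup>i = u\<^sup>2 U x\<^sup>i - u T y\<^sup>i\<close>. At \<open>z \<noteq> 0\<close> the expression \<open>z \<Psi>(\<Theta>/z)\<close> is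
  \<open>\<Theta> - s \<Theta>\<^sub>s - z \<Theta>\<^sub>z\<close>, so the eight equations say that \<open>u T\<close> is linear and \<open>u\<^sup>2 R\<close>, \<open>u\<^sup>2 U\<close>
  are quadratic in \<open>y\<close>. Conversely, the equations are read off from derivatives in a direction
  orthogonal to the bar-parts of both \<open>x\<close> and \<open>y\<close>, which exists because \<open>n \<ge> 3\<close>. The remaining
  points are limits of generic ones, and the Douglas tensor is continuous.
\<close>

subsection \<open>Smooth functions\<close>

text \<open>The obstacle is that \<open>\<phi>\<close>, and with it \<open>U\<close>,
  \<open>L\<close>, \<open>R\<close>, \<open>T\<close>, is controlled only for
  \<open>|s| < r\<close>. No formula in these functions reaches pairs with dependent bar-parts, so
  continuity of the Douglas tensor there has to come from the smoothness of \<open>F\<close> itself.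
  Since \<open>smooth_on\<close> speaks of partial derivatives only, the chain rule and the symmetry
  of mixed derivatives have to be derived.

  The functions of the statement arise as follows. The matrix F_{AB} annihilates \<open>y\<close>,
  so its equation sees \<open>H\<close> only modulo \<open>y\<close>. There \<open>H\<close> has the
  two coordinates \<open>L\<close> and \<open>U\<close>, and the equation collapses to a 2x2 system
  with determinant \<open>Lam\<close>, solved by Cramer's rule. That \<open>Lam\<close> has no zero
  follows from the positive definiteness of \<open>g\<close>. The divergence of the spray is
  \<open>(n + 2) u (T + W)\<close>, so subtracting the prescribed multiple of \<open>y\<close>
  removes \<open>W\<close>, and the 0-component keeps \<open>R = L + z s U - z T\<close>.

  Factors \<open>s\<close> and \<open>z\<close> have to be cancelled on the way; the sets
  \<open>s = 0\<close> and \<open>z = 0\<close> are recovered by continuity inside the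
  region.\<close>

lemma smooth_onD:
  assumes "smooth_on S f"
  shows smooth_on_continuous: "continuous_on S f"
    and smooth_on_differentiable: "\<And>v p. v \<in> Basis \<Longrightarrow> p \<in> S \<Longrightarrow> (\<lambda>t. f (p + t *\<^sub>R v)) differentiable (at 0)"
    and smooth_on_pd: "\<And>v. v \<in> Basis \<Longrightarrow> smooth_on S (pd v f)"
  using assms by (auto elim: smooth_on.cases)

lemma smooth_on_has_pd:
  assumes "smooth_on S f" "v \<in> Basis" "p \<in> S"
  shows "((\<lambda>t. f (p + t *\<^sub>R v)) has_real_derivative pd v f p) (at 0)"
  using smooth_on_differentiable[OF assms]
  by (simp add: pd_def DERIV_deriv_iff_real_differentiable)

lemma eventually_line_in_open:
  fixes p v :: "'a::real_normed_vector"
  assumes "open S" "p \<in> S"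
  shows "\<forall>\<^sub>F t in nhds (0::real). p + t *\<^sub>R v \<in> S"
proof -
  have "open ((\<lambda>t::real. p + t *\<^sub>R v) -` S)"
    by (intro open_vimage assms continuous_intros)
  then show ?thesis
    using assms(2) eventually_nhds_in_open[of "(\<lambda>t::real. p + t *\<^sub>R v) -` S" 0] by simp
qed

text \<open>Closing the smooth functions under ring operations, reciprocals and agreement on \<open>S\<close>
  gives a class that is stable under partial derivatives, so coinduction shows that all
  its members are smooth.\<close>

inductive smooth_alg :: "'a::euclidean_space set \<Rightarrow> ('a \<Rightarrow> real) \<Rightarrow> bool" for S where
  base: "smooth_on S f \<Longrightarrow> smooth_alg S f"
| add: "smooth_alg S f \<Longrightarrow> smooth_alg S g \<Longrightarrow> smooth_alg S (\<lambda>p. f p + g p)"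
| mult: "smooth_alg S f \<Longrightarrow> smooth_alg S g \<Longrightarrow> smooth_alg S (\<lambda>p. f p * g p)"
| inverse: "smooth_alg S f \<Longrightarrow> \<forall>p\<in>S. f p \<noteq> 0 \<Longrightarrow> smooth_alg S (\<lambda>p. inverse (f p))"
| cong: "smooth_alg S f \<Longrightarrow> \<forall>p\<in>S. f p = g p \<Longrightarrow> smooth_alg S g"
| const: "smooth_alg S (\<lambda>p. c)"
| linear: "bounded_linear f \<Longrightarrow> smooth_alg S f"

lemma pd_eqI:
  "((\<lambda>t. f (p + t *\<^sub>R v)) has_real_derivative d) (at 0) \<Longrightarrow> pd v f p = d"
  unfolding pd_def by (rule DERIV_imp_deriv)

text \<open>Continuity, differentiability and closure under \<open>pd v\<close> go through one
  induction because the product and reciprocal rules use them for the subterms. These rules describe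
  \<open>pd v\<close> only on \<open>S\<close>; rule \<open>cong\<close> absorbs what happens
  elsewhere, and openness of \<open>S\<close> lets agreement on \<open>S\<close> pass to
  derivatives.\<close>

lemma smooth_alg_step:
  assumes "open S" "smooth_alg S f"
  shows "continuous_on S f \<and>
    (\<forall>v\<in>Basis. (\<forall>p\<in>S. ((\<lambda>t. f (p + t *\<^sub>R v)) has_real_derivative pd v f p) (at 0)) \<and>
      smooth_alg S (pd v f))"
  using assms(2)
proof induction
  case (base f)
  then show ?case
    using smooth_on_continuous smooth_on_pd smooth_on_has_pd smooth_alg.base by blast
next
  case (add f g)
  have d: "((\<lambda>t. f (p + t *\<^sub>R v) + g (p + t *\<^sub>R v)) has_real_derivative pd v f p + pd v g p) (at 0)"
    if "v \<in> Basis" "p \<in> S" for v p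
    using add.IH that by (intro DERIV_add) auto
  moreover have "smooth_alg S (pd v (\<lambda>p. f p + g p))" if "v \<in> Basis" for v
  proof (rule smooth_alg.cong[of S "\<lambda>p. pd v f p + pd v g p"])
    show "smooth_alg S (\<lambda>p. pd v f p + pd v g p)"
      using add that by (intro smooth_alg.add) blast+
  qed (use pd_eqI[OF d] that in auto)
  ultimately show ?case using add.IH pd_eqI[OF d]
    by (auto intro!: continuous_on_add)
next
  case (mult f g)
  have d: "((\<lambda>t. f (p + t *\<^sub>R v) * g (p + t *\<^sub>R v)) has_real_derivative
      pd v f p * g p + pd v g p * f p) (at 0)"
    if "v \<in> Basis" "p \<in> S" for v p
    using mult.IH that DERIV_mult[of "\<lambda>t. f (p + t *\<^sub>R v)" "pd v f p" 0 UNIV "\<lambda>t. g (p + t *\<^sub>R v)" "pd v g p"]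
    by auto
  moreover have "smooth_alg S (pd v (\<lambda>p. f p * g p))" if "v \<in> Basis" for v
  proof (rule smooth_alg.cong[of S "\<lambda>p. pd v f p * g p + pd v g p * f p"])
    show "smooth_alg S (\<lambda>p. pd v f p * g p + pd v g p * f p)"
      using mult that by (intro smooth_alg.add smooth_alg.mult) blast+
  qed (use pd_eqI[OF d] that in auto)
  ultimately show ?case using mult.IH pd_eqI[OF d]
    by (auto intro!: continuous_on_mult)
next
  case (inverse f)
  have d: "((\<lambda>t. inverse (f (p + t *\<^sub>R v))) has_real_derivative
      (-1) * pd v f p * (inverse (f p) * inverse (f p))) (at 0)"
    if "v \<in> Basis" "p \<in> S" for v p
    using inverse that DERIV_inverse'[of "\<lambda>t. f (p + t *\<^sub>R v)" "pd v f p" 0 UNIV]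
    by (auto simp: mult_ac)
  moreover have "smooth_alg S (pd v (\<lambda>p. inverse (f p)))" if "v \<in> Basis" for v
  proof (rule smooth_alg.cong[of S "\<lambda>p. (-1) * pd v f p * (inverse (f p) * inverse (f p))"])
    show "smooth_alg S (\<lambda>p. (-1) * pd v f p * (inverse (f p) * inverse (f p)))"
      using inverse that by (intro smooth_alg.mult smooth_alg.const smooth_alg.inverse) blast+
  qed (use pd_eqI[OF d] that in auto)
  ultimately show ?case using inverse pd_eqI[OF d]
    by (auto intro!: continuous_on_inverse)
next
  case (cong f g)
  have d: "((\<lambda>t. g (p + t *\<^sub>R v)) has_real_derivative pd v f p) (at 0)"
    if "v \<in> Basis" "p \<in> S" for v p
  proof -
    have ev: "\<forall>\<^sub>F t in nhds 0. f (p + t *\<^sub>R v) = g (p + t *\<^sub>R v)"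
      by (rule eventually_mono[OF eventually_line_in_open[OF assms(1) that(2), of v]])
         (use cong.hyps(2) in blast)
    have "((\<lambda>t. f (p + t *\<^sub>R v)) has_real_derivative pd v f p) (at 0)"
      using cong.IH that by simp
    then show ?thesis by (rule DERIV_cong_ev[OF refl ev refl, THEN iffD1])
  qed
  moreover have "smooth_alg S (pd v g)" if "v \<in> Basis" for v
    by (rule smooth_alg.cong[of S "pd v f"]) (use cong.IH that pd_eqI[OF d] in simp_all)
  moreover have "continuous_on S g"
    using cong continuous_on_eq by blast
  ultimately show ?case using pd_eqI[OF d] by simp
next
  case (const c)
  have "pd v (\<lambda>p. c) = (\<lambda>p. 0)" for v :: 'a by (auto simp: pd_def)
  then show ?case by (auto intro: smooth_alg.const)
next
  case (linear f)
  note lin = linear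
  interpret bounded_linear f by fact
  have d: "((\<lambda>t. f (p + t *\<^sub>R v)) has_real_derivative f v) (at 0)" for p v
    unfolding add scaleR by (auto intro!: derivative_eq_intros)
  have "pd v f = (\<lambda>p. f v)" for v :: 'a using pd_eqI[OF d] by auto
  then show ?case
    using d linear_continuous_on[OF lin] smooth_alg.const[of S] by simp
qed

lemma smooth_alg_smooth_on:
  assumes "open S" "smooth_alg S f"
  shows "smooth_on S f"
  using assms(2)
proof (coinduction arbitrary: f)
  case smooth_on
  show ?case
    using smooth_alg_step[OF assms(1) smooth_on]
    unfolding real_differentiable_def by blast
qed

context
  fixes S :: "'a::euclidean_space set"
  assumes S: "open S"
begin

lemma smooth_on_add: "smooth_on S f \<Longrightarrow> smooth_on S g \<Longrightarrow> smooth_on S (\<lambda>p. f p + g p)"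
  by (rule smooth_alg_smooth_on[OF S], intro smooth_alg.add smooth_alg.base)

lemma smooth_on_mult: "smooth_on S f \<Longrightarrow> smooth_on S g \<Longrightarrow> smooth_on S (\<lambda>p. f p * g p)"
  by (rule smooth_alg_smooth_on[OF S], intro smooth_alg.mult smooth_alg.base)

lemma smooth_on_cong: "smooth_on S f \<Longrightarrow> (\<And>p. p \<in> S \<Longrightarrow> f p = g p) \<Longrightarrow> smooth_on S g"
  by (rule smooth_alg_smooth_on[OF S], rule smooth_alg.cong[OF smooth_alg.base]) auto

lemma smooth_on_const: "smooth_on S (\<lambda>p. c)"
  by (intro smooth_alg_smooth_on[OF S] smooth_alg.const)

lemma smooth_on_linear: "bounded_linear f \<Longrightarrow> smooth_on S f"
  by (intro smooth_alg_smooth_on[OF S] smooth_alg.linear)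

lemma smooth_on_minus: "smooth_on S f \<Longrightarrow> smooth_on S (\<lambda>p. - f p)"
  using smooth_on_mult[OF smooth_on_const[of "-1"], of f] by simp

lemma smooth_on_diff: "smooth_on S f \<Longrightarrow> smooth_on S g \<Longrightarrow> smooth_on S (\<lambda>p. f p - g p)"
  using smooth_on_add[of f "\<lambda>p. - g p"] smooth_on_minus[of g] by simp

lemma smooth_on_divide:
  "smooth_on S f \<Longrightarrow> smooth_on S g \<Longrightarrow> (\<And>p. p \<in> S \<Longrightarrow> g p \<noteq> 0) \<Longrightarrow> smooth_on S (\<lambda>p. f p / g p)"
  unfolding divide_inverse
  by (rule smooth_alg_smooth_on[OF S], intro smooth_alg.mult smooth_alg.inverse smooth_alg.base) auto

lemma smooth_on_power: "smooth_on S f \<Longrightarrow> smooth_on S (\<lambda>p. f p ^ k)"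
  by (induction k) (auto intro: smooth_on_const smooth_on_mult)

lemma smooth_on_sum: "(\<And>i. i \<in> A \<Longrightarrow> smooth_on S (f i)) \<Longrightarrow> smooth_on S (\<lambda>p. \<Sum>i\<in>A. f i p)"
  by (induction A rule: infinite_finite_induct) (auto intro: smooth_on_const smooth_on_add)

lemma smooth_on_prod: "(\<And>i. i \<in> A \<Longrightarrow> smooth_on S (f i)) \<Longrightarrow> smooth_on S (\<lambda>p. \<Prod>i\<in>A. f i p)"
  by (induction A rule: infinite_finite_induct) (auto intro: smooth_on_const smooth_on_mult)

lemmas smooth_intros = smooth_on_add smooth_on_mult smooth_on_const smooth_on_minus
  smooth_on_diff smooth_on_divide smooth_on_power smooth_on_sum smooth_on_prod

text \<open>Continuous partial derivatives give a total derivative: travel from \<open>p\<close> to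
  \<open>y\<close> one coordinate at a time and apply the mean value theorem on each segment. The
  chain rule in four variables rests on this.\<close>

lemma smooth_on_has_derivative:
  assumes f: "smooth_on S f" and p: "p \<in> S"
  shows "(f has_derivative (\<lambda>h. \<Sum>b\<in>Basis. (h \<bullet> b) * pd b f p)) (at p)"
  unfolding has_derivative_at_alt
proof (intro conjI allI impI)
  show "bounded_linear (\<lambda>h. \<Sum>b\<in>Basis. (h \<bullet> b) * pd b f p)"
    by (intro bounded_linear_sum bounded_linear_mult_const bounded_linear_inner_left)
next
  fix e :: real assume e: "e > 0"
  \<comment> \<open>Each of the \<open>DIM('a)\<close> segments may use up an equal share of the
    error.\<close>
  define e' where "e' = e / DIM('a)"
  have e': "e' > 0" using e by (simp add: e'_def)
  have "\<forall>\<^sub>F q in nhds p. \<forall>b\<in>Basis. q \<in> S \<and> \<bar>pd b f q - pd b f p\<bar> < e'"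
  proof (intro eventually_ball_finite ballI eventually_conj finite_Basis)
    fix b :: 'a assume b: "b \<in> Basis"
    have "continuous_on S (pd b f)"
      using smooth_on_pd[OF f b] by (rule smooth_on_continuous)
    then have "isCont (pd b f) p"
      using S p continuous_on_eq_continuous_at by blast
    then have "(pd b f \<longlongrightarrow> pd b f p) (nhds p)"
      by (simp add: isCont_def tendsto_at_iff_tendsto_nhds)
    then show "\<forall>\<^sub>F q in nhds p. \<bar>pd b f q - pd b f p\<bar> < e'"
      using e' by (auto simp: tendsto_iff dist_real_def)
    show "\<forall>\<^sub>F q in nhds p. q \<in> S" using S p by (rule eventually_nhds_in_open)
  qed
  then obtain d where d: "d > 0" and
    dd: "\<And>q b. dist q p < d \<Longrightarrow> b \<in> Basis \<Longrightarrow> q \<in> S \<and> \<bar>pd b f q - pd b f p\<bar> < e'"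
    unfolding eventually_nhds_metric by blast
  show "\<exists>d>0. \<forall>y. norm (y - p) < d \<longrightarrow>
    norm (f y - f p - (\<Sum>b\<in>Basis. ((y - p) \<bullet> b) * pd b f p)) \<le> e * norm (y - p)"
  proof (intro exI[of _ d] conjI allI impI d)
    fix y assume y: "norm (y - p) < d"
    define h where "h = y - p"
    \<comment> \<open>Induction over the set \<open>B\<close> of coordinates already moved; the
      bound grows by one share per coordinate.\<close>
    have *: "\<bar>f (p + (\<Sum>b\<in>B. (h \<bullet> b) *\<^sub>R b)) - f p - (\<Sum>b\<in>B. (h \<bullet> b) * pd b f p)\<bar>
       \<le> card B * e' * norm h" if "B \<subseteq> Basis" for B
      using finite_subset[OF that finite_Basis] that
    proof (induction B rule: finite_induct)
      case (insert c B)
      define q where "q = p + (\<Sum>b\<in>B. (h \<bullet> b) *\<^sub>R b)"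
      define g where "g = (\<lambda>t. f (q + t *\<^sub>R c))"
      have c: "c \<in> Basis" and B: "B \<subseteq> Basis" using insert by auto
      \<comment> \<open>Every coordinate of an intermediate displacement is bounded by that of
        \<open>h\<close>, so the point stays in the ball of radius \<open>d\<close>.\<close>
      have near: "dist (q + (t * (h \<bullet> c)) *\<^sub>R c) p < d" if t: "0 \<le> t" "t \<le> 1" for t
      proof -
        have fB: "finite (insert c B)" using insert by simp
        have "norm ((\<Sum>b\<in>B. (h \<bullet> b) *\<^sub>R b) + (t * (h \<bullet> c)) *\<^sub>R c) \<le> norm h"
        proof (rule norm_le_componentwise)
          fix k :: 'a assume k: "k \<in> Basis"
          have i: "(\<Sum>b\<in>B. (h \<bullet> b) *\<^sub>R b) \<bullet> k = (if k \<in> B then h \<bullet> k else 0)"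
          proof -
            have "(\<Sum>b\<in>B. (h \<bullet> b) *\<^sub>R b) \<bullet> k = (\<Sum>b\<in>B. (h \<bullet> b) * (b \<bullet> k))"
              by (simp add: inner_sum_left)
            also have "\<dots> = (\<Sum>b\<in>B. if b = k then h \<bullet> k else 0)"
              by (rule sum.cong) (use B k in \<open>auto simp: inner_Basis\<close>)
            finally show ?thesis using insert(1) by simp
          qed
          have "\<bar>t * (h \<bullet> c)\<bar> \<le> \<bar>h \<bullet> c\<bar>"
            using t mult_right_mono[of t 1 "\<bar>h \<bullet> c\<bar>"] by (simp add: abs_mult)
          then show "\<bar>((\<Sum>b\<in>B. (h \<bullet> b) *\<^sub>R b) + (t * (h \<bullet> c)) *\<^sub>R c) \<bullet> k\<bar> \<le> \<bar>h \<bullet> k\<bar>"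
            using insert(2) c k by (auto simp: inner_add_left i inner_Basis)
        qed
        then show ?thesis using y by (simp add: q_def dist_norm h_def add.assoc)
      qed
      have gd: "(g has_real_derivative pd c f (q + t *\<^sub>R c)) (at t)" if "q + t *\<^sub>R c \<in> S" for t
      proof -
        have "((\<lambda>u. f ((q + t *\<^sub>R c) + u *\<^sub>R c)) has_real_derivative pd c f (q + t *\<^sub>R c)) (at 0)"
          using smooth_on_has_pd[OF f c that] .
        then have "((\<lambda>u. g (u + t)) has_real_derivative pd c f (q + t *\<^sub>R c)) (at 0)"
          by (simp add: g_def algebra_simps)
        then show ?thesis using DERIV_shift[of g _ 0 t] by simp
      qed
      \<comment> \<open>Rescaling to \<open>[0, 1]\<close> lets the mean value theorem apply
        whatever the sign of \<open>h \<bullet> c\<close>.\<close>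
      define k where "k = (\<lambda>\<tau>. g (\<tau> * (h \<bullet> c)))"
      have kd: "(k has_real_derivative pd c f (q + (\<tau> * (h \<bullet> c)) *\<^sub>R c) * (h \<bullet> c)) (at \<tau>)"
        if "0 \<le> \<tau>" "\<tau> \<le> 1" for \<tau>
        unfolding k_def
        using dd[OF near[OF that] c]
        by (intro DERIV_chain'[where f = "\<lambda>\<tau>. \<tau> * (h \<bullet> c)" and g = g] gd)
           (auto intro!: derivative_eq_intros)
      obtain \<tau> where \<tau>: "0 < \<tau>" "\<tau> < 1" and
        k1: "k 1 - k 0 = (1 - 0) * (pd c f (q + (\<tau> * (h \<bullet> c)) *\<^sub>R c) * (h \<bullet> c))"
        using MVT2[of 0 1 k "\<lambda>\<tau>. pd c f (q + (\<tau> * (h \<bullet> c)) *\<^sub>R c) * (h \<bullet> c)"] kd by auto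
      have "k 1 - k 0 - (h \<bullet> c) * pd c f p
          = (pd c f (q + (\<tau> * (h \<bullet> c)) *\<^sub>R c) - pd c f p) * (h \<bullet> c)"
        by (simp add: k1 algebra_simps)
      also have "\<bar>\<dots>\<bar> \<le> e' * norm h"
        unfolding abs_mult using dd[OF near[of \<tau>] c] \<tau> Basis_le_norm[OF c, of h] e'
        by (intro mult_mono) auto
      finally have 1: "\<bar>k 1 - k 0 - (h \<bullet> c) * pd c f p\<bar> \<le> e' * norm h" .
      have 2: "\<bar>k 0 - f p - (\<Sum>b\<in>B. (h \<bullet> b) * pd b f p)\<bar> \<le> card B * e' * norm h"
        using insert.IH[OF B] by (simp add: k_def g_def q_def)
      have 3: "f (p + (\<Sum>b\<in>insert c B. (h \<bullet> b) *\<^sub>R b)) = k 1"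
        using insert by (simp add: k_def g_def q_def algebra_simps)
      show ?case using 1 2 insert(1,2) unfolding 3 by (simp add: algebra_simps)
    qed simp
    have "p + (\<Sum>b\<in>Basis. (h \<bullet> b) *\<^sub>R b) = y" by (simp add: h_def euclidean_representation)
    with *[of Basis] show "norm (f y - f p - (\<Sum>b\<in>Basis. ((y - p) \<bullet> b) * pd b f p)) \<le> e * norm (y - p)"
      by (simp add: h_def e'_def)
  qed
qed

end

section \<open>Symmetry of mixed partial derivatives\<close>

lemma smooth_on_line:
  assumes f: "smooth_on S f" and v: "v \<in> Basis" and q: "q + t *\<^sub>R v \<in> S"
  shows "((\<lambda>\<tau>. f (q + \<tau> *\<^sub>R v)) has_real_derivative pd v f (q + t *\<^sub>R v)) (at t)"
proof -
  have "((\<lambda>u. f ((q + t *\<^sub>R v) + u *\<^sub>R v)) has_real_derivative pd v f (q + t *\<^sub>R v)) (at 0)"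
    using smooth_on_has_pd[OF f v q] .
  then have "((\<lambda>u. (\<lambda>\<tau>. f (q + \<tau> *\<^sub>R v)) (u + t)) has_real_derivative pd v f (q + t *\<^sub>R v)) (at 0)"
    by (simp add: algebra_simps)
  then show ?thesis using DERIV_shift[of "\<lambda>\<tau>. f (q + \<tau> *\<^sub>R v)" _ 0 t] by simp
qed

text \<open>Two applications of the mean value theorem, in \<open>v\<close> and then in
  \<open>w\<close>. The second difference is symmetric in \<open>v\<close> and \<open>w\<close>,
  which is what the comparison of the mixed derivatives exploits.\<close>

lemma smooth_on_second_difference:
  assumes f: "smooth_on S f" and v: "v \<in> Basis" and w: "w \<in> Basis" and h: "h > 0"
    and sub: "\<And>a b. 0 \<le> a \<Longrightarrow> a \<le> h \<Longrightarrow> 0 \<le> b \<Longrightarrow> b \<le> h \<Longrightarrow> p + a *\<^sub>R v + b *\<^sub>R w \<in> S"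
  obtains a b where "0 < a" "a < h" "0 < b" "b < h"
    "f (p + h *\<^sub>R v + h *\<^sub>R w) - f (p + h *\<^sub>R v) - f (p + h *\<^sub>R w) + f p
      = h * h * pd w (pd v f) (p + a *\<^sub>R v + b *\<^sub>R w)"
proof -
  define k where "k = (\<lambda>a. f ((p + h *\<^sub>R w) + a *\<^sub>R v) - f (p + a *\<^sub>R v))"
  have kd: "(k has_real_derivative pd v f ((p + h *\<^sub>R w) + a *\<^sub>R v) - pd v f (p + a *\<^sub>R v)) (at a)"
    if "0 \<le> a" "a \<le> h" for a
    unfolding k_def using sub[OF that, of h] sub[OF that, of 0] h
    by (intro DERIV_diff smooth_on_line[OF f v]) (simp_all add: ac_simps)
  obtain a where a: "0 < a" "a < h"
    and ka: "k h - k 0 = (h - 0) * (pd v f ((p + h *\<^sub>R w) + a *\<^sub>R v) - pd v f (p + a *\<^sub>R v))"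
    using MVT2[OF h kd] by auto
  have fd: "((\<lambda>b. pd v f ((p + a *\<^sub>R v) + b *\<^sub>R w)) has_real_derivative
      pd w (pd v f) ((p + a *\<^sub>R v) + b *\<^sub>R w)) (at b)" if "0 \<le> b" "b \<le> h" for b
    using sub[of a b] a that by (intro smooth_on_line[OF smooth_on_pd[OF f v] w]) auto
  obtain b where b: "0 < b" "b < h"
    and kb: "pd v f ((p + a *\<^sub>R v) + h *\<^sub>R w) - pd v f ((p + a *\<^sub>R v) + 0 *\<^sub>R w)
      = (h - 0) * pd w (pd v f) ((p + a *\<^sub>R v) + b *\<^sub>R w)"
    using MVT2[OF h fd] by auto
  have "f (p + h *\<^sub>R v + h *\<^sub>R w) - f (p + h *\<^sub>R v) - f (p + h *\<^sub>R w) + f p = k h - k 0"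
    by (simp add: k_def ac_simps)
  also have "\<dots> = h * h * pd w (pd v f) (p + a *\<^sub>R v + b *\<^sub>R w)"
    using kb unfolding ka by (simp add: ac_simps)
  finally show ?thesis using that a b by blast
qed

lemma pd_commute:
  assumes S: "open S" and f: "smooth_on S f" and v: "v \<in> Basis" and w: "w \<in> Basis" and p: "p \<in> S"
  shows "pd v (pd w f) p = pd w (pd v f) p"
proof (rule ccontr)
  assume ne: "pd v (pd w f) p \<noteq> pd w (pd v f) p"
  \<comment> \<open>Half of the gap: two values closer than \<open>e\<close> to the respective
    derivatives cannot coincide.\<close>
  define e where "e = \<bar>pd v (pd w f) p - pd w (pd v f) p\<bar> / 2"
  have e: "e > 0" using ne by (simp add: e_def)
  have lim: "\<forall>\<^sub>F q in nhds p. \<bar>g q - g p\<bar> < e" if "smooth_on S g" for g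
  proof -
    have "isCont g p"
      using S p smooth_on_continuous[OF that] continuous_on_eq_continuous_at by blast
    then have "(g \<longlongrightarrow> g p) (nhds p)" by (simp add: isCont_def tendsto_at_iff_tendsto_nhds)
    then show ?thesis using e by (auto simp: tendsto_iff dist_real_def)
  qed
  have "\<forall>\<^sub>F q in nhds p. q \<in> S \<and> \<bar>pd v (pd w f) q - pd v (pd w f) p\<bar> < e
      \<and> \<bar>pd w (pd v f) q - pd w (pd v f) p\<bar> < e"
    using S p f v w by (intro eventually_conj lim eventually_nhds_in_open smooth_on_pd)
  then obtain d where d: "d > 0" and dd: "\<And>q. dist q p < d \<Longrightarrow> q \<in> S \<and>
      \<bar>pd v (pd w f) q - pd v (pd w f) p\<bar> < e \<and> \<bar>pd w (pd v f) q - pd w (pd v f) p\<bar> < e"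
    unfolding eventually_nhds_metric by blast
  define h where "h = d / 3"
  have h: "h > 0" using d by (simp add: h_def)
  have near: "dist (p + a *\<^sub>R x + b *\<^sub>R y) p < d"
    if "0 \<le> a" "a \<le> h" "0 \<le> b" "b \<le> h" "x \<in> Basis" "y \<in> Basis" for a b and x y :: 'a
  proof -
    have "dist (p + a *\<^sub>R x + b *\<^sub>R y) p \<le> norm (a *\<^sub>R x) + norm (b *\<^sub>R y)"
      using norm_triangle_ineq[of "a *\<^sub>R x" "b *\<^sub>R y"] by (simp add: dist_norm add.assoc)
    also have "\<dots> \<le> h + h" using that by simp
    also have "\<dots> < d" using d by (simp add: h_def)
    finally show ?thesis .
  qed
  obtain a b where 1: "0 < a" "a < h" "0 < b" "b < h"
    "f (p + h *\<^sub>R v + h *\<^sub>R w) - f (p + h *\<^sub>R v) - f (p + h *\<^sub>R w) + f p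
      = h * h * pd w (pd v f) (p + a *\<^sub>R v + b *\<^sub>R w)"
    by (rule smooth_on_second_difference[OF f v w h, of p]) (use dd near v w in blast)+
  obtain a' b' where 2: "0 < a'" "a' < h" "0 < b'" "b' < h"
    "f (p + h *\<^sub>R w + h *\<^sub>R v) - f (p + h *\<^sub>R w) - f (p + h *\<^sub>R v) + f p
      = h * h * pd v (pd w f) (p + a' *\<^sub>R w + b' *\<^sub>R v)"
    by (rule smooth_on_second_difference[OF f w v h, of p]) (use dd near v w in blast)+
  have "h * h * pd w (pd v f) (p + a *\<^sub>R v + b *\<^sub>R w) = h * h * pd v (pd w f) (p + a' *\<^sub>R w + b' *\<^sub>R v)"
    using 1(5) 2(5) unfolding add.assoc[of p] add.commute[of "h *\<^sub>R w"] by linarith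
  then have "pd w (pd v f) (p + a *\<^sub>R v + b *\<^sub>R w) = pd v (pd w f) (p + a' *\<^sub>R w + b' *\<^sub>R v)"
    using h by simp
  moreover have "\<bar>pd w (pd v f) (p + a *\<^sub>R v + b *\<^sub>R w) - pd w (pd v f) p\<bar> < e"
    using dd[OF near[of a b v w]] 1 v w by auto
  moreover have "\<bar>pd v (pd w f) (p + a' *\<^sub>R w + b' *\<^sub>R v) - pd v (pd w f) p\<bar> < e"
    using dd[OF near[of a' b' w v]] 2 v w by auto
  ultimately show False unfolding e_def by (simp add: abs_if split: if_splits)
qed

section \<open>Smooth functions of \<open>(t, r, s, z)\<close>\<close>

abbreviation (input) smooth4 :: "(real \<times> real \<times> real \<times> real) set \<Rightarrow> fn4 \<Rightarrow> bool" where
  "smooth4 S \<Theta> \<equiv> smooth_on S (\<lambda>(t, r, s, z). \<Theta> t r s z)"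

lemma deriv_shift_at:
  fixes f :: "real \<Rightarrow> real"
  shows "deriv (\<lambda>a. f (x + a)) 0 = deriv f x"
  using DERIV_shift[of f _ 0 x] by (simp add: deriv_def add.commute)

text \<open>Both sides are the same \<open>deriv\<close> up to a shift of its argument. Being an
  equality of functions, it rewrites iterated derivatives and transfers smoothness to
  \<open>d0 \<Theta>\<close>, \<open>dr \<Theta>\<close>, \<open>ds \<Theta>\<close> and
  \<open>dz \<Theta>\<close>.\<close>

lemma pd_fn4:
  "pd (1, 0, 0, 0) (\<lambda>(t, r, s, z). \<Theta> t r s z) = (\<lambda>(t, r, s, z). d0 \<Theta> t r s z)"
  "pd (0, 1, 0, 0) (\<lambda>(t, r, s, z). \<Theta> t r s z) = (\<lambda>(t, r, s, z). dr \<Theta> t r s z)"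
  "pd (0, 0, 1, 0) (\<lambda>(t, r, s, z). \<Theta> t r s z) = (\<lambda>(t, r, s, z). ds \<Theta> t r s z)"
  "pd (0, 0, 0, 1) (\<lambda>(t, r, s, z). \<Theta> t r s z) = (\<lambda>(t, r, s, z). dz \<Theta> t r s z)"
  unfolding pd_def d0_def dr_def ds_def dz_def
  by (auto simp: deriv_shift_at[of "\<lambda>a. \<Theta> a _ _ _"] deriv_shift_at[of "\<lambda>a. \<Theta> _ a _ _"]
    deriv_shift_at[of "\<lambda>a. \<Theta> _ _ a _"] deriv_shift_at[of "\<lambda>a. \<Theta> _ _ _ a"])

lemma Basis4:
  "(Basis :: (real \<times> real \<times> real \<times> real) set) = {(1,0,0,0), (0,1,0,0), (0,0,1,0), (0,0,0,1)}"
  by (auto simp: Basis_prod_def zero_prod_def)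

locale open4 =
  fixes S :: "(real \<times> real \<times> real \<times> real) set"
  assumes S: "open S"
begin

abbreviation sm :: "fn4 \<Rightarrow> bool" where "sm \<equiv> smooth4 S"

lemma sm_const: "sm (\<lambda>t r s z. c)"
  using smooth_on_const[OF S, of c] by (simp add: case_prod_unfold)

lemma sm_coords: "sm (\<lambda>t r s z. t)" "sm (\<lambda>t r s z. r)" "sm (\<lambda>t r s z. s)" "sm (\<lambda>t r s z. z)"
  by (auto intro!: smooth_on_linear[OF S] bounded_linear_intros
      bounded_linear_compose[OF bounded_linear_fst] bounded_linear_compose[OF bounded_linear_snd]
      simp: case_prod_unfold)

lemma sm_add: "sm \<Theta> \<Longrightarrow> sm \<Xi> \<Longrightarrow> sm (\<lambda>t r s z. \<Theta> t r s z + \<Xi> t r s z)"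
  using smooth_on_add[OF S, of "\<lambda>(t, r, s, z). \<Theta> t r s z" "\<lambda>(t, r, s, z). \<Xi> t r s z"]
  by (simp add: case_prod_unfold)

lemma sm_diff: "sm \<Theta> \<Longrightarrow> sm \<Xi> \<Longrightarrow> sm (\<lambda>t r s z. \<Theta> t r s z - \<Xi> t r s z)"
  using smooth_on_diff[OF S, of "\<lambda>(t, r, s, z). \<Theta> t r s z" "\<lambda>(t, r, s, z). \<Xi> t r s z"]
  by (simp add: case_prod_unfold)

lemma sm_mult: "sm \<Theta> \<Longrightarrow> sm \<Xi> \<Longrightarrow> sm (\<lambda>t r s z. \<Theta> t r s z * \<Xi> t r s z)"
  using smooth_on_mult[OF S, of "\<lambda>(t, r, s, z). \<Theta> t r s z" "\<lambda>(t, r, s, z). \<Xi> t r s z"]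
  by (simp add: case_prod_unfold)

lemma sm_power: "sm \<Theta> \<Longrightarrow> sm (\<lambda>t r s z. \<Theta> t r s z ^ k)"
  using smooth_on_power[OF S, of "\<lambda>(t, r, s, z). \<Theta> t r s z" k]
  by (simp add: case_prod_unfold)

lemma sm_divide:
  "sm \<Theta> \<Longrightarrow> sm \<Xi> \<Longrightarrow> (\<And>t r s z. (t, r, s, z) \<in> S \<Longrightarrow> \<Xi> t r s z \<noteq> 0) \<Longrightarrow>
   sm (\<lambda>t r s z. \<Theta> t r s z / \<Xi> t r s z)"
  using smooth_on_divide[OF S, of "\<lambda>(t, r, s, z). \<Theta> t r s z" "\<lambda>(t, r, s, z). \<Xi> t r s z"]
  by (force simp: case_prod_unfold)

lemma sm_d: assumes "sm \<Theta>" shows "sm (d0 \<Theta>)" "sm (dr \<Theta>)" "sm (ds \<Theta>)" "sm (dz \<Theta>)"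
  using smooth_on_pd[OF assms, of "(1,0,0,0)"] smooth_on_pd[OF assms, of "(0,1,0,0)"]
    smooth_on_pd[OF assms, of "(0,0,1,0)"] smooth_on_pd[OF assms, of "(0,0,0,1)"]
  by (simp_all add: Basis4 pd_fn4)

lemmas sm_intros = sm_const sm_coords sm_add sm_diff sm_mult sm_power sm_divide sm_d

lemma sm_DERIV:
  assumes "sm \<Theta>" "(t, r, s, z) \<in> S"
  shows "((\<lambda>a. \<Theta> a r s z) has_real_derivative d0 \<Theta> t r s z) (at t)"
    "((\<lambda>a. \<Theta> t a s z) has_real_derivative dr \<Theta> t r s z) (at r)"
    "((\<lambda>a. \<Theta> t r a z) has_real_derivative ds \<Theta> t r s z) (at s)"
    "((\<lambda>a. \<Theta> t r s a) has_real_derivative dz \<Theta> t r s z) (at z)"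
  using smooth_on_line[OF assms(1), of "(1,0,0,0)" "(0, r, s, z)" t]
    smooth_on_line[OF assms(1), of "(0,1,0,0)" "(t, 0, s, z)" r]
    smooth_on_line[OF assms(1), of "(0,0,1,0)" "(t, r, 0, z)" s]
    smooth_on_line[OF assms(1), of "(0,0,0,1)" "(t, r, s, 0)" z] assms(2)
  by (simp_all add: pd_fn4 Basis4)

lemma sm_commute:
  assumes "sm \<Theta>" "(t, r, s, z) \<in> S"
  shows "ds (d0 \<Theta>) t r s z = d0 (ds \<Theta>) t r s z" "ds (dr \<Theta>) t r s z = dr (ds \<Theta>) t r s z"
    "dz (d0 \<Theta>) t r s z = d0 (dz \<Theta>) t r s z" "dz (dr \<Theta>) t r s z = dr (dz \<Theta>) t r s z"
    "dz (ds \<Theta>) t r s z = ds (dz \<Theta>) t r s z"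
  using pd_commute[OF S assms(1) _ _ assms(2), of "(0,0,1,0)" "(1,0,0,0)"]
    pd_commute[OF S assms(1) _ _ assms(2), of "(0,0,1,0)" "(0,1,0,0)"]
    pd_commute[OF S assms(1) _ _ assms(2), of "(0,0,0,1)" "(1,0,0,0)"]
    pd_commute[OF S assms(1) _ _ assms(2), of "(0,0,0,1)" "(0,1,0,0)"]
    pd_commute[OF S assms(1) _ _ assms(2), of "(0,0,0,1)" "(0,0,1,0)"]
  by (simp_all add: pd_fn4 Basis4)

lemma sm_chain:
  assumes \<Theta>: "sm \<Theta>" and p: "(a x, b x, c x, d x) \<in> S"
    and "(a has_real_derivative a') (at x)" "(b has_real_derivative b') (at x)"
    "(c has_real_derivative c') (at x)" "(d has_real_derivative d') (at x)"
  shows "((\<lambda>\<tau>. \<Theta> (a \<tau>) (b \<tau>) (c \<tau>) (d \<tau>)) has_real_derivative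
     d0 \<Theta> (a x) (b x) (c x) (d x) * a' + dr \<Theta> (a x) (b x) (c x) (d x) * b'
     + ds \<Theta> (a x) (b x) (c x) (d x) * c' + dz \<Theta> (a x) (b x) (c x) (d x) * d') (at x)"
proof -
  have 1: "((\<lambda>\<tau>. (a \<tau>, b \<tau>, c \<tau>, d \<tau>)) has_derivative (\<lambda>h. (h * a', h * b', h * c', h * d'))) (at x)"
    using assms(3-) unfolding has_field_derivative_def
    by (auto intro!: derivative_eq_intros simp: fun_eq_iff mult.commute)
  have "((\<lambda>\<tau>. (\<lambda>(t, r, s, z). \<Theta> t r s z) (a \<tau>, b \<tau>, c \<tau>, d \<tau>)) has_derivative
     (\<lambda>h. \<Sum>k\<in>Basis. ((h * a', h * b', h * c', h * d') \<bullet> k) *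
        pd k (\<lambda>(t, r, s, z). \<Theta> t r s z) (a x, b x, c x, d x))) (at x)"
    by (rule has_derivative_compose[OF 1 smooth_on_has_derivative[OF S \<Theta> p]])
  then show ?thesis
    unfolding has_field_derivative_def
    unfolding prod.case
    by (rule has_derivative_eq_rhs) (simp add: Basis4 pd_fn4 fun_eq_iff algebra_simps)
qed

end

subsection \<open>Cylindrical coordinates\<close>

lemma sum_option:
  fixes f :: "'n::finite option \<Rightarrow> 'a::comm_monoid_add"
  shows "(\<Sum>A\<in>UNIV. f A) = f None + (\<Sum>i\<in>UNIV. f (Some i))"
  by (simp add: UNIV_option_conv sum.reindex)

definition un :: "('n::finite) pt \<Rightarrow> real" where "un y = norm (bar y)"
definition cs :: "('n::finite) pt \<Rightarrow> 'n pt \<Rightarrow> real" where "cs x y = inner (bar x) (bar y) / norm (bar y)"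
definition cz :: "('n::finite) pt \<Rightarrow> real" where "cz y = y $ None / norm (bar y)"

definition cyl :: "fn4 \<Rightarrow> ('n::finite) fn" where
  "cyl \<Theta> x y = \<Theta> (x $ None) (un x) (cs x y) (cz y)"

lemma ex_nth: "ex A $ B = (if A = B then 1 else 0)"
  by (simp add: ex_def axis_def)

lemma bar_nth: "bar x $ i = x $ Some i"
  by (simp add: bar_def)

lemma bar_line_None: "bar (y + \<epsilon> *\<^sub>R ex None) = bar y"
  by (simp add: bar_def vec_eq_iff ex_nth)

lemma bar_line_Some: "bar (y + \<epsilon> *\<^sub>R ex (Some i)) = bar y + \<epsilon> *\<^sub>R axis i 1"
  by (simp add: bar_def vec_eq_iff ex_nth axis_def)

lemma continuous_on_bar: "continuous_on T f \<Longrightarrow> continuous_on T (\<lambda>p. bar (f p))"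
  unfolding bar_def by (intro continuous_intros)

lemma inner_bar: "bar x \<bullet> bar y = (\<Sum>i\<in>UNIV. x $ Some i * y $ Some i)"
  by (simp add: inner_vec_def bar_nth)

lemma DERIV_norm_line:
  fixes b :: "real ^ 'n"
  assumes "b \<noteq> 0"
  shows "((\<lambda>\<epsilon>. norm (b + \<epsilon> *\<^sub>R axis i 1)) has_real_derivative b $ i / norm b) (at 0)"
proof -
  have "norm (b + \<epsilon> *\<^sub>R axis i 1) = sqrt (norm b ^ 2 + 2 * \<epsilon> * b $ i + \<epsilon>\<^sup>2)" for \<epsilon>
    unfolding norm_eq_sqrt_inner
    by (simp add: inner_add_left inner_add_right inner_axis inner_axis' power2_eq_square algebra_simps
      inner_commute)
  moreover have "((\<lambda>\<epsilon>. sqrt (norm b ^ 2 + 2 * \<epsilon> * b $ i + \<epsilon>\<^sup>2)) has_real_derivative b $ i / norm b) (at 0)"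
    using assms by (auto intro!: derivative_eq_intros simp: field_simps)
  ultimately show ?thesis by simp
qed

locale cyl_region =
  fixes I :: "real set" and \<rho> :: real
  assumes open_I: "open I"
begin

abbreviation Reg :: "(real \<times> real \<times> real \<times> real) set" where "Reg \<equiv> phi_region I \<rho>"

lemma open_Reg: "open Reg"
proof -
  have "Reg = (fst -` I) \<inter> {p. 0 < fst (snd p)} \<inter> {p. fst (snd p) < \<rho>} \<inter>
      {p. \<bar>fst (snd (snd p))\<bar> < fst (snd p)}"
    by (auto simp: phi_region_def)
  then show ?thesis
    using open_I
    by (auto intro!: open_Int open_vimage open_Collect_less continuous_intros)
qed

sublocale open4 Reg
  by unfold_locales (rule open_Reg)

text \<open>Strict Cauchy-Schwarz expresses linear independence of the bar-parts. This form makes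
  openness of the condition and \<open>|s| < r\<close> immediate.\<close>

definition gen :: "('n::finite) pt \<Rightarrow> 'n pt \<Rightarrow> bool" where
  "gen x y \<longleftrightarrow> x \<in> cyl_domain I \<rho> \<and> \<bar>bar x \<bullet> bar y\<bar> < norm (bar x) * norm (bar y)"

lemma gen_nonzero:
  assumes "gen x y"
  shows "bar x \<noteq> 0" "bar y \<noteq> 0" "un x > 0" "un y > 0"
  using assms unfolding gen_def un_def by auto

lemma gen_region:
  assumes "gen x y"
  shows "(x $ None, un x, cs x y, cz y) \<in> Reg"
proof -
  have "\<bar>cs x y\<bar> < un x"
    using assms gen_nonzero[OF assms]
    by (simp add: gen_def cs_def un_def abs_divide pos_divide_less_eq)
  then show ?thesis
    using assms gen_nonzero[OF assms] by (simp add: gen_def phi_region_def cyl_domain_def un_def)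
qed

lemma open_gen: "open {(x, y). gen x (y :: 'n::finite pt)}"
proof -
  have "{(x, y). gen x (y :: 'n pt)} = ((\<lambda>p. fst p $ None) -` I) \<inter> {p. norm (bar (fst p)) < \<rho>} \<inter>
     {p. \<bar>bar (fst p) \<bullet> bar (snd p)\<bar> < norm (bar (fst p)) * norm (bar (snd p))}"
    by (auto simp: gen_def cyl_domain_def)
  then show ?thesis
    using open_I
    by (auto intro!: open_Int open_vimage open_Collect_less continuous_intros continuous_on_bar)
qed

lemma gen_line_y: "gen x y \<Longrightarrow> \<forall>\<^sub>F \<epsilon> in nhds 0. gen x (y + \<epsilon> *\<^sub>R v)"
  using eventually_line_in_open[OF open_gen, of "(x, y)" "(0, v)"] by simp

lemma gen_line_x: "gen x y \<Longrightarrow> \<forall>\<^sub>F \<epsilon> in nhds 0. gen (x + \<epsilon> *\<^sub>R v) y"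
  using eventually_line_in_open[OF open_gen, of "(x, y)" "(v, 0)"] by simp

lemma dY_cong:
  assumes "\<And>y. gen x y \<Longrightarrow> H x y = H' x y" "gen x y"
  shows "dY A H x y = dY A H' x y"
  unfolding dY_def
  by (rule deriv_cong_ev, rule eventually_mono[OF gen_line_y[OF assms(2)]]) (use assms(1) in auto)

lemma dX_cong:
  assumes "\<And>x y. gen x y \<Longrightarrow> H x y = H' x y" "gen x y"
  shows "dX A H x y = dX A H' x y"
  unfolding dX_def
  by (rule deriv_cong_ev, rule eventually_mono[OF gen_line_x[OF assms(2)]]) (use assms(1) in auto)

lemma gen_identities:
  assumes "gen x y"
  shows "y $ None = cz y * un y" "(\<Sum>i\<in>UNIV. x $ Some i * y $ Some i) = cs x y * un y"
    "(\<Sum>i\<in>UNIV. x $ Some i * x $ Some i) = (un x)\<^sup>2" "(\<Sum>i\<in>UNIV. y $ Some i * y $ Some i) = (un y)\<^sup>2"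
  using gen_nonzero[OF assms]
  by (simp_all add: cz_def cs_def un_def inner_bar[symmetric] dot_square_norm)

section \<open>First derivatives of \<open>un\<close>, \<open>cs\<close>, \<open>cz\<close> and of
  functions of them\<close>

lemma DY_un:
  "gen x y \<Longrightarrow> ((\<lambda>\<epsilon>. un (y + \<epsilon> *\<^sub>R ex None)) has_real_derivative 0) (at 0)"
  "gen x y \<Longrightarrow> ((\<lambda>\<epsilon>. un (y + \<epsilon> *\<^sub>R ex (Some i))) has_real_derivative y $ Some i / un y) (at 0)"
  using gen_nonzero[of x y] DERIV_norm_line[of "bar y" i]
  by (simp_all add: un_def bar_line_None bar_line_Some bar_nth)

lemma DX_un:
  "gen x y \<Longrightarrow> ((\<lambda>\<epsilon>. un (x + \<epsilon> *\<^sub>R ex None)) has_real_derivative 0) (at 0)"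
  "gen x y \<Longrightarrow> ((\<lambda>\<epsilon>. un (x + \<epsilon> *\<^sub>R ex (Some i))) has_real_derivative x $ Some i / un x) (at 0)"
  using gen_nonzero[of x y] DERIV_norm_line[of "bar x" i]
  by (simp_all add: un_def bar_line_None bar_line_Some bar_nth)

lemma nth_line: "((\<lambda>\<epsilon>. (y + \<epsilon> *\<^sub>R ex A) $ B) has_real_derivative (if A = B then 1 else 0)) (at 0)"
proof -
  have "((\<lambda>\<epsilon>. y $ B + \<epsilon> * ex A $ B) has_real_derivative ex A $ B) (at 0)"
    by (auto intro!: derivative_eq_intros)
  then show ?thesis by (simp add: ex_nth)
qed

lemma cs_un: "cs x y = (bar x \<bullet> bar y) / un y" and cz_un: "cz y = y $ None / un y"
  by (simp_all add: cs_def cz_def un_def)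

text \<open>The quotient \<open>f a / g a\<close> is kept intact in the derivative because
  \<open>cs\<close> and \<open>cz\<close> are such quotients and should reappear.\<close>

lemma DERIV_divide_at:
  assumes "(f has_real_derivative f') (at a)" "(g has_real_derivative g') (at a)" "g a \<noteq> 0"
  shows "((\<lambda>x. f x / g x) has_real_derivative f' / g a - f a / g a * g' / g a) (at a)"
  using DERIV_divide[OF assms] assms(3) by (simp add: field_simps)

lemma DY_cs:
  assumes "gen x y"
  shows "((\<lambda>\<epsilon>. cs x (y + \<epsilon> *\<^sub>R ex None)) has_real_derivative 0) (at 0)"
    "((\<lambda>\<epsilon>. cs x (y + \<epsilon> *\<^sub>R ex (Some i))) has_real_derivative
      (x $ Some i - cs x y * y $ Some i / un y) / un y) (at 0)"
proof -
  show "((\<lambda>\<epsilon>. cs x (y + \<epsilon> *\<^sub>R ex None)) has_real_derivative 0) (at 0)"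
    by (simp add: cs_def bar_line_None)
  have "((\<lambda>\<epsilon>. bar x \<bullet> bar y + \<epsilon> * x $ Some i) has_real_derivative x $ Some i) (at 0)"
    by (auto intro!: derivative_eq_intros)
  then have "((\<lambda>\<epsilon>. bar x \<bullet> bar (y + \<epsilon> *\<^sub>R ex (Some i))) has_real_derivative x $ Some i) (at 0)"
    by (simp add: bar_line_Some inner_add_right inner_axis bar_nth)
  from DERIV_divide_at[OF this DY_un(2)[OF assms, of i]] gen_nonzero[OF assms]
  show "((\<lambda>\<epsilon>. cs x (y + \<epsilon> *\<^sub>R ex (Some i))) has_real_derivative
      (x $ Some i - cs x y * y $ Some i / un y) / un y) (at 0)"
    by (simp add: cs_un diff_divide_distrib)
qed

lemma DX_cs:
  assumes "gen x y"
  shows "((\<lambda>\<epsilon>. cs (x + \<epsilon> *\<^sub>R ex None) y) has_real_derivative 0) (at 0)"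
    "((\<lambda>\<epsilon>. cs (x + \<epsilon> *\<^sub>R ex (Some i)) y) has_real_derivative y $ Some i / un y) (at 0)"
proof -
  show "((\<lambda>\<epsilon>. cs (x + \<epsilon> *\<^sub>R ex None) y) has_real_derivative 0) (at 0)"
    by (simp add: cs_def bar_line_None)
  have "((\<lambda>\<epsilon>. (bar x \<bullet> bar y + \<epsilon> * y $ Some i) / un y) has_real_derivative y $ Some i / un y) (at 0)"
    using gen_nonzero[OF assms] by (auto intro!: derivative_eq_intros)
  then show "((\<lambda>\<epsilon>. cs (x + \<epsilon> *\<^sub>R ex (Some i)) y) has_real_derivative y $ Some i / un y) (at 0)"
    by (simp add: cs_un bar_line_Some inner_add_left inner_axis' bar_nth)
qed

lemma DY_cz:
  assumes "gen x y"
  shows "((\<lambda>\<epsilon>. cz (y + \<epsilon> *\<^sub>R ex None)) has_real_derivative 1 / un y) (at 0)"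
    "((\<lambda>\<epsilon>. cz (y + \<epsilon> *\<^sub>R ex (Some i))) has_real_derivative - cz y * y $ Some i / un y / un y) (at 0)"
  using DERIV_divide_at[OF nth_line[of y None None] DY_un(1)[OF assms]]
    DERIV_divide_at[OF nth_line[of y "Some i" None] DY_un(2)[OF assms]] gen_nonzero[OF assms]
  by (simp_all add: cz_un)

lemma DY_cyl:
  assumes "sm \<Theta>" "gen x y"
  shows "((\<lambda>\<epsilon>. cyl \<Theta> x (y + \<epsilon> *\<^sub>R ex None)) has_real_derivative cyl (dz \<Theta>) x y / un y) (at 0)"
    "((\<lambda>\<epsilon>. cyl \<Theta> x (y + \<epsilon> *\<^sub>R ex (Some i))) has_real_derivative
      (cyl (ds \<Theta>) x y * (x $ Some i - cs x y * y $ Some i / un y)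
        - cyl (dz \<Theta>) x y * cz y * y $ Some i / un y) / un y) (at 0)"
proof -
  note c = sm_chain[OF assms(1) _ DERIV_const DERIV_const DY_cs(1)[OF assms(2)] DY_cz(1)[OF assms(2)]]
  show "((\<lambda>\<epsilon>. cyl \<Theta> x (y + \<epsilon> *\<^sub>R ex None)) has_real_derivative cyl (dz \<Theta>) x y / un y) (at 0)"
    using c[of "x $ None" "un x"] gen_region[OF assms(2)] by (simp add: cyl_def)
  note c = sm_chain[OF assms(1) _ DERIV_const DERIV_const DY_cs(2)[OF assms(2)] DY_cz(2)[OF assms(2)]]
  show "((\<lambda>\<epsilon>. cyl \<Theta> x (y + \<epsilon> *\<^sub>R ex (Some i))) has_real_derivative
      (cyl (ds \<Theta>) x y * (x $ Some i - cs x y * y $ Some i / un y)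
        - cyl (dz \<Theta>) x y * cz y * y $ Some i / un y) / un y) (at 0)"
    using gen_region[OF assms(2)] unfolding cyl_def
    by (intro DERIV_cong[OF c]) (simp_all add: diff_divide_distrib add_divide_distrib algebra_simps)
qed

lemma DX_cyl:
  assumes "sm \<Theta>" "gen x y"
  shows "((\<lambda>\<epsilon>. cyl \<Theta> (x + \<epsilon> *\<^sub>R ex None) y) has_real_derivative cyl (d0 \<Theta>) x y) (at 0)"
    "((\<lambda>\<epsilon>. cyl \<Theta> (x + \<epsilon> *\<^sub>R ex (Some i)) y) has_real_derivative
      cyl (dr \<Theta>) x y * x $ Some i / un x + cyl (ds \<Theta>) x y * y $ Some i / un y) (at 0)"
proof -
  note c = sm_chain[OF assms(1) _ nth_line DX_un(1)[OF assms(2)] DX_cs(1)[OF assms(2)] DERIV_const]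
  show "((\<lambda>\<epsilon>. cyl \<Theta> (x + \<epsilon> *\<^sub>R ex None) y) has_real_derivative cyl (d0 \<Theta>) x y) (at 0)"
    using c[of x None None "cz y"] gen_region[OF assms(2)] by (simp add: cyl_def)
  note c = sm_chain[OF assms(1) _ nth_line DX_un(2)[OF assms(2)] DX_cs(2)[OF assms(2)] DERIV_const]
  show "((\<lambda>\<epsilon>. cyl \<Theta> (x + \<epsilon> *\<^sub>R ex (Some i)) y) has_real_derivative
      cyl (dr \<Theta>) x y * x $ Some i / un x + cyl (ds \<Theta>) x y * y $ Some i / un y) (at 0)"
    using c[of x "Some i" None i i "cz y"] gen_region[OF assms(2)] by (simp add: cyl_def)
qed

text \<open>Origin of \<open>Omega\<close>: in the coefficient of \<open>y $ Some i / un y\<close>,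
  the factor \<open>u\<close> contributes \<open>\<Theta>\<close>, while the denominators of
  \<open>s\<close> and \<open>z\<close> contribute \<open>- s * ds \<Theta>\<close> and
  \<open>- z * dz \<Theta>\<close>.\<close>

lemma DY_un_cyl:
  assumes "sm \<Theta>" "gen x y"
  shows "((\<lambda>\<epsilon>. un (y + \<epsilon> *\<^sub>R ex None) * cyl \<Theta> x (y + \<epsilon> *\<^sub>R ex None)) has_real_derivative
      cyl (dz \<Theta>) x y) (at 0)"
    "((\<lambda>\<epsilon>. un (y + \<epsilon> *\<^sub>R ex (Some i)) * cyl \<Theta> x (y + \<epsilon> *\<^sub>R ex (Some i))) has_real_derivative
      cyl (ds \<Theta>) x y * x $ Some i + cyl (Omega \<Theta>) x y * y $ Some i / un y) (at 0)"
  by (rule DERIV_cong[OF DERIV_mult[OF DY_un(1) DY_cyl(1), OF assms(2) assms]],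
      use gen_nonzero[OF assms(2)] in simp)
     (rule DERIV_cong[OF DERIV_mult[OF DY_un(2) DY_cyl(2), OF assms(2) assms]],
      use gen_nonzero[OF assms(2)] in \<open>simp add: cyl_def Omega_def field_simps\<close>)

text \<open>The counterpart of \<open>Omega\<close> in degree two: the coefficient of
  \<open>y $ Some i\<close> in the derivative of \<open>u^2 \<Theta>\<close>.\<close>

definition Omega2 :: "fn4 \<Rightarrow> fn4" where
  "Omega2 \<Theta> = (\<lambda>t r s z. 2 * \<Theta> t r s z - s * ds \<Theta> t r s z - z * dz \<Theta> t r s z)"

lemma DY_un2_cyl:
  assumes "sm \<Theta>" "gen x y"
  shows "((\<lambda>\<epsilon>. (un (y + \<epsilon> *\<^sub>R ex None))\<^sup>2 * cyl \<Theta> x (y + \<epsilon> *\<^sub>R ex None)) has_real_derivative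
      un y * cyl (dz \<Theta>) x y) (at 0)"
    "((\<lambda>\<epsilon>. (un (y + \<epsilon> *\<^sub>R ex (Some i)))\<^sup>2 * cyl \<Theta> x (y + \<epsilon> *\<^sub>R ex (Some i))) has_real_derivative
      un y * cyl (ds \<Theta>) x y * x $ Some i + cyl (Omega2 \<Theta>) x y * y $ Some i) (at 0)"
  unfolding power2_eq_square mult.assoc[of "un _"]
  by (rule DERIV_cong[OF DERIV_mult[OF DY_un(1) DY_un_cyl(1), OF assms(2) assms]],
      use gen_nonzero[OF assms(2)] in simp)
     (rule DERIV_cong[OF DERIV_mult[OF DY_un(2) DY_un_cyl(2), OF assms(2) assms]],
      use gen_nonzero[OF assms(2)] in \<open>simp add: cyl_def Omega_def Omega2_def field_simps\<close>)

lemma sm_Omega: "sm \<Theta> \<Longrightarrow> sm (Omega \<Theta>)" and sm_Omega2: "sm \<Theta> \<Longrightarrow> sm (Omega2 \<Theta>)"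
  unfolding Omega_def Omega2_def by (intro sm_intros; assumption)+

lemma dY_I: "((\<lambda>\<epsilon>. H x (y + \<epsilon> *\<^sub>R ex A)) has_real_derivative D) (at 0) \<Longrightarrow> dY A H x y = D"
  and dX_I: "((\<lambda>\<epsilon>. H (x + \<epsilon> *\<^sub>R ex A) y) has_real_derivative D) (at 0) \<Longrightarrow> dX A H x y = D"
  by (auto simp: dY_def dX_def intro: DERIV_imp_deriv)

end

section \<open>Derivatives of \<open>Omega\<close> and \<open>vphi\<close>\<close>

context open4
begin

lemma DERIV_Omega:
  assumes "sm \<Theta>" "(t, r, s, z) \<in> S"
  shows "ds (Omega \<Theta>) t r s z = - s * ds (ds \<Theta>) t r s z - z * ds (dz \<Theta>) t r s z"
    "dz (Omega \<Theta>) t r s z = - s * ds (dz \<Theta>) t r s z - z * dz (dz \<Theta>) t r s z"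
    "d0 (Omega \<Theta>) t r s z = d0 \<Theta> t r s z - s * d0 (ds \<Theta>) t r s z - z * d0 (dz \<Theta>) t r s z"
    "dr (Omega \<Theta>) t r s z = dr \<Theta> t r s z - s * dr (ds \<Theta>) t r s z - z * dr (dz \<Theta>) t r s z"
proof -
  note D = sm_DERIV[OF assms] sm_DERIV[OF sm_d(3)[OF assms(1)] assms(2)] sm_DERIV[OF sm_d(4)[OF assms(1)] assms(2)]
  have "((\<lambda>a. Omega \<Theta> t r a z) has_real_derivative - s * ds (ds \<Theta>) t r s z - z * ds (dz \<Theta>) t r s z) (at s)"
    unfolding Omega_def by (rule derivative_eq_intros D refl | simp add: algebra_simps)+
  then show "ds (Omega \<Theta>) t r s z = - s * ds (ds \<Theta>) t r s z - z * ds (dz \<Theta>) t r s z"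
    unfolding ds_def[of "Omega \<Theta>"] by (rule DERIV_imp_deriv)
  have "((\<lambda>a. Omega \<Theta> t r s a) has_real_derivative - s * ds (dz \<Theta>) t r s z - z * dz (dz \<Theta>) t r s z) (at z)"
    unfolding Omega_def
    by (rule derivative_eq_intros D refl | simp add: algebra_simps sm_commute[OF assms])+
  then show "dz (Omega \<Theta>) t r s z = - s * ds (dz \<Theta>) t r s z - z * dz (dz \<Theta>) t r s z"
    unfolding dz_def[of "Omega \<Theta>"] by (rule DERIV_imp_deriv)
  have "((\<lambda>a. Omega \<Theta> a r s z) has_real_derivative
      d0 \<Theta> t r s z - s * d0 (ds \<Theta>) t r s z - z * d0 (dz \<Theta>) t r s z) (at t)"
    unfolding Omega_def by (rule derivative_eq_intros D refl | simp add: algebra_simps)+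
  then show "d0 (Omega \<Theta>) t r s z = d0 \<Theta> t r s z - s * d0 (ds \<Theta>) t r s z - z * d0 (dz \<Theta>) t r s z"
    unfolding d0_def[of "Omega \<Theta>"] by (rule DERIV_imp_deriv)
  have "((\<lambda>a. Omega \<Theta> t a s z) has_real_derivative
      dr \<Theta> t r s z - s * dr (ds \<Theta>) t r s z - z * dr (dz \<Theta>) t r s z) (at r)"
    unfolding Omega_def by (rule derivative_eq_intros D refl | simp add: algebra_simps)+
  then show "dr (Omega \<Theta>) t r s z = dr \<Theta> t r s z - s * dr (ds \<Theta>) t r s z - z * dr (dz \<Theta>) t r s z"
    unfolding dr_def[of "Omega \<Theta>"] by (rule DERIV_imp_deriv)
qed

text \<open>\<open>vphi\<close> is a first-order operator in its argument with coefficients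
  \<open>z\<close> and \<open>s / r\<close>. Differentiating these coefficients yields the extra
  terms; the rest is commutation of derivatives.\<close>

lemma DERIV_vphi:
  assumes "sm \<Theta>" "(t, r, s, z) \<in> S" "r \<noteq> 0"
  shows "ds (vphi \<Theta>) t r s z = dr \<Theta> t r s z / r + vphi (ds \<Theta>) t r s z"
    "dz (vphi \<Theta>) t r s z = d0 \<Theta> t r s z + vphi (dz \<Theta>) t r s z"
proof -
  note D = sm_DERIV[OF sm_d(1)[OF assms(1)] assms(2)] sm_DERIV[OF sm_d(2)[OF assms(1)] assms(2)]
    sm_DERIV[OF sm_d(3)[OF assms(1)] assms(2)]
  have "((\<lambda>a. vphi \<Theta> t r a z) has_real_derivative dr \<Theta> t r s z / r + vphi (ds \<Theta>) t r s z) (at s)"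
    unfolding vphi_def
    by (rule derivative_eq_intros D refl assms(3) | simp add: algebra_simps assms(3) sm_commute[OF assms(1,2)])+
  then show "ds (vphi \<Theta>) t r s z = dr \<Theta> t r s z / r + vphi (ds \<Theta>) t r s z"
    unfolding ds_def[of "vphi \<Theta>"] by (rule DERIV_imp_deriv)
  have "((\<lambda>a. vphi \<Theta> t r s a) has_real_derivative d0 \<Theta> t r s z + vphi (dz \<Theta>) t r s z) (at z)"
    unfolding vphi_def
    by (rule derivative_eq_intros D refl assms(3) | simp add: algebra_simps sm_commute[OF assms(1,2)])+
  then show "dz (vphi \<Theta>) t r s z = d0 \<Theta> t r s z + vphi (dz \<Theta>) t r s z"
    unfolding dz_def[of "vphi \<Theta>"] by (rule DERIV_imp_deriv)
qed

text \<open>The right-hand side contains exactly the two brackets of \<open>Uf\<close> and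
  \<open>Vf\<close>, so the \<open>y\<close>-coefficient of the spray equation introduces no scalar
  beyond these two.\<close>

lemma vphi_Omega:
  assumes "sm \<Theta>" "(t, r, s, z) \<in> S" "r \<noteq> 0"
  shows "vphi (Omega \<Theta>) t r s z = - s * (ds (vphi \<Theta>) t r s z - 2 / r * dr \<Theta> t r s z)
      - z * (dz (vphi \<Theta>) t r s z - 2 * d0 \<Theta> t r s z)"
  unfolding DERIV_vphi[OF assms]
  by (simp add: vphi_def DERIV_Omega[OF assms(1,2)] algebra_simps)
     (use assms(3) in \<open>simp add: field_simps\<close>)

end

context cyl_region
begin

definition DYc :: "fn4 \<Rightarrow> 'n::finite \<Rightarrow> 'n fn" where
  "DYc \<Theta> i x y = (cyl (ds \<Theta>) x y * (x $ Some i - cs x y * y $ Some i / un y)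
        - cyl (dz \<Theta>) x y * cz y * y $ Some i / un y) / un y"

fun DXc :: "fn4 \<Rightarrow> 'n::finite option \<Rightarrow> 'n fn" where
  "DXc \<Theta> None x y = cyl (d0 \<Theta>) x y"
| "DXc \<Theta> (Some i) x y = cyl (dr \<Theta>) x y * x $ Some i / un x + cyl (ds \<Theta>) x y * y $ Some i / un y"

lemma DX_cyl':
  assumes "sm \<Theta>" "gen x y"
  shows "((\<lambda>\<epsilon>. cyl \<Theta> (x + \<epsilon> *\<^sub>R ex C) y) has_real_derivative DXc \<Theta> C x y) (at 0)"
  using DX_cyl[OF assms] by (cases C) auto

lemma sum_lin:
  assumes "gen x y"
  shows "(\<Sum>i\<in>UNIV. (a * x $ Some i + c * y $ Some i) * x $ Some i) = a * (un x)\<^sup>2 + c * (cs x y * un y)"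
    "(\<Sum>i\<in>UNIV. (a * x $ Some i + c * y $ Some i) * y $ Some i) = a * (cs x y * un y) + c * (un y)\<^sup>2"
  using gen_identities[OF assms]
  by (simp_all add: distrib_right sum.distrib mult.assoc sum_distrib_left[symmetric] mult.commute[of "y $ _" "x $ _"])

text \<open>Origin of \<open>vphi\<close>: \<open>u\<close> times \<open>vphi \<Theta>\<close> is
  the derivative of \<open>\<Theta>\<close> with respect to the point, taken in the direction
  \<open>y\<close>.\<close>

lemma sum_DXc:
  assumes "gen x y"
  shows "(\<Sum>C\<in>UNIV. DXc \<Theta> C x y * y $ C) = un y * cyl (vphi \<Theta>) x y"
proof -
  have "(\<Sum>i\<in>UNIV. DXc \<Theta> (Some i) x y * y $ Some i) =
     (\<Sum>i\<in>UNIV. (cyl (dr \<Theta>) x y / un x * x $ Some i + cyl (ds \<Theta>) x y / un y * y $ Some i) * y $ Some i)"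
    by simp
  also have "\<dots> = cyl (dr \<Theta>) x y / un x * (cs x y * un y) + cyl (ds \<Theta>) x y / un y * (un y)\<^sup>2"
    by (rule sum_lin[OF assms])
  finally show ?thesis
    using gen_nonzero[OF assms] gen_identities(1)[OF assms]
    by (simp add: sum_option cyl_def vphi_def power2_eq_square algebra_simps)
qed

end

subsection \<open>The fundamental tensor\<close>

locale cyl_finsler = cyl_region +
  fixes F :: "'n::finite fn" and \<phi> :: fn4
  assumes fins: "finsler_metric (cyl_domain I \<rho>) F"
    and phi_smooth: "smooth_on (phi_region I \<rho>) (\<lambda>(t, r, s, z). \<phi> t r s z)"
    and phi_pos: "\<forall>(t, r, s, z) \<in> phi_region I \<rho>. \<phi> t r s z > 0"
    and cyl_form: "\<forall>x\<in>cyl_domain I \<rho>. \<forall>y. bar y \<noteq> 0 \<longrightarrow>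
                F x y = norm (bar y) * \<phi> (x $ None) (norm (bar x))
                          (inner (bar x) (bar y) / norm (bar y)) (y $ None / norm (bar y))"
begin

lemmas sm_phi = phi_smooth

lemma F_gen: "gen x y \<Longrightarrow> F x y = un y * cyl \<phi> x y"
  using cyl_form gen_nonzero[of x y] by (auto simp: gen_def cyl_def un_def cs_def cz_def)

lemma F_pos: "gen x y \<Longrightarrow> F x y > 0"
  using F_gen[of x y] gen_nonzero[of x y] phi_pos gen_region[of x y] by (auto simp: cyl_def)

text \<open>The closed form of F_{y^A} at generic pairs; \<open>FX\<close> below is that of
  F_{x^A}.\<close>

fun FD :: "'n option \<Rightarrow> 'n fn" where
  "FD None x y = cyl (dz \<phi>) x y"
| "FD (Some i) x y = cyl (ds \<phi>) x y * x $ Some i + cyl (Omega \<phi>) x y * y $ Some i / un y"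

lemma DY_F:
  assumes "gen x y"
  shows "((\<lambda>\<epsilon>. F x (y + \<epsilon> *\<^sub>R ex A)) has_real_derivative FD A x y) (at 0)"
proof -
  have D: "((\<lambda>\<epsilon>. un (y + \<epsilon> *\<^sub>R ex A) * cyl \<phi> x (y + \<epsilon> *\<^sub>R ex A)) has_real_derivative FD A x y) (at 0)"
    using DY_un_cyl[OF sm_phi assms] by (cases A) auto
  have ev: "\<forall>\<^sub>F \<epsilon> in nhds 0. un (y + \<epsilon> *\<^sub>R ex A) * cyl \<phi> x (y + \<epsilon> *\<^sub>R ex A) = F x (y + \<epsilon> *\<^sub>R ex A)"
    by (rule eventually_mono[OF gen_line_y[OF assms, of "ex A"]]) (simp add: F_gen)
  show ?thesis by (rule DERIV_cong_ev[OF refl ev refl, THEN iffD1, OF D])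
qed

fun FX :: "'n option \<Rightarrow> 'n fn" where
  "FX None x y = un y * cyl (d0 \<phi>) x y"
| "FX (Some i) x y = un y * cyl (dr \<phi>) x y / un x * x $ Some i + cyl (ds \<phi>) x y * y $ Some i"

lemma DX_F:
  assumes "gen x y"
  shows "((\<lambda>\<epsilon>. F (x + \<epsilon> *\<^sub>R ex A) y) has_real_derivative FX A x y) (at 0)"
proof -
  have D: "((\<lambda>\<epsilon>. un y * cyl \<phi> (x + \<epsilon> *\<^sub>R ex A) y) has_real_derivative FX A x y) (at 0)"
    using DERIV_cmult[OF DX_cyl'[OF sm_phi assms, of A], of "un y"] gen_nonzero[OF assms]
    by (cases A) (simp_all add: distrib_left mult.assoc)
  have ev: "\<forall>\<^sub>F \<epsilon> in nhds 0. un y * cyl \<phi> (x + \<epsilon> *\<^sub>R ex A) y = F (x + \<epsilon> *\<^sub>R ex A) y"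
    by (rule eventually_mono[OF gen_line_x[OF assms, of "ex A"]]) (simp add: F_gen)
  show ?thesis by (rule DERIV_cong_ev[OF refl ev refl, THEN iffD1, OF D])
qed

text \<open>\<open>FDD A B\<close> is the \<open>y^A\<close>-derivative of \<open>FD B\<close>.\<close>

fun FDD :: "'n option \<Rightarrow> 'n option \<Rightarrow> 'n fn" where
  "FDD None None x y = cyl (dz (dz \<phi>)) x y / un y"
| "FDD (Some i) None x y = DYc (dz \<phi>) i x y"
| "FDD None (Some j) x y = cyl (dz (ds \<phi>)) x y / un y * x $ Some j
     + cyl (dz (Omega \<phi>)) x y / (un y)\<^sup>2 * y $ Some j"
| "FDD (Some i) (Some j) x y = DYc (ds \<phi>) i x y * x $ Some j
     + (DYc (Omega \<phi>) i x y / un y - cyl (Omega \<phi>) x y * y $ Some i / (un y)^3) * y $ Some j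
     + (if i = j then cyl (Omega \<phi>) x y / un y else 0)"

lemma DY_FD:
  assumes "gen x y"
  shows "((\<lambda>\<epsilon>. FD B x (y + \<epsilon> *\<^sub>R ex A)) has_real_derivative FDD A B x y) (at 0)"
proof (cases B)
  case None
  then show ?thesis
    using DY_cyl[OF sm_d(4)[OF sm_phi] assms] by (cases A) (auto simp: DYc_def)
next
  case (Some j)
  have u: "un y \<noteq> 0" using gen_nonzero[OF assms] by simp
  note D = DY_cyl[OF sm_d(3)[OF sm_phi] assms] DY_cyl[OF sm_Omega[OF sm_phi] assms] DY_un[OF assms]
    nth_line
  show ?thesis
  proof (cases A)
    case None
    have "((\<lambda>\<epsilon>. cyl (ds \<phi>) x (y + \<epsilon> *\<^sub>R ex None) * x $ Some j
       + cyl (Omega \<phi>) x (y + \<epsilon> *\<^sub>R ex None) * (y + \<epsilon> *\<^sub>R ex None) $ Some j / un (y + \<epsilon> *\<^sub>R ex None))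
       has_real_derivative FDD None (Some j) x y) (at 0)"
      by (rule DERIV_cong[OF DERIV_add[OF DERIV_cmult_right DERIV_divide_at[OF DERIV_mult]], OF D(1) D(3,7,5)])
         (use u in \<open>auto simp: power2_eq_square\<close>)
    then show ?thesis using Some None by simp
  next
    case (Some i)
    have "((\<lambda>\<epsilon>. cyl (ds \<phi>) x (y + \<epsilon> *\<^sub>R ex (Some i)) * x $ Some j
       + cyl (Omega \<phi>) x (y + \<epsilon> *\<^sub>R ex (Some i)) * (y + \<epsilon> *\<^sub>R ex (Some i)) $ Some j
          / un (y + \<epsilon> *\<^sub>R ex (Some i)))
       has_real_derivative FDD (Some i) (Some j) x y) (at 0)"
      by (rule DERIV_cong[OF DERIV_add[OF DERIV_cmult_right DERIV_divide_at[OF DERIV_mult]], OF D(2) D(4,7,6)])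
         (use u in \<open>auto simp: DYc_def field_simps power3_eq_cube power2_eq_square\<close>)
    then show ?thesis using Some \<open>B = Some j\<close> by simp
  qed
qed

lemma dY_Fsq: "gen x y \<Longrightarrow> dY B (Fsq F) x y = 2 * F x y * FD B x y"
  unfolding Fsq_def power2_eq_square
  by (rule dY_I, rule DERIV_cong[OF DERIV_mult[OF DY_F DY_F]]) auto

lemma dX_Fsq: "gen x y \<Longrightarrow> dX B (Fsq F) x y = 2 * F x y * FX B x y"
  unfolding Fsq_def power2_eq_square
  by (rule dX_I, rule DERIV_cong[OF DERIV_mult[OF DX_F DX_F]]) auto

lemma gmat_gen:
  assumes "gen x y"
  shows "gmat F x y $ A $ B = F x y * FDD A B x y + FD A x y * FD B x y"
proof -
  have "dY A (dY B (Fsq F)) x y = dY A (\<lambda>x y. 2 * F x y * FD B x y) x y"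
    by (rule dY_cong[OF _ assms]) (simp add: dY_Fsq)
  also have "\<dots> = 2 * (F x y * FDD A B x y + FD A x y * FD B x y)"
    by (rule dY_I, rule DERIV_cong[OF DERIV_mult[OF DERIV_cmult[OF DY_F] DY_FD]])
       (use assms in \<open>auto simp: algebra_simps\<close>)
  finally show ?thesis by (simp add: gmat_def)
qed

text \<open>\<open>FXD C A\<close> is the \<open>x^C\<close>-derivative of \<open>FD A\<close>.\<close>

fun FXD :: "'n option \<Rightarrow> 'n option \<Rightarrow> 'n fn" where
  "FXD C None x y = DXc (dz \<phi>) C x y"
| "FXD C (Some j) x y = DXc (ds \<phi>) C x y * x $ Some j + (if C = Some j then cyl (ds \<phi>) x y else 0)
     + DXc (Omega \<phi>) C x y * (y $ Some j / un y)"

lemma DX_FD: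
  assumes "gen x y"
  shows "((\<lambda>\<epsilon>. FD B (x + \<epsilon> *\<^sub>R ex C) y) has_real_derivative FXD C B x y) (at 0)"
proof (cases B)
  case None
  then show ?thesis
    using DX_cyl'[OF sm_d(4)[OF sm_phi] assms] by simp
next
  case (Some j)
  have "((\<lambda>\<epsilon>. cyl (ds \<phi>) (x + \<epsilon> *\<^sub>R ex C) y * (x + \<epsilon> *\<^sub>R ex C) $ Some j
       + cyl (Omega \<phi>) (x + \<epsilon> *\<^sub>R ex C) y * (y $ Some j / un y))
       has_real_derivative FXD C (Some j) x y) (at 0)"
    by (rule DERIV_cong[OF DERIV_add[OF DERIV_mult DERIV_cmult_right],
          OF DX_cyl'[OF sm_d(3)[OF sm_phi] assms] nth_line DX_cyl'[OF sm_Omega[OF sm_phi] assms]]) auto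
  then show ?thesis using Some by simp
qed

lemma dX_dY_Fsq:
  assumes "gen x y"
  shows "dX C (dY A (Fsq F)) x y = 2 * (FX C x y * FD A x y + F x y * FXD C A x y)"
proof -
  have "dX C (dY A (Fsq F)) x y = dX C (\<lambda>x y. 2 * F x y * FD A x y) x y"
    by (rule dX_cong[OF _ assms]) (simp add: dY_Fsq)
  also have "\<dots> = 2 * (FX C x y * FD A x y + F x y * FXD C A x y)"
    by (rule dX_I, rule DERIV_cong[OF DERIV_mult[OF DERIV_cmult[OF DX_F] DX_FD]])
       (use assms in \<open>auto simp: algebra_simps\<close>)
  finally show ?thesis .
qed

text \<open>\<open>alpha\<close> and \<open>beta\<close> are the brackets in \<open>Uf\<close> and
  \<open>Vf\<close>. Up to the factor \<open>u\<close> they are the coefficients of F_{x^C y^A} y^C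
  - F_{x^A} along the bar-part of \<open>x\<close> and in the 0-slot.\<close>

definition alpha :: fn4 where "alpha = (\<lambda>t r s z. ds (vphi \<phi>) t r s z - 2 / r * dr \<phi> t r s z)"
definition beta :: fn4 where "beta = (\<lambda>t r s z. dz (vphi \<phi>) t r s z - 2 * d0 \<phi> t r s z)"

lemma alpha_beta_gen:
  assumes "gen x y"
  shows "cyl (vphi (ds \<phi>)) x y = cyl alpha x y + cyl (dr \<phi>) x y / un x"
    "cyl (vphi (dz \<phi>)) x y = cyl beta x y + cyl (d0 \<phi>) x y"
    "cyl (vphi (Omega \<phi>)) x y = - cs x y * cyl alpha x y - cz y * cyl beta x y"
  using DERIV_vphi[OF sm_phi gen_region[OF assms]] vphi_Omega[OF sm_phi gen_region[OF assms]]
    gen_nonzero[OF assms]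
  by (simp_all add: cyl_def alpha_def beta_def)

lemma sum_FX:
  assumes "gen x y"
  shows "(\<Sum>C\<in>UNIV. FX C x y * y $ C) = (un y)\<^sup>2 * cyl (vphi \<phi>) x y"
proof -
  have "(\<Sum>C\<in>UNIV. FX C x y * y $ C) = un y * (\<Sum>C\<in>UNIV. DXc \<phi> C x y * y $ C)"
    unfolding sum_distrib_left
  proof (rule sum.cong[OF refl])
    fix C show "FX C x y * y $ C = un y * (DXc \<phi> C x y * y $ C)"
      using gen_nonzero[OF assms] by (cases C) (auto simp: algebra_simps)
  qed
  then show ?thesis by (simp add: sum_DXc[OF assms] power2_eq_square)
qed

lemma sum_FXD_None:
  assumes "gen x y"
  shows "(\<Sum>C\<in>UNIV. FXD C None x y * y $ C) - FX None x y = un y * cyl beta x y"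
  unfolding FXD.simps FX.simps sum_DXc[OF assms] alpha_beta_gen[OF assms]
  by (simp add: algebra_simps)

text \<open>This covector annihilates \<open>y\<close> by homogeneity, so its coefficient along the
  bar-part of \<open>y\<close> is determined by \<open>alpha\<close> and \<open>beta\<close>; the
  computation finds it through \<open>vphi (Omega \<phi>)\<close>.\<close>

lemma sum_FXD_Some:
  assumes "gen x y"
  shows "(\<Sum>C\<in>UNIV. FXD C (Some j) x y * y $ C) - FX (Some j) x y
    = un y * cyl alpha x y * x $ Some j - (cs x y * cyl alpha x y + cz y * cyl beta x y) * y $ Some j"
proof -
  have "(\<Sum>C\<in>UNIV. FXD C (Some j) x y * y $ C) =
     (\<Sum>C\<in>UNIV. x $ Some j * (DXc (ds \<phi>) C x y * y $ C)
        + (if C = Some j then cyl (ds \<phi>) x y * y $ C else 0)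
        + y $ Some j / un y * (DXc (Omega \<phi>) C x y * y $ C))"
    by (rule sum.cong) (auto simp: algebra_simps)
  also have "\<dots> = x $ Some j * (\<Sum>C\<in>UNIV. DXc (ds \<phi>) C x y * y $ C) + cyl (ds \<phi>) x y * y $ Some j
     + y $ Some j / un y * (\<Sum>C\<in>UNIV. DXc (Omega \<phi>) C x y * y $ C)"
    by (simp add: sum.distrib sum_distrib_left del: times_divide_eq_left)
  finally have eq: "(\<Sum>C\<in>UNIV. FXD C (Some j) x y * y $ C) = \<dots>" .
  show ?thesis
    unfolding eq sum_DXc[OF assms] alpha_beta_gen[OF assms] FX.simps
    using gen_nonzero[OF assms] by (simp add: field_simps del: FXD.simps)
qed

text \<open>For a vector whose bar-part lies in the span of those of \<open>x\<close> and
  \<open>y\<close>, the contraction needs only the inner products of these two. It is applied to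
  \<open>y\<close> and to \<open>Hvec\<close>.\<close>

lemma sum_FDD_Some:
  assumes "gen x y" and v: "\<And>j. v $ Some j = a * x $ Some j + c * y $ Some j"
  shows "(\<Sum>B\<in>UNIV. FDD A B x y * v $ B) = FDD A None x y * v $ None +
    (case A of None \<Rightarrow> cyl (dz (ds \<phi>)) x y / un y * (a * (un x)\<^sup>2 + c * (cs x y * un y))
        + cyl (dz (Omega \<phi>)) x y / (un y)\<^sup>2 * (a * (cs x y * un y) + c * (un y)\<^sup>2)
     | Some i \<Rightarrow> DYc (ds \<phi>) i x y * (a * (un x)\<^sup>2 + c * (cs x y * un y))
        + (DYc (Omega \<phi>) i x y / un y - cyl (Omega \<phi>) x y * y $ Some i / (un y)^3)
          * (a * (cs x y * un y) + c * (un y)\<^sup>2)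
        + cyl (Omega \<phi>) x y / un y * (a * x $ Some i + c * y $ Some i))"
proof -
  have *: "(\<Sum>j\<in>UNIV. (p * x $ Some j + q * y $ Some j + (if i = j then d else 0)) * v $ Some j)
     = p * (a * (un x)\<^sup>2 + c * (cs x y * un y)) + q * (a * (cs x y * un y) + c * (un y)\<^sup>2)
       + d * (a * x $ Some i + c * y $ Some i)" for p q d i
  proof -
    have "(\<Sum>j\<in>UNIV. (p * x $ Some j + q * y $ Some j + (if i = j then d else 0)) * v $ Some j)
      = p * (\<Sum>j\<in>UNIV. (a * x $ Some j + c * y $ Some j) * x $ Some j)
      + q * (\<Sum>j\<in>UNIV. (a * x $ Some j + c * y $ Some j) * y $ Some j)
      + (\<Sum>j\<in>UNIV. if i = j then d * v $ Some j else 0)"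
      unfolding sum_distrib_left sum.distrib[symmetric]
      by (rule sum.cong) (auto simp: v algebra_simps)
    then show ?thesis by (simp add: sum_lin[OF assms(1)] v)
  qed
  show ?thesis
  proof (cases A)
    case None
    have "(\<Sum>j\<in>UNIV. FDD None (Some j) x y * v $ Some j) =
        cyl (dz (ds \<phi>)) x y / un y * (a * (un x)\<^sup>2 + c * (cs x y * un y))
        + cyl (dz (Omega \<phi>)) x y / (un y)\<^sup>2 * (a * (cs x y * un y) + c * (un y)\<^sup>2)"
      \<comment> \<open>The row of index \<open>None\<close> has no diagonal term; with
        \<open>d = 0\<close> the index \<open>i\<close> is irrelevant, hence
        \<open>undefined\<close>.\<close>
      using *[of "cyl (dz (ds \<phi>)) x y / un y" "cyl (dz (Omega \<phi>)) x y / (un y)\<^sup>2" undefined 0]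
      by (simp only: FDD.simps if_cancel add_0_right mult_zero_left)
    with None show ?thesis by (simp add: sum_option del: FDD.simps)
  next
    case (Some i)
    have "(\<Sum>j\<in>UNIV. FDD (Some i) (Some j) x y * v $ Some j) =
        DYc (ds \<phi>) i x y * (a * (un x)\<^sup>2 + c * (cs x y * un y))
        + (DYc (Omega \<phi>) i x y / un y - cyl (Omega \<phi>) x y * y $ Some i / (un y)^3)
          * (a * (cs x y * un y) + c * (un y)\<^sup>2)
        + cyl (Omega \<phi>) x y / un y * (a * x $ Some i + c * y $ Some i)"
      unfolding FDD.simps by (rule *)
    with Some show ?thesis by (simp add: sum_option del: FDD.simps)
  qed
qed

lemma Omega_gen:
  assumes "gen x y"
  shows "cyl (ds (Omega \<phi>)) x y = - cs x y * cyl (ds (ds \<phi>)) x y - cz y * cyl (ds (dz \<phi>)) x y"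
    "cyl (dz (Omega \<phi>)) x y = - cs x y * cyl (ds (dz \<phi>)) x y - cz y * cyl (dz (dz \<phi>)) x y"
    "cyl (dz (ds \<phi>)) x y = cyl (ds (dz \<phi>)) x y"
  using DERIV_Omega(1,2)[OF sm_phi gen_region[OF assms]] sm_commute(5)[OF sm_phi gen_region[OF assms]]
  by (simp_all add: cyl_def)

text \<open>Euler's identity for the functions \<open>FD A\<close>, homogeneous of degree zero. It
  is why a multiple of \<open>y\<close> in the spray is invisible to \<open>FDD\<close>.\<close>

lemma sum_FDD_y:
  assumes "gen x y"
  shows "(\<Sum>B\<in>UNIV. FDD A B x y * y $ B) = 0"
  using sum_FDD_Some[OF assms, of y 0 1 A] gen_nonzero[OF assms] gen_identities(1)[OF assms]
  by (cases A) (simp_all add: DYc_def Omega_gen[OF assms] field_simps power2_eq_square power3_eq_cube)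

text \<open>The two scalar equations that determine the part of the spray not proportional to \<open>y\<close>.\<close>

definition eqP :: "real \<Rightarrow> real \<Rightarrow> 'n fn" where
  "eqP l b x y = cyl (ds (dz \<phi>)) x y * l
     + (((un x)\<^sup>2 - (cs x y)\<^sup>2) * cyl (ds (ds \<phi>)) x y + cyl (Omega \<phi>) x y) * b"
definition eqQ :: "real \<Rightarrow> real \<Rightarrow> 'n fn" where
  "eqQ l b x y = cyl (dz (dz \<phi>)) x y * l + ((un x)\<^sup>2 - (cs x y)\<^sup>2) * cyl (ds (dz \<phi>)) x y * b"

text \<open>Subtracting \<open>u s b y\<close> leaves \<open>u^2 l\<close> in the 0-slot and
  \<open>u^2 b\<close> times the component of the bar-part of \<open>x\<close> orthogonal to that of
  \<open>y\<close>. So the term \<open>z s b\<close> only selects the representative modulo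
  \<open>y\<close> whose bar-part is along \<open>bar x\<close>; the squared length
  \<open>r^2 - s^2\<close> of the orthogonal component enters \<open>eqP\<close> and
  \<open>eqQ\<close>.\<close>

definition Hvec :: "real \<Rightarrow> real \<Rightarrow> 'n pt \<Rightarrow> 'n pt \<Rightarrow> 'n pt" where
  "Hvec l b x y = (\<chi> A. case A of None \<Rightarrow> (un y)\<^sup>2 * (l + cz y * cs x y * b)
     | Some i \<Rightarrow> (un y)\<^sup>2 * b * x $ Some i)"

text \<open>The result has the shape of \<open>sum_FXD_None\<close> and \<open>sum_FXD_Some\<close>
  with \<open>eqP\<close>, \<open>eqQ\<close> in the places of \<open>alpha\<close>,
  \<open>beta\<close>, so the vector equation reduces to two scalar ones.\<close>

lemma sum_FDD_H:
  assumes "gen x y"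
  shows "(\<Sum>B\<in>UNIV. FDD A B x y * Hvec l b x y $ B) =
    (case A of None \<Rightarrow> un y * eqQ l b x y
     | Some i \<Rightarrow> un y * eqP l b x y * x $ Some i
         - (cs x y * eqP l b x y + cz y * eqQ l b x y) * y $ Some i)"
proof -
  have v: "Hvec l b x y $ Some j = (un y)\<^sup>2 * b * x $ Some j + 0 * y $ Some j" for j
    by (simp add: Hvec_def)
  have u: "un y \<noteq> 0" using gen_nonzero[OF assms] by simp
  show ?thesis
    unfolding sum_FDD_Some[OF assms v]
    by (cases A) (simp_all add: Hvec_def eqP_def eqQ_def DYc_def Omega_gen[OF assms] u
      field_simps power2_eq_square power3_eq_cube)
qed

lemma sum_FD_y:
  assumes "gen x y"
  shows "(\<Sum>B\<in>UNIV. FD B x y * y $ B) = F x y"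
proof -
  have eq: "(\<Sum>i\<in>UNIV. FD (Some i) x y * y $ Some i) =
      cyl (ds \<phi>) x y * (cs x y * un y) + cyl (Omega \<phi>) x y / un y * (un y)\<^sup>2"
    using sum_lin(2)[OF assms, of "cyl (ds \<phi>) x y" "cyl (Omega \<phi>) x y / un y"] by simp
  show ?thesis
    unfolding sum_option eq
    using gen_nonzero[OF assms] gen_identities(1)[OF assms]
    by (simp add: F_gen[OF assms] cyl_def Omega_def power2_eq_square field_simps del: FD.simps(2))
qed

lemma sum_FD_H:
  assumes "gen x y"
  shows "(\<Sum>B\<in>UNIV. FD B x y * Hvec l b x y $ B) = (un y)\<^sup>2 *
    (cyl (dz \<phi>) x y * (l + cz y * cs x y * b)
      + b * (cyl (ds \<phi>) x y * (un x)\<^sup>2 + cyl (Omega \<phi>) x y * cs x y))"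
proof -
  have "(\<Sum>i\<in>UNIV. FD (Some i) x y * Hvec l b x y $ Some i) =
      (un y)\<^sup>2 * b * (\<Sum>i\<in>UNIV. (cyl (ds \<phi>) x y * x $ Some i + cyl (Omega \<phi>) x y / un y * y $ Some i) * x $ Some i)"
    unfolding sum_distrib_left by (rule sum.cong) (auto simp: Hvec_def algebra_simps)
  then show ?thesis
    unfolding sum_option sum_lin[OF assms]
    using gen_nonzero[OF assms]
    by (simp add: Hvec_def algebra_simps del: FD.simps(2))
qed

lemma gmat_mult:
  assumes "gen x y"
  shows "(gmat F x y *v v) $ A = F x y * (\<Sum>B\<in>UNIV. FDD A B x y * v $ B)
     + FD A x y * (\<Sum>B\<in>UNIV. FD B x y * v $ B)"
  by (simp add: matrix_vector_mult_def gmat_gen[OF assms] sum_distrib_left distrib_right sum.distrib mult.assoc)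

lemma gmat_ker:
  assumes "x \<in> cyl_domain I \<rho>" "y \<noteq> 0" "gmat F x y *v v = 0"
  shows "v = 0"
proof (rule ccontr)
  assume "v \<noteq> 0"
  then have "(\<Sum>A\<in>UNIV. \<Sum>B\<in>UNIV. gmat F x y $ A $ B * v $ A * v $ B) > 0"
    using fins assms by (auto simp: finsler_metric_def)
  also have "(\<Sum>A\<in>UNIV. \<Sum>B\<in>UNIV. gmat F x y $ A $ B * v $ A * v $ B)
    = (\<Sum>A\<in>UNIV. v $ A * (gmat F x y *v v) $ A)"
    by (simp add: matrix_vector_mult_def sum_distrib_left mult_ac)
  finally show False by (simp add: assms(3))
qed

lemma gmat_invertible:
  assumes "x \<in> cyl_domain I \<rho>" "y \<noteq> 0"
  shows "invertible (gmat F x y)"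
  using gmat_ker[OF assms] by (metis invertible_left_inverse matrix_left_invertible_ker)

lemma gen_y_nonzero: "gen x y \<Longrightarrow> y \<noteq> 0"
  using gen_nonzero[of x y] by (auto simp: bar_def zero_vec_def)

lemma singular_2x2:
  fixes a b c d :: real
  assumes "a * d - b * c = 0"
  obtains x y where "x \<noteq> 0 \<or> y \<noteq> 0" "a * x + b * y = 0" "c * x + d * y = 0"
proof (cases "a = 0 \<and> b = 0")
  case True
  show ?thesis
  proof (cases "c = 0 \<and> d = 0")
    case True
    with \<open>a = 0 \<and> b = 0\<close> show ?thesis using that[of 1 0] by simp
  next
    case False
    with True show ?thesis using that[of d "- c"] by auto
  qed
next
  case False
  with assms show ?thesis using that[of b "- a"] by (auto simp: mult.commute)
qed

text \<open>If \<open>Lam\<close> vanished, the two scalar equations would have a nontrivial solution, and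
  its component orthogonal to \<open>y\<close> would be a null vector of the fundamental tensor.\<close>

lemma Lam_gen:
  fixes x y :: "'n pt"
  assumes "gen x y"
  shows "cyl (Lam \<phi>) x y \<noteq> 0"
proof
  assume 0: "cyl (Lam \<phi>) x y = 0"
  define m11 where "m11 = cyl (dz (dz \<phi>)) x y"
  define m12 where "m12 = ((un x)\<^sup>2 - (cs x y)\<^sup>2) * cyl (ds (dz \<phi>)) x y"
  define m21 where "m21 = cyl (ds (dz \<phi>)) x y"
  define m22 where "m22 = ((un x)\<^sup>2 - (cs x y)\<^sup>2) * cyl (ds (ds \<phi>)) x y + cyl (Omega \<phi>) x y"
  \<comment> \<open>The coefficient determinant of \<open>eqQ\<close>, \<open>eqP\<close> is
    \<open>Lam\<close>.\<close>
  have det: "m11 * m22 - m12 * m21 = 0"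
    using 0 by (simp add: m11_def m12_def m21_def m22_def cyl_def Lam_def algebra_simps power2_eq_square)
  obtain l b where lb: "l \<noteq> 0 \<or> b \<noteq> 0" and "m11 * l + m12 * b = 0" "m21 * l + m22 * b = 0"
    by (rule singular_2x2[OF det])
  then have P: "eqP l b x y = 0" and Q: "eqQ l b x y = 0"
    unfolding eqP_def eqQ_def m11_def m12_def m21_def m22_def by simp_all
  define H where "H = Hvec l b x y"
  \<comment> \<open>By Euler's identity this \<open>c\<close> makes \<open>FD\<close> annihilate
    \<open>H - c *\<^sub>R y\<close>; the part with \<open>FDD\<close> vanishes by \<open>P\<close>
    and \<open>Q\<close>.\<close>
  define c where "c = (\<Sum>B\<in>UNIV. FD B x y * H $ B) / F x y"
  have "(gmat F x y *v (H - c *\<^sub>R y)) $ A = 0" for A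
  proof -
    have "(\<Sum>B\<in>UNIV. FDD A B x y * (H - c *\<^sub>R y) $ B) =
       (\<Sum>B\<in>UNIV. FDD A B x y * H $ B) - c * (\<Sum>B\<in>UNIV. FDD A B x y * y $ B)"
      by (simp add: sum_distrib_left right_diff_distrib sum_subtractf mult_ac)
    then have 1: "(\<Sum>B\<in>UNIV. FDD A B x y * (H - c *\<^sub>R y) $ B) = 0"
      unfolding H_def sum_FDD_H[OF assms] sum_FDD_y[OF assms] P Q by (auto split: option.split)
    have "(\<Sum>B\<in>UNIV. FD B x y * (H - c *\<^sub>R y) $ B) =
       (\<Sum>B\<in>UNIV. FD B x y * H $ B) - c * (\<Sum>B\<in>UNIV. FD B x y * y $ B)"
      by (simp add: sum_distrib_left right_diff_distrib sum_subtractf mult_ac)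
    then have "(\<Sum>B\<in>UNIV. FD B x y * (H - c *\<^sub>R y) $ B) = 0"
      unfolding sum_FD_y[OF assms] c_def using F_pos[OF assms] by simp
    with 1 show ?thesis by (simp add: gmat_mult[OF assms])
  qed
  then have "gmat F x y *v (H - c *\<^sub>R y) = 0" by (simp add: vec_eq_iff)
  then have "H - c *\<^sub>R y = 0"
    by (rule gmat_ker[rotated 2]) (use assms gen_y_nonzero[OF assms] in \<open>auto simp: gen_def\<close>)
  then have "H = c *\<^sub>R y" by simp
  then have H: "H $ A = c * y $ A" for A by simp
  have u: "un y > 0" "un x > 0" using gen_nonzero[OF assms] by auto
  have "c * y $ Some i = (un y)\<^sup>2 * b * x $ Some i" for i
    using H[of "Some i"] by (simp add: H_def Hvec_def)
  then have cb: "c *\<^sub>R bar y = ((un y)\<^sup>2 * b) *\<^sub>R bar x"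
    by (simp add: vec_eq_iff bar_nth)
  have cA: "c * (bar y \<bullet> bar y) = (un y)\<^sup>2 * b * (bar x \<bullet> bar y)"
    and cD: "c * (bar x \<bullet> bar y) = (un y)\<^sup>2 * b * (bar x \<bullet> bar x)"
    using arg_cong[OF cb, of "\<lambda>v. v \<bullet> bar y"] arg_cong[OF cb, of "\<lambda>v. bar x \<bullet> v"]
    by simp_all
  \<comment> \<open>Eliminating \<open>c\<close> between the inner products with the two bar-parts
    leaves \<open>b\<close> times their Gram determinant, which is positive at generic
    pairs.\<close>
  have "(un y)\<^sup>2 * b * ((norm (bar x))\<^sup>2 * (norm (bar y))\<^sup>2 - (bar x \<bullet> bar y)\<^sup>2)
     = ((un y)\<^sup>2 * b * (bar x \<bullet> bar x)) * (bar y \<bullet> bar y) - ((un y)\<^sup>2 * b * (bar x \<bullet> bar y)) * (bar x \<bullet> bar y)"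
    by (simp add: power2_norm_eq_inner power2_eq_square[of "_ \<bullet> _"] right_diff_distrib mult.assoc)
  also have "\<dots> = 0"
    unfolding cA[symmetric] cD[symmetric] by simp
  finally have "(un y)\<^sup>2 * b * ((norm (bar x))\<^sup>2 * (norm (bar y))\<^sup>2 - (bar x \<bullet> bar y)\<^sup>2) = 0" .
  moreover have "(norm (bar x))\<^sup>2 * (norm (bar y))\<^sup>2 - (bar x \<bullet> bar y)\<^sup>2 > 0"
    using assms power2_strict_mono[of "\<bar>bar x \<bullet> bar y\<bar>" "norm (bar x) * norm (bar y)"]
    by (simp add: gen_def power_mult_distrib)
  ultimately have b: "b = 0" using u by simp
  then have "c *\<^sub>R bar y = 0" using cb by simp
  then have "c = 0" using gen_nonzero[OF assms] by simp
  with H[of None] b u have "l = 0" by (simp add: H_def Hvec_def)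
  with b lb show False by simp
qed

end

subsection \<open>The spray and its projectively invariant part\<close>

context cyl_region
begin

text \<open>A normal form for each parameter point: the bar-part of \<open>x\<close> lies on axis
  \<open>i\<close>, that of \<open>y\<close> is a unit vector in the plane of axes \<open>i\<close>
  and \<open>j\<close>, and axis \<open>k\<close> is orthogonal to both.\<close>

lemma region_gen:
  assumes p: "(t, r, s, z) \<in> Reg" and n: "CARD('n::finite) \<ge> 3"
  obtains x y :: "'n::finite pt" and i k where "gen x y" "x $ None = t" "un x = r" "cs x y = s" "cz y = z"
    "un y = 1" "x $ Some i = r" "y $ Some i = s / r" "x $ Some k = 0" "y $ Some k = 0"
proof -
  obtain A :: "'n set" where "card A = 3"
    using obtain_subset_with_card_n[OF n] by blast
  then obtain i j k :: 'n where d: "i \<noteq> j" "i \<noteq> k" "j \<noteq> k"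
    by (auto simp: card_3_iff)
  have r: "r > 0" "\<bar>s\<bar> < r" "t \<in> I" "r < \<rho>" using p by (auto simp: phi_region_def)
  \<comment> \<open>Second component of the unit vector whose first component \<open>s / r\<close>
    gives inner product \<open>s\<close>.\<close>
  define q where "q = sqrt (1 - (s / r)\<^sup>2)"
  have "\<bar>s / r\<bar> < 1" using r by (simp add: abs_divide)
  then have "(s / r)\<^sup>2 < 1" by (simp add: abs_square_less_1)
  then have q: "q\<^sup>2 = 1 - (s / r)\<^sup>2" by (simp add: q_def)
  define x :: "'n pt" where "x = (\<chi> A. if A = None then t else if A = Some i then r else 0)"
  define y :: "'n pt" where "y = (\<chi> A. if A = None then z else if A = Some i then s / r
     else if A = Some j then q else 0)"
  have bx: "bar x = r *\<^sub>R axis i 1"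
    by (auto simp: bar_def x_def vec_eq_iff axis_def)
  have bb: "bar y = (s / r) *\<^sub>R axis i 1 + q *\<^sub>R axis j 1"
    using d by (auto simp: bar_def y_def vec_eq_iff axis_def)
  have nx: "norm (bar x) = r" using r by (simp add: bx)
  have "(norm (bar y))\<^sup>2 = (s / r)\<^sup>2 + q\<^sup>2"
    unfolding power2_norm_eq_inner bb using d
    by (simp add: inner_add_left inner_add_right inner_axis_axis power2_eq_square)
  then have ny: "norm (bar y) = 1"
    using power2_eq_iff_nonneg[of "norm (bar y)" 1] by (simp add: q)
  have ip: "bar x \<bullet> bar y = s"
    using d r by (simp add: bx bb inner_add_right inner_axis_axis)
  show ?thesis
  proof (rule that[of x y i k])
    show "gen x y" using r nx ny ip by (auto simp: gen_def cyl_domain_def x_def)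
  qed (use d nx ny ip in \<open>auto simp: un_def cs_def cz_def x_def y_def\<close>)
qed

lemma dY_eqI:
  assumes "gen x y" "\<And>y. gen x y \<Longrightarrow> K x y = K' y"
    and "((\<lambda>\<epsilon>. K' (y + \<epsilon> *\<^sub>R ex A)) has_real_derivative D) (at 0)"
  shows "dY A K x y = D"
  using dY_cong[of x K "\<lambda>_. K'" y A] assms dY_I[of "\<lambda>_. K'"] by simp

end

locale cyl_finsler3 = cyl_finsler I \<rho> F \<phi> for I \<rho> and F :: "'n::finite fn" and \<phi> +
  fixes n :: real
  assumes n_card: "n = real CARD('n)" and n3: "CARD('n) \<ge> 3"
begin

text \<open>\<open>Lam\<close> inherits non-vanishing from generic pairs because every point of the
  region is realised by one; this justifies the divisions in \<open>U\<close>, \<open>V\<close> and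
  \<open>L\<close>.\<close>

lemma Reg_nonzero:
  assumes "(t, r, s, z) \<in> Reg"
  shows "r \<noteq> 0" "r > 0" "\<bar>s\<bar> < r" "\<phi> t r s z \<noteq> 0" "Lam \<phi> t r s z \<noteq> 0"
proof -
  show "r \<noteq> 0" "r > 0" "\<bar>s\<bar> < r" "\<phi> t r s z \<noteq> 0"
    using assms bspec[OF phi_pos assms] by (auto simp: phi_region_def)
  obtain x y :: "'n pt" where "gen x y" "x $ None = t" "un x = r" "cs x y = s" "cz y = z"
    using region_gen[OF assms n3] by metis
  then show "Lam \<phi> t r s z \<noteq> 0" using Lam_gen[of x y] by (simp add: cyl_def)
qed

abbreviation "U \<equiv> Uf \<phi>"
abbreviation "L \<equiv> Lf \<phi>"
abbreviation "R \<equiv> Rf n \<phi>"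
abbreviation "T \<equiv> Tf n \<phi>"

lemma sm_vphi: "sm \<Theta> \<Longrightarrow> sm (vphi \<Theta>)"
  unfolding vphi_def by (intro sm_intros Reg_nonzero(1))

lemma sm_Lam: "sm (Lam \<phi>)"
  unfolding Lam_def by (intro sm_intros sm_Omega sm_phi)

lemma sm_U: "sm U"
  unfolding Uf_def by (intro sm_intros sm_vphi sm_Lam sm_phi) (auto dest: Reg_nonzero)

lemma sm_V: "sm (Vf \<phi>)"
  unfolding Vf_def by (intro sm_intros sm_vphi sm_Lam sm_phi) (auto dest: Reg_nonzero)

lemma sm_L: "sm L"
  unfolding Lf_def by (intro sm_intros sm_vphi sm_Lam sm_phi sm_V sm_Omega) (auto dest: Reg_nonzero)

lemma n_pos: "n + 2 > 0" "n + 2 \<noteq> 0"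
  by (simp_all add: n_card)

lemma sm_R: "sm R"
  unfolding Rf_def by (intro sm_intros sm_L sm_U n_pos)

lemma sm_T: "sm T"
  unfolding Tf_def by (intro sm_intros sm_L sm_U n_pos)

text \<open>\<open>W\<close> is fixed by the one remaining equation, the contraction of the spray with \<open>FD\<close>.\<close>

definition W :: fn4 where
  "W = (\<lambda>t r s z. (vphi \<phi> t r s z / 2 - dz \<phi> t r s z * (L t r s z + z * s * U t r s z)
    - U t r s z * (ds \<phi> t r s z * r\<^sup>2 + Omega \<phi> t r s z * s)) / \<phi> t r s z)"

lemma sm_W: "sm W"
  unfolding W_def by (intro sm_intros sm_L sm_U sm_Omega sm_phi sm_vphi) (auto dest: Reg_nonzero)

text \<open>Cramer's rule for the 2x2 system with determinant \<open>Lam\<close>; \<open>U\<close>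
  and \<open>L\<close> are its quotients of determinants.\<close>

lemma eqP_eqQ:
  fixes x y :: "'n pt"
  assumes "gen x y"
  shows "eqP (cyl L x y) (cyl U x y) x y = cyl alpha x y / 2"
    "eqQ (cyl L x y) (cyl U x y) x y = cyl beta x y / 2"
proof -
  define la where "la = cyl (Lam \<phi>) x y"
  define a b zz sz ss om rs where abb: "a = cyl alpha x y" "b = cyl beta x y" "zz = cyl (dz (dz \<phi>)) x y"
    "sz = cyl (ds (dz \<phi>)) x y" "ss = cyl (ds (ds \<phi>)) x y" "om = cyl (Omega \<phi>) x y"
    "rs = (un x)\<^sup>2 - (cs x y)\<^sup>2"
  have la: "la \<noteq> 0" using Lam_gen[OF assms] by (simp add: la_def)
  have lam: "la = om * zz + rs * (ss * zz - sz\<^sup>2)"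
    by (simp add: la_def abb cyl_def Lam_def)
  have U: "cyl U x y = (a * zz - b * sz) / (2 * la)"
    by (simp add: la_def abb cyl_def Uf_def alpha_def beta_def)
  have "cyl L x y = om / (2 * la) * b - rs * (1 / (2 * la) * (a * sz - b * ss))"
    by (simp add: la_def abb cyl_def Lf_def Vf_def alpha_def beta_def)
  then have L: "cyl L x y = (om * b - rs * (a * sz - b * ss)) / (2 * la)"
    using la by (simp add: field_simps)
  have "2 * la * eqP (cyl L x y) (cyl U x y) x y = sz * (om * b - rs * (a * sz - b * ss)) + (rs * ss + om) * (a * zz - b * sz)"
    using la unfolding eqP_def U L abb[symmetric] by (simp add: field_simps)
  also have "\<dots> = la * a" unfolding lam by (simp add: algebra_simps power2_eq_square)
  finally show "eqP (cyl L x y) (cyl U x y) x y = cyl alpha x y / 2"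
    using la by (simp add: abb)
  have "2 * la * eqQ (cyl L x y) (cyl U x y) x y = zz * (om * b - rs * (a * sz - b * ss)) + rs * sz * (a * zz - b * sz)"
    using la unfolding eqQ_def U L abb[symmetric] by (simp add: field_simps)
  also have "\<dots> = la * b" unfolding lam by (simp add: algebra_simps power2_eq_square)
  finally show "eqQ (cyl L x y) (cyl U x y) x y = cyl beta x y / 2"
    using la by (simp add: abb)
qed

definition Gvec :: "'n pt \<Rightarrow> 'n pt \<Rightarrow> 'n pt" where
  "Gvec x y = Hvec (cyl L x y) (cyl U x y) x y + (un y * cyl W x y) *\<^sub>R y"

lemma gmat_Gvec:
  assumes "gen x y"
  shows "(gmat F x y *v (4 *\<^sub>R Gvec x y)) $ A =
    (\<Sum>C\<in>UNIV. dX C (dY A (Fsq F)) x y * y $ C) - dX A (Fsq F) x y"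
proof -
  define H where "H = Hvec (cyl L x y) (cyl U x y) x y"
  define w where "w = un y * cyl W x y"
  have lin: "(\<Sum>B\<in>UNIV. f B * (4 *\<^sub>R Gvec x y) $ B) =
     4 * (\<Sum>B\<in>UNIV. f B * H $ B) + 4 * w * (\<Sum>B\<in>UNIV. f B * y $ B)" for f :: "'n option \<Rightarrow> real"
    by (simp add: Gvec_def H_def w_def sum_distrib_left sum.distrib[symmetric] algebra_simps)
  have "(\<Sum>B\<in>UNIV. FDD A B x y * H $ B) = ((\<Sum>C\<in>UNIV. FXD C A x y * y $ C) - FX A x y) / 2"
    unfolding H_def sum_FDD_H[OF assms] eqP_eqQ[OF assms]
    by (cases A)
       (simp_all add: sum_FXD_None[OF assms] sum_FXD_Some[OF assms] diff_divide_distrib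
          add_divide_distrib del: FXD.simps FX.simps)
  then have 1: "(\<Sum>B\<in>UNIV. FDD A B x y * (4 *\<^sub>R Gvec x y) $ B) =
     2 * ((\<Sum>C\<in>UNIV. FXD C A x y * y $ C) - FX A x y)"
    unfolding lin sum_FDD_y[OF assms] by simp
  have "4 * (\<Sum>B\<in>UNIV. FD B x y * H $ B) + 4 * w * F x y = 2 * (un y)\<^sup>2 * cyl (vphi \<phi>) x y"
    using Reg_nonzero(4)[OF gen_region[OF assms]]
    unfolding H_def sum_FD_H[OF assms] w_def F_gen[OF assms]
    by (simp add: cyl_def W_def field_simps power2_eq_square)
  then have 2: "(\<Sum>B\<in>UNIV. FD B x y * (4 *\<^sub>R Gvec x y) $ B) = 2 * (\<Sum>C\<in>UNIV. FX C x y * y $ C)"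
    unfolding lin sum_FD_y[OF assms] sum_FX[OF assms] by simp
  have "(\<Sum>C\<in>UNIV. dX C (dY A (Fsq F)) x y * y $ C) =
     2 * FD A x y * (\<Sum>C\<in>UNIV. FX C x y * y $ C) + 2 * F x y * (\<Sum>C\<in>UNIV. FXD C A x y * y $ C)"
    unfolding dX_dY_Fsq[OF assms] sum_distrib_left sum.distrib[symmetric]
    by (simp add: algebra_simps)
  then show ?thesis
    unfolding gmat_mult[OF assms] 1 2 dX_Fsq[OF assms] by (simp add: algebra_simps)
qed

lemma matrix_inv_mult_vec:
  fixes M :: "real ^ 'm ^ 'm"
  assumes "invertible M"
  shows "matrix_inv M *v (M *v v) = v" "M *v (matrix_inv M *v v) = v"
proof -
  have "M ** matrix_inv M = mat 1 \<and> matrix_inv M ** M = mat 1"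
    using assms unfolding invertible_def matrix_inv_def by (rule someI_ex)
  then show "matrix_inv M *v (M *v v) = v" "M *v (matrix_inv M *v v) = v"
    by (simp_all add: matrix_vector_mul_assoc)
qed

lemma geod_gen:
  assumes "gen x y"
  shows "geod F A x y = Gvec x y $ A"
proof -
  have "(\<chi> B. (\<Sum>C\<in>UNIV. dX C (dY B (Fsq F)) x y * y $ C) - dX B (Fsq F) x y)
     = gmat F x y *v (4 *\<^sub>R Gvec x y)"
    by (simp add: vec_eq_iff gmat_Gvec[OF assms])
  then show ?thesis
    using assms gen_y_nonzero[OF assms]
    by (simp add: geod_def gen_def matrix_inv_mult_vec(1)[OF gmat_invertible])
qed

section \<open>Divergence of the spray and the projectively invariant field \<open>K\<close>\<close>

definition G0 :: fn4 where "G0 = (\<lambda>t r s z. L t r s z + z * s * U t r s z + z * W t r s z)"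

lemma sm_G0: "sm G0"
  unfolding G0_def by (intro sm_intros sm_L sm_U sm_W)

lemma geod_None: "gen x y \<Longrightarrow> geod F None x y = (un y)\<^sup>2 * cyl G0 x y"
  using gen_identities(1)[of x y]
  by (simp add: geod_gen Gvec_def Hvec_def G0_def cyl_def algebra_simps power2_eq_square)

lemma geod_Some:
  "gen x y \<Longrightarrow> geod F (Some i) x y = (un y)\<^sup>2 * cyl U x y * x $ Some i + un y * cyl W x y * y $ Some i"
  by (simp add: geod_gen Gvec_def Hvec_def algebra_simps)

lemma DERIV_z_G0:
  assumes "(t, r, s, z) \<in> Reg"
  shows "dz G0 t r s z = dz L t r s z + s * U t r s z + z * s * dz U t r s z + W t r s z + z * dz W t r s z"
proof -
  note D = sm_DERIV(4)[OF sm_L assms] sm_DERIV(4)[OF sm_U assms] sm_DERIV(4)[OF sm_W assms]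
  have "((\<lambda>a. G0 t r s a) has_real_derivative
     dz L t r s z + s * U t r s z + z * s * dz U t r s z + W t r s z + z * dz W t r s z) (at z)"
    unfolding G0_def by (rule derivative_eq_intros D refl | simp add: algebra_simps)+
  then show ?thesis unfolding dz_def[of G0] by (rule DERIV_imp_deriv)
qed

text \<open>Origin of \<open>T\<close> and of \<open>n + 2\<close>. The field \<open>u W y\<close>
  contributes \<open>(n + 2) u W\<close>: the dimension \<open>n + 1\<close>, plus one for the
  degree of \<open>u W\<close> by Euler's identity. The divergence of the \<open>Hvec\<close> part
  is what \<open>Tf\<close> collects.\<close>

lemma div_geod:
  assumes "gen x y"
  shows "(\<Sum>E\<in>UNIV. dY E (geod F E) x y) = (n + 2) * un y * (cyl T x y + cyl W x y)"
proof -
  have u: "un y \<noteq> 0" using gen_nonzero[OF assms] by simp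
  have 0: "dY None (geod F None) x y = un y * cyl (dz G0) x y"
    by (rule dY_eqI[OF assms _ DY_un2_cyl(1)[OF sm_G0 assms]]) (rule geod_None)
  have i: "dY (Some i) (geod F (Some i)) x y =
     (un y * cyl (ds U) x y * x $ Some i + cyl (Omega2 U) x y * y $ Some i) * x $ Some i
     + ((cyl (ds W) x y * x $ Some i + cyl (Omega W) x y / un y * y $ Some i) * y $ Some i + un y * cyl W x y)" for i
    by (rule dY_eqI[OF assms, where K' = "\<lambda>y. (un y)\<^sup>2 * cyl U x y * x $ Some i + un y * cyl W x y * y $ Some i"],
        erule geod_Some,
        rule DERIV_cong[OF DERIV_add[OF DERIV_cmult_right DERIV_mult],
          OF DY_un2_cyl(2)[OF sm_U assms] DY_un_cyl(2)[OF sm_W assms] nth_line]) simp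
  have "(\<Sum>i\<in>UNIV. dY (Some i) (geod F (Some i)) x y) =
     un y * cyl (ds U) x y * (un x)\<^sup>2 + cyl (Omega2 U) x y * (cs x y * un y)
     + (cyl (ds W) x y * (cs x y * un y) + cyl (Omega W) x y / un y * (un y)\<^sup>2)
     + n * (un y * cyl W x y)"
    unfolding i sum.distrib sum_lin[OF assms] by (simp add: n_card)
  then have "(\<Sum>E\<in>UNIV. dY E (geod F E) x y) = un y * (cyl (dz G0) x y +
      cyl (ds U) x y * (un x)\<^sup>2 + cyl (Omega2 U) x y * cs x y
     + cyl (ds W) x y * cs x y + cyl (Omega W) x y + n * cyl W x y)"
    unfolding sum_option 0 using u by (simp add: algebra_simps power2_eq_square)
  also have "\<dots> = un y * ((n + 2) * (cyl T x y + cyl W x y))"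
  proof -
    have "(n + 2) * cyl T x y = 3 * cs x y * cyl U x y + cyl (dz L) x y
       + ((un x)\<^sup>2 - (cs x y)\<^sup>2) * cyl (ds U) x y"
      using n_pos by (simp add: cyl_def Tf_def)
    then have T: "(n + 2) * (cyl T x y + cyl W x y) = 3 * cs x y * cyl U x y + cyl (dz L) x y
       + ((un x)\<^sup>2 - (cs x y)\<^sup>2) * cyl (ds U) x y + (n + 2) * cyl W x y"
      by (simp add: distrib_left)
    show ?thesis
      unfolding T
      by (simp add: cyl_def DERIV_z_G0[OF gen_region[OF assms]] Omega_def Omega2_def algebra_simps power2_eq_square)
  qed
  finally show ?thesis by (simp add: mult_ac)
qed

definition K :: "'n option \<Rightarrow> 'n fn" where
  "K A x y = geod F A x y - (1 / (n + 2)) * (\<Sum>E\<in>UNIV. dY E (geod F E) x y) * y $ A"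

lemma douglas_K: "douglas F A B C D = dY D (dY C (dY B (K A)))"
  unfolding douglas_def K_def[abs_def] n_card[symmetric] ..

lemma K_gen:
  assumes "gen x y"
  shows "K A x y = geod F A x y - un y * (cyl T x y + cyl W x y) * y $ A"
  unfolding K_def div_geod[OF assms] using n_pos by simp

lemma K_None:
  assumes "gen x y"
  shows "K None x y = (un y)\<^sup>2 * cyl R x y"
proof -
  \<comment> \<open>Origin of \<open>R\<close>: since \<open>y^0 = z u\<close>, the correction
    \<open>- u T y^0\<close> equals \<open>- u^2 z T\<close>.\<close>
  have eq: "cyl R x y = cyl L x y + cz y * cs x y * cyl U x y - cz y * cyl T x y"
    using n_pos by (simp add: cyl_def Rf_def Tf_def field_simps)
  show ?thesis
    unfolding K_gen[OF assms] geod_None[OF assms] gen_identities(1)[OF assms] eq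
    by (simp add: G0_def cyl_def algebra_simps power2_eq_square)
qed

lemma K_Some:
  assumes "gen x y"
  shows "K (Some i) x y = x $ Some i * ((un y)\<^sup>2 * cyl U x y) - y $ Some i * (un y * cyl T x y)"
  unfolding K_gen[OF assms] geod_Some[OF assms] by (simp add: algebra_simps)

end

subsection \<open>Vanishing derivatives\<close>

context cyl_region
begin

text \<open>The derivatives in \<open>y\<close> are handed down as explicit witnesses
  \<open>H'\<close>, so differentiability is part of the claim; an equation between iterated
  \<open>deriv\<close> terms would not provide it.\<close>

primrec van :: "nat \<Rightarrow> 'n::finite pt \<Rightarrow> ('n pt \<Rightarrow> real) \<Rightarrow> bool" where
  "van 0 x H \<longleftrightarrow> (\<forall>y. gen x y \<longrightarrow> H y = 0)"
| "van (Suc k) x H \<longleftrightarrow> (\<exists>H'. (\<forall>A y. gen x y \<longrightarrow>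
     ((\<lambda>\<epsilon>. H (y + \<epsilon> *\<^sub>R ex A)) has_real_derivative H' A y) (at 0)) \<and> (\<forall>A. van k x (H' A)))"

lemma van_SucI:
  assumes "\<And>A y. gen x y \<Longrightarrow> ((\<lambda>\<epsilon>. H (y + \<epsilon> *\<^sub>R ex A)) has_real_derivative H' A y) (at 0)"
    and "\<And>A. van k x (H' A)"
  shows "van (Suc k) x H"
  using assms by (auto intro!: exI[of _ H'])

lemma DERIV_y_cong:
  assumes "gen x y" "\<And>y. gen x y \<Longrightarrow> H y = H' y"
    and "((\<lambda>\<epsilon>. H (y + \<epsilon> *\<^sub>R v)) has_real_derivative D) (at 0)"
  shows "((\<lambda>\<epsilon>. H' (y + \<epsilon> *\<^sub>R v)) has_real_derivative D) (at 0)"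
proof -
  have ev: "\<forall>\<^sub>F \<epsilon> in nhds 0. H (y + \<epsilon> *\<^sub>R v) = H' (y + \<epsilon> *\<^sub>R v)"
    by (rule eventually_mono[OF gen_line_y[OF assms(1)]]) (rule assms(2))
  show ?thesis using assms(3) by (rule DERIV_cong_ev[OF refl ev refl, THEN iffD1])
qed

lemma van_cong:
  assumes "van k x H" "\<And>y. gen x y \<Longrightarrow> H y = H' y"
  shows "van k x H'"
proof (cases k)
  case 0
  then show ?thesis using assms by simp
next
  case (Suc m)
  then obtain D where D: "\<And>A y. gen x y \<Longrightarrow>
     ((\<lambda>\<epsilon>. H (y + \<epsilon> *\<^sub>R ex A)) has_real_derivative D A y) (at 0)" "\<And>A. van m x (D A)"
    using assms(1) by auto
  show ?thesis unfolding Suc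
    by (rule van_SucI[OF _ D(2)]) (rule DERIV_y_cong[OF _ assms(2) D(1)])
qed

lemma van_zero: "van k x (\<lambda>y. 0)"
proof (induction k)
  case (Suc k)
  then show ?case by (intro van_SucI[where H' = "\<lambda>A y. 0"]) auto
qed simp

lemma van_add: "van k x H \<Longrightarrow> van k x H' \<Longrightarrow> van k x (\<lambda>y. H y + H' y)"
proof (induction k arbitrary: H H')
  case (Suc k)
  obtain D where D: "\<And>A y. gen x y \<Longrightarrow>
     ((\<lambda>\<epsilon>. H (y + \<epsilon> *\<^sub>R ex A)) has_real_derivative D A y) (at 0)" "\<And>A. van k x (D A)"
    using Suc.prems(1) by auto
  obtain D' where D': "\<And>A y. gen x y \<Longrightarrow>
     ((\<lambda>\<epsilon>. H' (y + \<epsilon> *\<^sub>R ex A)) has_real_derivative D' A y) (at 0)" "\<And>A. van k x (D' A)"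
    using Suc.prems(2) by auto
  show ?case by (rule van_SucI[OF DERIV_add[OF D(1) D'(1)] Suc.IH[OF D(2) D'(2)]])
qed simp

lemma van_cmult: "van k x H \<Longrightarrow> van k x (\<lambda>y. c * H y)"
proof (induction k arbitrary: H)
  case (Suc k)
  obtain D where D: "\<And>A y. gen x y \<Longrightarrow>
     ((\<lambda>\<epsilon>. H (y + \<epsilon> *\<^sub>R ex A)) has_real_derivative D A y) (at 0)" "\<And>A. van k x (D A)"
    using Suc.prems(1) by auto
  show ?case by (rule van_SucI[OF DERIV_cmult[OF D(1)] Suc.IH[OF D(2)]])
qed simp

text \<open>By Leibniz at most one derivative falls on the coordinate, so a linear factor costs one
  order.\<close>

lemma van_coord:
  fixes x :: "'n::finite pt"
  shows "van k x H \<Longrightarrow> van (Suc k) x (\<lambda>y. y $ B * H y)"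
proof (induction k arbitrary: H)
  case 0
  then have "van (Suc 0) x (\<lambda>y. 0)" by (intro van_zero)
  with 0 show ?case by (elim van_cong) auto
next
  case (Suc k)
  obtain D where D: "\<And>A y. gen x y \<Longrightarrow>
     ((\<lambda>\<epsilon>. H (y + \<epsilon> *\<^sub>R ex A)) has_real_derivative D A y) (at 0)" "\<And>A. van k x (D A)"
    using Suc.prems by auto
  show ?case
  proof (rule van_SucI[where H' = "\<lambda>A y. (if A = B then 1 else 0) * H y + y $ B * D A y"])
    fix A y assume "gen x y"
    show "((\<lambda>\<epsilon>. (y + \<epsilon> *\<^sub>R ex A) $ B * H (y + \<epsilon> *\<^sub>R ex A)) has_real_derivative
       (if A = B then 1 else 0) * H y + y $ B * D A y) (at 0)"
      by (rule DERIV_cong[OF DERIV_mult[OF nth_line D(1)[OF \<open>gen x y\<close>]]]) simp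
  next
    show "van (Suc k) x (\<lambda>y. (if A = B then 1 else 0) * H y + y $ B * D A y)" for A
      by (intro van_add van_cmult Suc.prems Suc.IH D(2))
  qed
qed

lemma van_cyl:
  assumes "sm \<Theta>" "\<And>t r s z. (t, r, s, z) \<in> Reg \<Longrightarrow> ds \<Theta> t r s z = 0"
    "\<And>t r s z. (t, r, s, z) \<in> Reg \<Longrightarrow> dz \<Theta> t r s z = 0"
  shows "van (Suc 0) x (cyl \<Theta> x)"
proof (rule van_SucI[where H' = "\<lambda>A y. 0"])
  fix A y assume g: "gen x y"
  have "cyl (ds \<Theta>) x y = 0" "cyl (dz \<Theta>) x y = 0"
    using assms(2,3)[OF gen_region[OF g]] by (simp_all add: cyl_def)
  then show "((\<lambda>\<epsilon>. cyl \<Theta> x (y + \<epsilon> *\<^sub>R ex A)) has_real_derivative 0) (at 0)"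
    using DY_cyl[OF assms(1) g] by (cases A) auto
qed (rule van_zero)

lemma zero_derivs:
  assumes "\<And>t r s z. (t, r, s, z) \<in> Reg \<Longrightarrow> \<Theta> t r s z = 0" and p: "(t, r, s, z) \<in> Reg"
  shows "ds \<Theta> t r s z = 0" "dz \<Theta> t r s z = 0"
proof -
  have "((\<lambda>a. \<Theta> t r a z) has_real_derivative 0) (at s)"
  proof (rule has_field_derivative_transform_within_open[OF DERIV_const])
    show "open ((\<lambda>a. (t, r, a, z)) -` Reg)" by (intro open_vimage open_Reg continuous_intros)
  qed (use p assms(1) in auto)
  then show "ds \<Theta> t r s z = 0" unfolding ds_def by (rule DERIV_imp_deriv)
  have "((\<lambda>a. \<Theta> t r s a) has_real_derivative 0) (at z)"
  proof (rule has_field_derivative_transform_within_open[OF DERIV_const])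
    show "open ((\<lambda>a. (t, r, s, a)) -` Reg)" by (intro open_vimage open_Reg continuous_intros)
  qed (use p assms(1) in auto)
  then show "dz \<Theta> t r s z = 0" unfolding dz_def by (rule DERIV_imp_deriv)
qed

text \<open>Cancelling a factor \<open>s\<close> or \<open>z\<close> is possible only off its zero
  set; continuity along a coordinate line fills in \<open>s = 0\<close> or \<open>z = 0\<close>. The
  alternative in the hypothesis serves both variables.\<close>

lemma eq_0_by_density:
  assumes "sm \<Theta>" and p: "(t, r, s, z) \<in> Reg"
    and "(\<forall>a. (t, r, a, z) \<in> Reg \<longrightarrow> a \<noteq> 0 \<longrightarrow> \<Theta> t r a z = 0) \<or>
         (\<forall>a. (t, r, s, a) \<in> Reg \<longrightarrow> a \<noteq> 0 \<longrightarrow> \<Theta> t r s a = 0)"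
  shows "\<Theta> t r s z = 0"
proof -
  have lim0: "f b = 0" if c: "isCont f b" and o: "open V" "b \<in> V" "\<And>a. a \<in> V \<Longrightarrow> a \<noteq> 0 \<Longrightarrow> f a = 0"
    for f :: "real \<Rightarrow> real" and b V
  proof (cases "b = 0")
    case True
    have "\<forall>\<^sub>F a in at b. a \<in> V \<and> a \<noteq> 0"
      using o(1,2) True by (auto simp: eventually_at_topological)
    then have "\<forall>\<^sub>F a in at b. f a = 0" by (rule eventually_mono) (use o(3) in blast)
    then have "(f \<longlongrightarrow> 0) (at b)" by (rule tendsto_eventually)
    with c show ?thesis unfolding isCont_def by (rule tendsto_unique[OF trivial_limit_at])
  qed (use o in blast)
  have o: "open ((\<lambda>a. (t, r, a, z)) -` Reg)" "open ((\<lambda>a. (t, r, s, a)) -` Reg)"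
    by (intro open_vimage open_Reg continuous_intros)+
  have c: "isCont (\<lambda>a. \<Theta> t r a z) s" "isCont (\<lambda>a. \<Theta> t r s a) z"
    using sm_DERIV(3,4)[OF assms(1) p] by (auto intro: DERIV_isCont)
  show ?thesis
    using assms(3) lim0[OF c(1) o(1)] lim0[OF c(2) o(2)] p by auto
qed

text \<open>A function of degree one in \<open>(s, z)\<close> that is affine in \<open>z\<close> is linear in \<open>(s, z)\<close>:
  differentiating \<open>Omega \<Theta> = 0\<close> and using density of \<open>s \<noteq> 0\<close> kills the second derivatives.\<close>

lemma linear_in_s_z:
  assumes \<Theta>: "sm \<Theta>"
    and Om: "\<And>t r s z. (t, r, s, z) \<in> Reg \<Longrightarrow> Omega \<Theta> t r s z = 0"
    and zz: "\<And>t r s z. (t, r, s, z) \<in> Reg \<Longrightarrow> dz (dz \<Theta>) t r s z = 0"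
    and p: "(t, r, s, z) \<in> Reg"
  shows "ds (dz \<Theta>) t r s z = 0" "dz (ds \<Theta>) t r s z = 0" "ds (ds \<Theta>) t r s z = 0"
proof -
  have Z: "ds (Omega \<Theta>) t r s z = 0" "dz (Omega \<Theta>) t r s z = 0" if "(t, r, s, z) \<in> Reg" for t r s z
    by (rule zero_derivs[OF _ that]; erule Om)+
  note D = DERIV_Omega(1,2)[OF \<Theta>] Z
  have sz: "ds (dz \<Theta>) t r s z = 0" if p: "(t, r, s, z) \<in> Reg" for t r s z
  proof (rule eq_0_by_density[OF _ p], intro sm_d \<Theta>, rule disjI1, intro allI impI)
    fix a assume a: "(t, r, a, z) \<in> Reg" "a \<noteq> 0"
    then show "ds (dz \<Theta>) t r a z = 0" using D(2)[OF a(1)] D(4)[OF a(1)] zz[OF a(1)] by simp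
  qed
  show "ds (dz \<Theta>) t r s z = 0" by (rule sz[OF p])
  then show "dz (ds \<Theta>) t r s z = 0" using sm_commute(5)[OF \<Theta> p] by simp
  show "ds (ds \<Theta>) t r s z = 0"
  proof (rule eq_0_by_density[OF _ p], intro sm_d \<Theta>, rule disjI1, intro allI impI)
    fix a assume a: "(t, r, a, z) \<in> Reg" "a \<noteq> 0"
    then show "ds (ds \<Theta>) t r a z = 0" using D(1)[OF a(1)] D(3)[OF a(1)] sz[OF a(1)] by simp
  qed
qed

text \<open>Without the \<open>Omega\<close> term the gradient of \<open>u \<Theta>\<close> consists
  of \<open>dz \<Theta>\<close> and \<open>x $ Some i * ds \<Theta>\<close>, whose
  \<open>y\<close>-derivatives vanish by \<open>linear_in_s_z\<close>.\<close>

lemma van_un_cyl: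
  fixes x :: "'n::finite pt"
  assumes \<Theta>: "sm \<Theta>"
    and Om: "\<And>t r s z. (t, r, s, z) \<in> Reg \<Longrightarrow> Omega \<Theta> t r s z = 0"
    and zz: "\<And>t r s z. (t, r, s, z) \<in> Reg \<Longrightarrow> dz (dz \<Theta>) t r s z = 0"
  shows "van (Suc (Suc 0)) x (\<lambda>y. un y * cyl \<Theta> x y)"
proof (rule van_SucI[where H' = "\<lambda>A y. case A of None \<Rightarrow> cyl (dz \<Theta>) x y | Some i \<Rightarrow> x $ Some i * cyl (ds \<Theta>) x y"])
  fix A y assume g: "gen x y"
  have "cyl (Omega \<Theta>) x y = 0" using Om[OF gen_region[OF g]] by (simp add: cyl_def)
  then show "((\<lambda>\<epsilon>. un (y + \<epsilon> *\<^sub>R ex A) * cyl \<Theta> x (y + \<epsilon> *\<^sub>R ex A)) has_real_derivative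
      (case A of None \<Rightarrow> cyl (dz \<Theta>) x y | Some i \<Rightarrow> x $ Some i * cyl (ds \<Theta>) x y)) (at 0)"
    using DY_un_cyl[OF \<Theta> g] by (cases A) (auto simp: mult.commute)
next
  note l = linear_in_s_z[OF \<Theta> Om zz]
  show "van (Suc 0) x (\<lambda>y. case A of None \<Rightarrow> cyl (dz \<Theta>) x y | Some i \<Rightarrow> x $ Some i * cyl (ds \<Theta>) x y)" for A
    using van_cyl[OF sm_d(4)[OF \<Theta>] l(1) zz] van_cmult[OF van_cyl[OF sm_d(3)[OF \<Theta>] l(3,2)]]
    by (cases A) simp_all
qed

lemma DERIV_Omega2:
  assumes "sm \<Theta>" "(t, r, s, z) \<in> Reg"
  shows "ds (Omega2 \<Theta>) t r s z = Omega (ds \<Theta>) t r s z" "dz (Omega2 \<Theta>) t r s z = Omega (dz \<Theta>) t r s z"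
proof -
  note D = sm_DERIV[OF assms] sm_DERIV[OF sm_d(3)[OF assms(1)] assms(2)] sm_DERIV[OF sm_d(4)[OF assms(1)] assms(2)]
  have "((\<lambda>a. Omega2 \<Theta> t r a z) has_real_derivative Omega (ds \<Theta>) t r s z) (at s)"
    unfolding Omega_def Omega2_def
    by (rule derivative_eq_intros D refl | simp add: algebra_simps sm_commute[OF assms])+
  then show "ds (Omega2 \<Theta>) t r s z = Omega (ds \<Theta>) t r s z"
    unfolding ds_def[of "Omega2 \<Theta>"] by (rule DERIV_imp_deriv)
  have "((\<lambda>a. Omega2 \<Theta> t r s a) has_real_derivative Omega (dz \<Theta>) t r s z) (at z)"
    unfolding Omega_def Omega2_def
    by (rule derivative_eq_intros D refl | simp add: algebra_simps sm_commute[OF assms])+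
  then show "dz (Omega2 \<Theta>) t r s z = Omega (dz \<Theta>) t r s z"
    unfolding dz_def[of "Omega2 \<Theta>"] by (rule DERIV_imp_deriv)
qed

text \<open>The gradient of \<open>u^2 \<Theta>\<close> is built from \<open>u * dz \<Theta>\<close>
  and \<open>u * ds \<Theta>\<close>, covered by \<open>van_un_cyl\<close>, and from
  \<open>y $ Some i\<close> times \<open>Omega2 \<Theta>\<close>. The last factor has zero
  derivatives because differentiation turns \<open>Omega2\<close> into \<open>Omega\<close> of the
  derivative.\<close>

lemma van_un2_cyl:
  fixes x :: "'n::finite pt"
  assumes \<Theta>: "sm \<Theta>"
    and s: "\<And>t r s z. (t, r, s, z) \<in> Reg \<Longrightarrow> Omega (ds \<Theta>) t r s z = 0"
    and z: "\<And>t r s z. (t, r, s, z) \<in> Reg \<Longrightarrow> Omega (dz \<Theta>) t r s z = 0"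
    and zzz: "\<And>t r s z. (t, r, s, z) \<in> Reg \<Longrightarrow> dz (dz (dz \<Theta>)) t r s z = 0"
  shows "van (Suc (Suc (Suc 0))) x (\<lambda>y. (un y)\<^sup>2 * cyl \<Theta> x y)"
proof (rule van_SucI[where H' = "\<lambda>A y. case A of None \<Rightarrow> un y * cyl (dz \<Theta>) x y
    | Some i \<Rightarrow> x $ Some i * (un y * cyl (ds \<Theta>) x y) + y $ Some i * cyl (Omega2 \<Theta>) x y"])
  fix A y assume g: "gen x y"
  show "((\<lambda>\<epsilon>. (un (y + \<epsilon> *\<^sub>R ex A))\<^sup>2 * cyl \<Theta> x (y + \<epsilon> *\<^sub>R ex A)) has_real_derivative
      (case A of None \<Rightarrow> un y * cyl (dz \<Theta>) x y
    | Some i \<Rightarrow> x $ Some i * (un y * cyl (ds \<Theta>) x y) + y $ Some i * cyl (Omega2 \<Theta>) x y)) (at 0)"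
    using DY_un2_cyl[OF \<Theta> g] by (cases A) (auto simp: mult_ac)
next
  \<comment> \<open>\<open>van_un_cyl\<close> for \<open>ds \<Theta>\<close> asks for its second
    \<open>z\<close>-derivative; that it vanishes follows from the linearity of
    \<open>dz \<Theta>\<close> in \<open>(s, z)\<close> by commuting derivatives.\<close>
  have dzds: "dz (dz (ds \<Theta>)) t r s z = 0" if p: "(t, r, s, z) \<in> Reg" for t r s z
  proof -
    have "((\<lambda>a. ds (dz \<Theta>) t r s a) has_real_derivative 0) (at z)"
      using sm_DERIV(4)[OF sm_d(3)[OF sm_d(4)[OF \<Theta>]] p] linear_in_s_z(2)[OF sm_d(4)[OF \<Theta>] z zzz p] by simp
    then have "((\<lambda>a. dz (ds \<Theta>) t r s a) has_real_derivative 0) (at z)"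
    proof (rule has_field_derivative_transform_within_open)
      show "open ((\<lambda>a. (t, r, s, a)) -` Reg)" by (intro open_vimage open_Reg continuous_intros)
    qed (use p sm_commute(5)[OF \<Theta>] in auto)
    then show ?thesis unfolding dz_def[of "dz (ds \<Theta>)"] by (rule DERIV_imp_deriv)
  qed
  have 1: "van 2 x (\<lambda>y. un y * cyl (dz \<Theta>) x y)" "van 2 x (\<lambda>y. un y * cyl (ds \<Theta>) x y)"
    unfolding numeral_2_eq_2
    using van_un_cyl[OF sm_d(4)[OF \<Theta>] z zzz] van_un_cyl[OF sm_d(3)[OF \<Theta>] s dzds] by auto
  have 2: "van (Suc 0) x (cyl (Omega2 \<Theta>) x)"
    by (rule van_cyl[OF sm_Omega2[OF \<Theta>]]) (simp_all add: DERIV_Omega2[OF \<Theta>] s z)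
  show "van (Suc (Suc 0)) x (\<lambda>y. case A of None \<Rightarrow> un y * cyl (dz \<Theta>) x y
    | Some i \<Rightarrow> x $ Some i * (un y * cyl (ds \<Theta>) x y) + y $ Some i * cyl (Omega2 \<Theta>) x y)" for A
    using 1 van_add[OF van_cmult[OF 1(2)] van_coord[OF 2, folded numeral_2_eq_2]]
    by (cases A) (simp_all add: numeral_2_eq_2[symmetric] del: van.simps)
qed

lemma van3_dY:
  fixes x :: "'n::finite pt" and K :: "'n fn"
  assumes "van (Suc (Suc (Suc 0))) x H" "\<And>y. gen x y \<Longrightarrow> K x y = H y" "gen x y"
  shows "dY D (dY C (dY B K)) x y = 0"
proof -
  have step: "\<exists>H'. van k x H' \<and> (\<forall>y. gen x y \<longrightarrow> dY A K x y = H' y)"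
    if v: "van (Suc k) x H" and "\<And>y. gen x y \<Longrightarrow> K x y = H y" for k H and K :: "'n fn" and A
  proof -
    obtain H' where H': "\<And>A y. gen x y \<Longrightarrow>
       ((\<lambda>\<epsilon>. H (y + \<epsilon> *\<^sub>R ex A)) has_real_derivative H' A y) (at 0)" "\<And>A. van k x (H' A)"
      using v by auto
    have "dY A K x y = H' A y" if g: "gen x y" for y
      using dY_cong[of x K "\<lambda>_. H" y A] dY_I[of "\<lambda>_. H" x y A] H'(1)[OF g] g \<open>\<And>y. gen x y \<Longrightarrow> K x y = H y\<close>
      by simp
    with H'(2) show ?thesis by blast
  qed
  obtain H1 where 1: "van (Suc (Suc 0)) x H1" "\<forall>y. gen x y \<longrightarrow> dY B K x y = H1 y"
    using step[of "Suc (Suc 0)" H K B] assms by blast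
  obtain H2 where 2: "van (Suc 0) x H2" "\<forall>y. gen x y \<longrightarrow> dY C (dY B K) x y = H2 y"
    using step[of "Suc 0" H1 "dY B K" C] 1 by blast
  obtain H3 where 3: "van 0 x H3" "\<forall>y. gen x y \<longrightarrow> dY D (dY C (dY B K)) x y = H3 y"
    using step[of 0 H2 "dY C (dY B K)" D] 2 by blast
  then show ?thesis using assms(3) by simp
qed

end

subsection \<open>Recovering the equations from the Douglas tensor\<close>

context cyl_region
begin

text \<open>Differentiating \<open>1 / z\<close> supplies the undifferentiated
  \<open>\<Theta>\<close> by which \<open>Omega\<close> differs from \<open>Psi\<close>. At
  \<open>z = 0\<close> the outer factor erases all information, which the case distinction
  records.\<close>

lemma Psi_overz:
  assumes \<Theta>: "sm \<Theta>" and p: "(t, r, s, z) \<in> Reg"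
  shows "z * Psi (overz \<Theta>) t r s z = (if z = 0 then 0 else Omega \<Theta> t r s z)"
proof (cases "z = 0")
  case False
  have "((\<lambda>a. overz \<Theta> t r a z) has_real_derivative ds \<Theta> t r s z / z) (at s)"
    unfolding overz_def by (intro DERIV_cdivide sm_DERIV(3)[OF \<Theta> p])
  then have "ds (overz \<Theta>) t r s z = ds \<Theta> t r s z / z"
    unfolding ds_def[of "overz \<Theta>"] by (rule DERIV_imp_deriv)
  moreover have "((\<lambda>a. overz \<Theta> t r s a) has_real_derivative dz \<Theta> t r s z / z - \<Theta> t r s z / z * 1 / z) (at z)"
    unfolding overz_def by (rule DERIV_divide_at[OF sm_DERIV(4)[OF \<Theta> p] DERIV_ident False])
  then have "dz (overz \<Theta>) t r s z = dz \<Theta> t r s z / z - \<Theta> t r s z / z * 1 / z"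
    unfolding dz_def[of "overz \<Theta>"] by (rule DERIV_imp_deriv)
  ultimately show ?thesis
    using False by (simp add: Psi_def Omega_def field_simps)
qed simp

text \<open>The quantifiers belong to the claim: pointwise the left-hand equation is empty at
  \<open>z = 0\<close>, and \<open>Omega \<Theta> = 0\<close> is obtained there as a limit along
  \<open>z\<close>.\<close>

lemma Psi_overz_iff:
  assumes \<Theta>: "sm \<Theta>"
  shows "(\<forall>t r s z. (t, r, s, z) \<in> Reg \<longrightarrow> z * Psi (overz \<Theta>) t r s z = 0) \<longleftrightarrow>
    (\<forall>t r s z. (t, r, s, z) \<in> Reg \<longrightarrow> Omega \<Theta> t r s z = 0)"
proof (intro iffI allI impI)
  fix t r s z assume *: "\<forall>t r s z. (t, r, s, z) \<in> Reg \<longrightarrow> z * Psi (overz \<Theta>) t r s z = 0"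
    and p: "(t, r, s, z) \<in> Reg"
  show "Omega \<Theta> t r s z = 0"
  proof (rule eq_0_by_density[OF sm_Omega[OF \<Theta>] p], rule disjI2, intro allI impI)
    fix a :: real assume a: "(t, r, s, a) \<in> Reg" "a \<noteq> 0"
    show "Omega \<Theta> t r s a = 0"
      using Psi_overz[OF \<Theta> a(1)] * a by simp
  qed
qed (simp add: Psi_overz[OF \<Theta>])

text \<open>Third derivatives are read off from an explicit part \<open>P\<close> after discarding a
  part \<open>H\<close> whose third derivatives vanish; when \<open>U\<close> is recovered,
  \<open>H\<close> is the contribution of \<open>T\<close>. The last derivative is taken at one
  point only, where special coordinates are available.\<close>

lemma dY_chain3:
  fixes x :: "'n::finite pt" and K :: "'n fn"
  assumes y: "gen x y"
    and H: "van (Suc (Suc (Suc 0))) x H"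
    and K: "\<And>y. gen x y \<Longrightarrow> K x y = P y - H y"
    and Q: "\<And>y. gen x y \<Longrightarrow> ((\<lambda>\<epsilon>. P (y + \<epsilon> *\<^sub>R ex B)) has_real_derivative Q y) (at 0)"
    and Q': "\<And>y. gen x y \<Longrightarrow> ((\<lambda>\<epsilon>. Q (y + \<epsilon> *\<^sub>R ex C)) has_real_derivative Q' y) (at 0)"
    and PQ: "((\<lambda>\<epsilon>. Q' (y + \<epsilon> *\<^sub>R ex D)) has_real_derivative d) (at 0)"
  shows "dY D (dY C (dY B K)) x y = d"
proof -
  obtain H1 where H1: "\<And>A y. gen x y \<Longrightarrow> ((\<lambda>\<epsilon>. H (y + \<epsilon> *\<^sub>R ex A)) has_real_derivative H1 A y) (at 0)"
    "\<And>A. van (Suc (Suc 0)) x (H1 A)"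
    using H unfolding van.simps(2)[of "Suc (Suc 0)"] by blast
  obtain H2 where H2: "\<And>A y. gen x y \<Longrightarrow> ((\<lambda>\<epsilon>. H1 B (y + \<epsilon> *\<^sub>R ex A)) has_real_derivative H2 A y) (at 0)"
    "\<And>A. van (Suc 0) x (H2 A)"
    using H1(2)[of B] unfolding van.simps(2)[of "Suc 0"] by blast
  obtain H3 where H3: "\<And>A y. gen x y \<Longrightarrow> ((\<lambda>\<epsilon>. H2 C (y + \<epsilon> *\<^sub>R ex A)) has_real_derivative H3 A y) (at 0)"
    "\<And>A. van 0 x (H3 A)"
    using H2(2)[of C] unfolding van.simps(2)[of 0] by blast
  have 1: "dY B K x y = Q y - H1 B y" if "gen x y" for y
    by (rule dY_eqI[where K = K and K' = "\<lambda>y. P y - H y", OF that K DERIV_diff[OF Q[OF that] H1(1)[OF that]]])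
  have 2: "dY C (dY B K) x y = Q' y - H2 C y" if "gen x y" for y
    by (rule dY_eqI[where K = "dY B K" and K' = "\<lambda>y. Q y - H1 B y",
          OF that 1 DERIV_diff[OF Q'[OF that] H2(1)[OF that]]])
  have "dY D (dY C (dY B K)) x y = d - H3 D y"
    by (rule dY_eqI[where K = "dY C (dY B K)" and K' = "\<lambda>y. Q' y - H2 C y",
          OF y 2 DERIV_diff[OF PQ H3(1)[OF y]]])
  then show ?thesis using H3(2)[of D] y by simp
qed

text \<open>At a zero of the coordinate the difference quotient is \<open>h\<close> itself, so
  continuity of \<open>h\<close> suffices and the last derivative along \<open>k\<close> is
  evaluated without differentiating \<open>h\<close>.\<close>

lemma DERIV_coord_mult:
  fixes y :: "'n::finite pt"
  assumes "y $ B = 0" "isCont (\<lambda>\<epsilon>. h (y + \<epsilon> *\<^sub>R ex B)) 0"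
  shows "((\<lambda>\<epsilon>. (y + \<epsilon> *\<^sub>R ex B) $ B * h (y + \<epsilon> *\<^sub>R ex B)) has_real_derivative h y) (at 0)"
proof -
  have "(\<lambda>\<epsilon>. h (y + \<epsilon> *\<^sub>R ex B)) \<midarrow>0\<rightarrow> h y"
    using assms(2) by (simp add: isCont_def)
  then have "(\<lambda>\<epsilon>. \<epsilon> * h (y + \<epsilon> *\<^sub>R ex B) / \<epsilon>) \<midarrow>0\<rightarrow> h y"
    by (rule Lim_transform_eventually) (auto simp: eventually_at_filter)
  then show ?thesis by (simp add: DERIV_def assms(1) ex_nth)
qed

lemma isCont_gen:
  assumes "gen x y"
  shows "isCont (\<lambda>\<epsilon>. un (y + \<epsilon> *\<^sub>R ex A)) 0" "isCont (\<lambda>\<epsilon>. cs x (y + \<epsilon> *\<^sub>R ex A)) 0"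
    "isCont (\<lambda>\<epsilon>. cz (y + \<epsilon> *\<^sub>R ex A)) 0" "isCont (\<lambda>\<epsilon>. (y + \<epsilon> *\<^sub>R ex A) $ B) 0"
    "sm \<Theta> \<Longrightarrow> isCont (\<lambda>\<epsilon>. cyl \<Theta> x (y + \<epsilon> *\<^sub>R ex A)) 0"
  using DY_un[OF assms, THEN DERIV_isCont] DY_cs[OF assms, THEN DERIV_isCont]
    DY_cz[OF assms, THEN DERIV_isCont] nth_line[THEN DERIV_isCont]
    DY_cyl[OF _ assms, THEN DERIV_isCont, of \<Theta>]
  by (cases A; simp)+

text \<open>The derivatives along (0,0,0), (0,k,k) and (i,k,k) give the three equations in this
  order. Axis \<open>k\<close> is orthogonal to both bar-parts at the point, so differentiating
  twice along it isolates \<open>Omega\<close> terms.\<close>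

lemma third_derivs_un2_cyl:
  fixes x y :: "'n::finite pt" and K :: "'n fn"
  assumes \<Theta>: "sm \<Theta>" and y: "gen x y"
    and H: "van (Suc (Suc (Suc 0))) x H" and c: "c \<noteq> 0"
    and K: "\<And>y. gen x y \<Longrightarrow> K x y = c * ((un y)\<^sup>2 * cyl \<Theta> x y) - H y"
    and z: "\<And>B C D. dY D (dY C (dY B K)) x y = 0"
    and pt: "un y = 1" "x $ Some i = un x" "y $ Some i = cs x y / un x" "x $ Some k = 0" "y $ Some k = 0"
  shows "cyl (dz (dz (dz \<Theta>))) x y = 0" "cyl (Omega (dz \<Theta>)) x y = 0" "cyl (Omega (ds \<Theta>)) x y = 0"
proof -
  have xpos: "un x > 0" using gen_nonzero[OF y] by simp
  have ik: "i \<noteq> k" using pt xpos by auto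
  note zz = sm_d(4)[OF \<Theta>]
  have "dY None (dY None (dY None K)) x y = c * (cyl (dz (dz (dz \<Theta>))) x y / un y)"
  proof (rule dY_chain3[where K = K and H = H and P = "\<lambda>y. c * ((un y)\<^sup>2 * cyl \<Theta> x y)", OF y H K])
    show "((\<lambda>\<epsilon>. c * ((un (y + \<epsilon> *\<^sub>R ex None))\<^sup>2 * cyl \<Theta> x (y + \<epsilon> *\<^sub>R ex None))) has_real_derivative
       c * (un y * cyl (dz \<Theta>) x y)) (at 0)" if "gen x y" for y
      by (rule DERIV_cmult[OF DY_un2_cyl(1)[OF \<Theta> that]])
    show "((\<lambda>\<epsilon>. c * (un (y + \<epsilon> *\<^sub>R ex None) * cyl (dz \<Theta>) x (y + \<epsilon> *\<^sub>R ex None))) has_real_derivative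
       c * cyl (dz (dz \<Theta>)) x y) (at 0)" if "gen x y" for y
      by (rule DERIV_cmult[OF DY_un_cyl(1)[OF zz that]])
    show "((\<lambda>\<epsilon>. c * cyl (dz (dz \<Theta>)) x (y + \<epsilon> *\<^sub>R ex None)) has_real_derivative
       c * (cyl (dz (dz (dz \<Theta>))) x y / un y)) (at 0)"
      by (rule DERIV_cmult[OF DY_cyl(1)[OF sm_d(4)[OF zz] y]])
  qed
  then show "cyl (dz (dz (dz \<Theta>))) x y = 0" using z c pt by simp

  have "dY (Some k) (dY (Some k) (dY None K)) x y = c * (cyl (Omega (dz \<Theta>)) x y / un y)"
  proof (rule dY_chain3[where K = K and H = H and P = "\<lambda>y. c * ((un y)\<^sup>2 * cyl \<Theta> x y)", OF y H K])
    show "((\<lambda>\<epsilon>. c * ((un (y + \<epsilon> *\<^sub>R ex None))\<^sup>2 * cyl \<Theta> x (y + \<epsilon> *\<^sub>R ex None))) has_real_derivative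
       c * (un y * cyl (dz \<Theta>) x y)) (at 0)" if "gen x y" for y
      by (rule DERIV_cmult[OF DY_un2_cyl(1)[OF \<Theta> that]])
    show "((\<lambda>\<epsilon>. c * (un (y + \<epsilon> *\<^sub>R ex (Some k)) * cyl (dz \<Theta>) x (y + \<epsilon> *\<^sub>R ex (Some k)))) has_real_derivative
       c * (y $ Some k * (cyl (Omega (dz \<Theta>)) x y / un y))) (at 0)" if "gen x y" for y
      by (rule DERIV_cong[OF DERIV_cmult[OF DY_un_cyl(2)[OF zz that]]]) (simp add: pt)
    show "((\<lambda>\<epsilon>. c * ((y + \<epsilon> *\<^sub>R ex (Some k)) $ Some k *
        (cyl (Omega (dz \<Theta>)) x (y + \<epsilon> *\<^sub>R ex (Some k)) / un (y + \<epsilon> *\<^sub>R ex (Some k))))) has_real_derivative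
        c * (cyl (Omega (dz \<Theta>)) x y / un y)) (at 0)"
      by (rule DERIV_cmult[OF DERIV_coord_mult[where h = "\<lambda>y. cyl (Omega (dz \<Theta>)) x y / un y"]])
         (use pt y in \<open>auto intro!: continuous_intros isCont_gen sm_Omega zz\<close>)
  qed
  then show 2: "cyl (Omega (dz \<Theta>)) x y = 0" using z c pt by simp

  \<comment> \<open>Up to the constant \<open>c\<close>, the derivative along \<open>i\<close> and
    then \<open>k\<close> is \<open>y $ Some k\<close> times this \<open>h\<close>, because
    \<open>x $ Some k = 0\<close>.\<close>
  define h where "h = (\<lambda>y. x $ Some i * (cyl (Omega (ds \<Theta>)) x y / un y)
     - y $ Some i * ((cyl (Omega (ds \<Theta>)) x y * cs x y + cyl (Omega (dz \<Theta>)) x y * cz y) / (un y * un y)))"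
  have "dY (Some k) (dY (Some k) (dY (Some i) K)) x y = c * h y"
  proof (rule dY_chain3[where K = K and H = H and P = "\<lambda>y. c * ((un y)\<^sup>2 * cyl \<Theta> x y)", OF y H K])
    show "((\<lambda>\<epsilon>. c * ((un (y + \<epsilon> *\<^sub>R ex (Some i)))\<^sup>2 * cyl \<Theta> x (y + \<epsilon> *\<^sub>R ex (Some i)))) has_real_derivative
       c * (un y * cyl (ds \<Theta>) x y * x $ Some i + cyl (Omega2 \<Theta>) x y * y $ Some i)) (at 0)" if "gen x y" for y
      by (rule DERIV_cmult[OF DY_un2_cyl(2)[OF \<Theta> that]])
    show "((\<lambda>\<epsilon>. c * (un (y + \<epsilon> *\<^sub>R ex (Some k)) * cyl (ds \<Theta>) x (y + \<epsilon> *\<^sub>R ex (Some k)) * x $ Some i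
        + cyl (Omega2 \<Theta>) x (y + \<epsilon> *\<^sub>R ex (Some k)) * (y + \<epsilon> *\<^sub>R ex (Some k)) $ Some i)) has_real_derivative
       c * (y $ Some k * h y)) (at 0)" if g: "gen x y" for y
    proof -
      have "cyl (ds (Omega2 \<Theta>)) x y = cyl (Omega (ds \<Theta>)) x y" "cyl (dz (Omega2 \<Theta>)) x y = cyl (Omega (dz \<Theta>)) x y"
        using DERIV_Omega2[OF \<Theta> gen_region[OF g]] by (simp_all add: cyl_def)
      then show ?thesis
        by (intro DERIV_cong[OF DERIV_cmult[OF DERIV_add[OF DERIV_cmult_right DERIV_mult]],
            OF DY_un_cyl(2)[OF sm_d(3)[OF \<Theta>] g] DY_cyl(2)[OF sm_Omega2[OF \<Theta>] g] nth_line])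
           (use gen_nonzero[OF g] ik in \<open>simp add: pt h_def field_simps\<close>)
    qed
    show "((\<lambda>\<epsilon>. c * ((y + \<epsilon> *\<^sub>R ex (Some k)) $ Some k * h (y + \<epsilon> *\<^sub>R ex (Some k)))) has_real_derivative c * h y) (at 0)"
      using pt y gen_nonzero[OF y] unfolding h_def
      by (intro DERIV_cmult DERIV_coord_mult continuous_intros isCont_gen sm_Omega sm_d \<Theta>) auto
  qed
  then have "h y = 0" using z c by simp
  \<comment> \<open>With \<open>Omega (dz \<Theta>)\<close> already zero and the point in normal
    form, \<open>h y\<close> is \<open>Omega (ds \<Theta>)\<close> times
    \<open>(r^2 - s^2) / r\<close>.\<close>
  then have "cyl (Omega (ds \<Theta>)) x y * ((un x)\<^sup>2 - (cs x y)\<^sup>2) = 0"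
    using xpos by (simp add: h_def pt 2 field_simps power2_eq_square)
  moreover have "(cs x y)\<^sup>2 < (un x)\<^sup>2"
    using gen_region[OF y] power2_strict_mono[of "\<bar>cs x y\<bar>" "un x"] by (simp add: phi_region_def)
  ultimately show "cyl (Omega (ds \<Theta>)) x y = 0" by simp
qed

text \<open>Meant for component \<open>k\<close> of \<open>K\<close>, which has no
  \<open>x\<close>-term since \<open>x $ Some k = 0\<close>. The derivatives along (0,0,k) and
  (k,k,k) isolate \<open>dz (dz \<Theta>)\<close> and \<open>Omega \<Theta>\<close>.\<close>

lemma third_derivs_un_cyl:
  fixes x y :: "'n::finite pt" and K :: "'n fn"
  assumes \<Theta>: "sm \<Theta>" and y: "gen x y"
    and K: "\<And>y. gen x y \<Longrightarrow> K x y = - (y $ Some k * (un y * cyl \<Theta> x y))"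
    and z: "\<And>B C D. dY D (dY C (dY B K)) x y = 0"
    and pt: "un y = 1" "x $ Some k = 0" "y $ Some k = 0"
  shows "cyl (dz (dz \<Theta>)) x y = 0" "cyl (Omega \<Theta>) x y = 0"
proof -
  have K0: "K x y = - 1 * (y $ Some k * (un y * cyl \<Theta> x y)) - 0" if "gen x y" for y
    using K[OF that] by simp
  note zz = sm_d(4)[OF \<Theta>]
  have "dY (Some k) (dY None (dY None K)) x y = - 1 * (cyl (dz (dz \<Theta>)) x y / un y)"
  proof (rule dY_chain3[where K = K and H = "\<lambda>y. 0" and
      P = "\<lambda>y. - 1 * (y $ Some k * (un y * cyl \<Theta> x y))", OF y van_zero K0])
    show "((\<lambda>\<epsilon>. - 1 * ((y + \<epsilon> *\<^sub>R ex None) $ Some k * (un (y + \<epsilon> *\<^sub>R ex None) * cyl \<Theta> x (y + \<epsilon> *\<^sub>R ex None))))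
       has_real_derivative - 1 * (y $ Some k * cyl (dz \<Theta>) x y)) (at 0)" if "gen x y" for y
      by (rule DERIV_cmult[OF DERIV_cong[OF DERIV_mult[OF nth_line DY_un_cyl(1)[OF \<Theta> that]]]]) simp
    show "((\<lambda>\<epsilon>. - 1 * ((y + \<epsilon> *\<^sub>R ex None) $ Some k * cyl (dz \<Theta>) x (y + \<epsilon> *\<^sub>R ex None)))
       has_real_derivative - 1 * (y $ Some k * (cyl (dz (dz \<Theta>)) x y / un y))) (at 0)" if "gen x y" for y
      by (rule DERIV_cmult[OF DERIV_cong[OF DERIV_mult[OF nth_line DY_cyl(1)[OF zz that]]]]) simp
    show "((\<lambda>\<epsilon>. - 1 * ((y + \<epsilon> *\<^sub>R ex (Some k)) $ Some k * (cyl (dz (dz \<Theta>)) x (y + \<epsilon> *\<^sub>R ex (Some k))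
         / un (y + \<epsilon> *\<^sub>R ex (Some k)))))
       has_real_derivative - 1 * (cyl (dz (dz \<Theta>)) x y / un y)) (at 0)"
      by (rule DERIV_cmult[OF DERIV_coord_mult[where h = "\<lambda>y. cyl (dz (dz \<Theta>)) x y / un y"]])
         (use pt y in \<open>auto intro!: continuous_intros isCont_gen sm_d \<Theta>\<close>)
  qed
  then show "cyl (dz (dz \<Theta>)) x y = 0" using z pt by simp

  \<comment> \<open>The 3 counts which of the three derivatives falls on the factor
    \<open>y $ Some k\<close>; the other term carries that coordinate squared and drops out at the
    point.\<close>
  define h where "h = (\<lambda>y. 3 * (cyl (Omega \<Theta>) x y / un y) - y $ Some k * y $ Some k *
     ((cyl (ds (Omega \<Theta>)) x y * cs x y + cyl (dz (Omega \<Theta>)) x y * cz y + cyl (Omega \<Theta>) x y) / (un y * un y * un y)))"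
  have "dY (Some k) (dY (Some k) (dY (Some k) K)) x y = - 1 * h y"
  proof (rule dY_chain3[where K = K and H = "\<lambda>y. 0" and
      P = "\<lambda>y. - 1 * (y $ Some k * (un y * cyl \<Theta> x y))", OF y van_zero K0])
    show "((\<lambda>\<epsilon>. - 1 * ((y + \<epsilon> *\<^sub>R ex (Some k)) $ Some k *
        (un (y + \<epsilon> *\<^sub>R ex (Some k)) * cyl \<Theta> x (y + \<epsilon> *\<^sub>R ex (Some k)))))
       has_real_derivative - 1 * (un y * cyl \<Theta> x y +
         y $ Some k * y $ Some k * (cyl (Omega \<Theta>) x y / un y))) (at 0)" if "gen x y" for y
      by (rule DERIV_cmult[OF DERIV_cong[OF DERIV_mult[OF nth_line DY_un_cyl(2)[OF \<Theta> that]]]])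
         (simp add: pt)
    show "((\<lambda>\<epsilon>. - 1 * (un (y + \<epsilon> *\<^sub>R ex (Some k)) * cyl \<Theta> x (y + \<epsilon> *\<^sub>R ex (Some k)) +
        (y + \<epsilon> *\<^sub>R ex (Some k)) $ Some k * (y + \<epsilon> *\<^sub>R ex (Some k)) $ Some k *
          (cyl (Omega \<Theta>) x (y + \<epsilon> *\<^sub>R ex (Some k)) / un (y + \<epsilon> *\<^sub>R ex (Some k)))))
       has_real_derivative - 1 * (y $ Some k * h y)) (at 0)" if g: "gen x y" for y
    proof -
      have u: "un y \<noteq> 0" using gen_nonzero[OF g] by simp
      show ?thesis
        by (rule DERIV_cmult[OF DERIV_cong[OF DERIV_add[OF DY_un_cyl(2)[OF \<Theta> g]
              DERIV_mult[OF DERIV_mult[OF nth_line nth_line]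
                DERIV_divide_at[OF DY_cyl(2)[OF sm_Omega[OF \<Theta>] g] DY_un(2)[OF g]]]]]])
           (use u in \<open>simp_all add: pt h_def field_simps\<close>)
    qed
    show "((\<lambda>\<epsilon>. - 1 * ((y + \<epsilon> *\<^sub>R ex (Some k)) $ Some k * h (y + \<epsilon> *\<^sub>R ex (Some k)))) has_real_derivative - 1 * h y) (at 0)"
      using pt y gen_nonzero[OF y] unfolding h_def
      by (intro DERIV_cmult DERIV_coord_mult continuous_intros isCont_gen sm_Omega sm_d \<Theta>) auto
  qed
  then show "cyl (Omega \<Theta>) x y = 0" using z pt by (simp add: h_def)
qed

end

context cyl_finsler3
begin

text \<open>\<open>T\<close> has to precede \<open>U\<close>: component \<open>i\<close> mixes both,
  and only after \<open>T\<close> has been read off from component \<open>k\<close> is its share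
  known to be quadratic and to drop out. \<open>R\<close> sits alone in component 0.\<close>

lemma douglas_gen_zero_imp:
  assumes D: "\<And>x y A B C D. gen x y \<Longrightarrow> douglas F A B C D x y = 0"
  shows "\<And>t r s z. (t, r, s, z) \<in> Reg \<Longrightarrow> Omega T t r s z = 0 \<and> dz (dz T) t r s z = 0"
    "\<And>t r s z. (t, r, s, z) \<in> Reg \<Longrightarrow>
      dz (dz (dz R)) t r s z = 0 \<and> Omega (dz R) t r s z = 0 \<and> Omega (ds R) t r s z = 0"
    "\<And>t r s z. (t, r, s, z) \<in> Reg \<Longrightarrow>
      dz (dz (dz U)) t r s z = 0 \<and> Omega (dz U) t r s z = 0 \<and> Omega (ds U) t r s z = 0"
proof -
  have z: "dY D (dY C (dY B (K A))) x y = 0" if "gen x y" for x y A B C D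
    using D[OF that, of A B C D] by (simp add: douglas_K)
  have T: "Omega T t r s z = 0 \<and> dz (dz T) t r s z = 0" if p: "(t, r, s, z) \<in> Reg" for t r s z
  proof -
    obtain x y :: "'n pt" and i k where pt: "gen x y" "x $ None = t" "un x = r" "cs x y = s" "cz y = z"
      "un y = 1" "x $ Some i = r" "y $ Some i = s / r" "x $ Some k = 0" "y $ Some k = 0"
      using region_gen[OF p n3] by metis
    have "K (Some k) x y = - (y $ Some k * (un y * cyl T x y))" if "gen x y" for y
      using pt by (simp add: K_Some[OF that])
    from third_derivs_un_cyl[where K = "K (Some k)", OF sm_T pt(1) this z[OF pt(1)] pt(6,9,10)]
    show ?thesis by (simp add: cyl_def pt)
  qed
  then show "\<And>t r s z. (t, r, s, z) \<in> Reg \<Longrightarrow> Omega T t r s z = 0 \<and> dz (dz T) t r s z = 0" .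
  fix t r s z assume p: "(t, r, s, z) \<in> Reg"
  obtain x y :: "'n pt" and i k where pt: "gen x y" "x $ None = t" "un x = r" "cs x y = s" "cz y = z"
      "un y = 1" "x $ Some i = r" "y $ Some i = s / r" "x $ Some k = 0" "y $ Some k = 0"
    using region_gen[OF p n3] by metis
  have pt': "x $ Some i = un x" "y $ Some i = cs x y / un x" using pt by auto
  have "K None x y = 1 * ((un y)\<^sup>2 * cyl R x y) - 0" if "gen x y" for y
    by (simp add: K_None[OF that])
  from third_derivs_un2_cyl[where K = "K None" and H = "\<lambda>y. 0" and c = 1,
      OF sm_R pt(1) van_zero _ this z[OF pt(1)] pt(6) pt' pt(9,10)]
  show "dz (dz (dz R)) t r s z = 0 \<and> Omega (dz R) t r s z = 0 \<and> Omega (ds R) t r s z = 0"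
    by (simp add: cyl_def pt)
  have KU: "K (Some i) x y = r * ((un y)\<^sup>2 * cyl U x y) - y $ Some i * (un y * cyl T x y)" if "gen x y" for y
    by (simp add: K_Some[OF that] pt)
  have vU: "van (Suc (Suc (Suc 0))) x (\<lambda>y. y $ Some i * (un y * cyl T x y))"
    using T by (intro van_coord van_un_cyl sm_T) auto
  show "dz (dz (dz U)) t r s z = 0 \<and> Omega (dz U) t r s z = 0 \<and> Omega (ds U) t r s z = 0"
    using third_derivs_un2_cyl[where K = "K (Some i)" and c = r,
        OF sm_U pt(1) vU Reg_nonzero(1)[OF p] KU z[OF pt(1)] pt(6) pt' pt(9,10)]
    by (simp add: cyl_def pt)
qed

lemma douglas_gen_zero:
  assumes T: "\<And>t r s z. (t, r, s, z) \<in> Reg \<Longrightarrow> Omega T t r s z = 0"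
    "\<And>t r s z. (t, r, s, z) \<in> Reg \<Longrightarrow> dz (dz T) t r s z = 0"
    and R: "\<And>t r s z. (t, r, s, z) \<in> Reg \<Longrightarrow> Omega (ds R) t r s z = 0"
    "\<And>t r s z. (t, r, s, z) \<in> Reg \<Longrightarrow> Omega (dz R) t r s z = 0"
    "\<And>t r s z. (t, r, s, z) \<in> Reg \<Longrightarrow> dz (dz (dz R)) t r s z = 0"
    and U: "\<And>t r s z. (t, r, s, z) \<in> Reg \<Longrightarrow> Omega (ds U) t r s z = 0"
    "\<And>t r s z. (t, r, s, z) \<in> Reg \<Longrightarrow> Omega (dz U) t r s z = 0"
    "\<And>t r s z. (t, r, s, z) \<in> Reg \<Longrightarrow> dz (dz (dz U)) t r s z = 0"
    and g: "gen x y"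
  shows "douglas F A B C D x y = 0"
proof (cases A)
  case None
  show ?thesis unfolding douglas_K None
    by (rule van3_dY[OF van_un2_cyl[OF sm_R R]]) (simp_all add: K_None g)
next
  case (Some i)
  have "van (Suc (Suc (Suc 0))) x (\<lambda>y. x $ Some i * ((un y)\<^sup>2 * cyl U x y)
      + (- 1) * (y $ Some i * (un y * cyl T x y)))"
    by (intro van_add van_cmult van_coord van_un2_cyl[OF sm_U U] van_un_cyl[OF sm_T T])
  then show ?thesis unfolding douglas_K Some
    by (rule van3_dY[OF _ _ g]) (simp add: K_Some)
qed

end

subsection \<open>Degenerate points\<close>

context cyl_finsler3
begin

abbreviation "slit \<equiv> (cyl_domain I \<rho> :: 'n pt set) \<times> (UNIV - {0 :: 'n pt})"

lemma open_slit: "open slit"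
  using fins by (intro open_Times) (auto simp: finsler_metric_def)

abbreviation smooth2 :: "'n fn \<Rightarrow> bool" where
  "smooth2 H \<equiv> smooth_on slit (\<lambda>p. H (fst p) (snd p))"

lemma
  assumes "smooth2 H"
  shows smooth2_dX: "smooth2 (dX A H)" and smooth2_dY: "smooth2 (dY A H)"
proof -
  have pd: "pd (ex A, 0) (\<lambda>p. H (fst p) (snd p)) = (\<lambda>p. dX A H (fst p) (snd p))"
    "pd (0, ex A) (\<lambda>p. H (fst p) (snd p)) = (\<lambda>p. dY A H (fst p) (snd p))"
    by (simp_all add: fun_eq_iff pd_def dX_def dY_def)
  have "(ex A, 0) \<in> Basis" "(0, ex A) \<in> Basis"
    by (simp_all add: Basis_prod_def ex_def axis_in_Basis_iff)
  then show "smooth2 (dX A H)" "smooth2 (dY A H)"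
    using smooth_on_pd[OF assms, of "(ex A, 0)"] smooth_on_pd[OF assms, of "(0, ex A)"]
    by (simp_all only: pd)
qed

lemma smooth2_Fsq: "smooth2 (Fsq F)"
  using smooth_on_power[OF open_slit, of "\<lambda>p. F (fst p) (snd p)" 2] fins
  by (simp add: Fsq_def finsler_metric_def case_prod_unfold)

lemma smooth2_nth: "smooth2 (\<lambda>x y. y $ C)"
  by (rule smooth_on_linear[OF open_slit])
     (rule bounded_linear_compose[OF bounded_linear_vec_nth bounded_linear_snd])

definition rhs :: "'n option \<Rightarrow> 'n fn" where
  "rhs B x y = (\<Sum>C\<in>UNIV. dX C (dY B (Fsq F)) x y * y $ C) - dX B (Fsq F) x y"

lemma smooth2_rhs: "smooth2 (rhs B)"
  unfolding rhs_def
  by (intro smooth_intros[OF open_slit] smooth2_dX smooth2_dY smooth2_Fsq smooth2_nth)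

lemma smooth2_gmat: "smooth2 (\<lambda>x y. gmat F x y $ A $ B)"
  unfolding gmat_def vec_lambda_beta
  by (intro smooth_intros[OF open_slit] smooth2_dY smooth2_Fsq) simp

lemma smooth2_det:
  assumes "\<And>i j. smooth2 (\<lambda>x y. M x y $ i $ j)"
  shows "smooth2 (\<lambda>x y. det (M x y :: real ^ 'n option ^ 'n option))"
  unfolding det_def by (intro smooth_intros[OF open_slit] assms)

text \<open>Determinants are polynomials in the entries, so Cramer's rule exhibits
  \<open>geod\<close> as a smooth function on all of \<open>slit\<close>, including the pairs
  outside the generic set.\<close>

lemma geod_cramer:
  assumes "x \<in> cyl_domain I \<rho>" "y \<noteq> 0"
  shows "geod F A x y = 1 / 4 * (det (\<chi> i j. if j = A then rhs i x y else gmat F x y $ i $ j)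
    / det (gmat F x y))"
proof -
  have inv: "invertible (gmat F x y)" by (rule gmat_invertible[OF assms])
  define w where "w = matrix_inv (gmat F x y) *v (\<chi> B. rhs B x y)"
  have "gmat F x y *v w = (\<chi> B. rhs B x y)"
    unfolding w_def by (rule matrix_inv_mult_vec(2)[OF inv])
  then have "w = (\<chi> k. det (\<chi> i j. if j = k then (\<chi> B. rhs B x y) $ i else gmat F x y $ i $ j)
      / det (gmat F x y))"
    using cramer[of "gmat F x y" w "\<chi> B. rhs B x y"] inv invertible_det_nz by blast
  then have "w $ A = det (\<chi> i j. if j = A then rhs i x y else gmat F x y $ i $ j) / det (gmat F x y)"
    by (simp cong: if_cong)
  then show ?thesis unfolding geod_def rhs_def[symmetric] w_def[symmetric] by simp
qed

lemma smooth2_geod: "smooth2 (geod F A)"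
proof (rule smooth_on_cong[OF open_slit])
  have "smooth2 (\<lambda>x y. (\<chi> i j. if j = A then rhs i x y else gmat F x y $ i $ j) $ i $ j)" for i j
    using smooth2_rhs smooth2_gmat by (cases "j = A") simp_all
  then show "smooth2 (\<lambda>x y. 1 / 4 * (det (\<chi> i j. if j = A then rhs i x y else gmat F x y $ i $ j)
    / det (gmat F x y)))"
    using gmat_invertible
    by (intro smooth_intros[OF open_slit] smooth2_det smooth2_gmat) (auto simp: invertible_det_nz)
next
  fix p assume "p \<in> slit"
  then show "1 / 4 * (det (\<chi> i j. if j = A then rhs i (fst p) (snd p) else gmat F (fst p) (snd p) $ i $ j)
    / det (gmat F (fst p) (snd p))) = geod F A (fst p) (snd p)"
    using geod_cramer[of "fst p" "snd p" A] by (simp add: mem_Times_iff)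
qed

lemma smooth2_douglas: "smooth2 (douglas F A B C D)"
  unfolding douglas_def
  by (intro smooth2_dY smooth_intros[OF open_slit] smooth2_geod smooth2_nth)

text \<open>Pushing the bar-parts along two different axes makes their Gram determinant a polynomial
  in \<open>\<epsilon>\<close>, monic of degree four, so it has finitely many zeros.\<close>

lemma gen_dense:
  fixes x y :: "'n pt"
  assumes x: "x \<in> cyl_domain I \<rho>"
  obtains a b where "\<forall>\<^sub>F \<epsilon> in at 0. gen (x + \<epsilon> *\<^sub>R a) (y + \<epsilon> *\<^sub>R b)"
proof -
  obtain A :: "'n set" where "card A = 3"
    using obtain_subset_with_card_n[OF n3] by blast
  then obtain i j :: 'n where ij: "i \<noteq> j"
    by (auto simp: card_3_iff)
  then have axis_ij: "axis i (1::real) $ j = 0" by (simp add: axis_def)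
  define X where "X = (\<lambda>\<epsilon>. x + \<epsilon> *\<^sub>R ex (Some i))"
  define Y where "Y = (\<lambda>\<epsilon>. y + \<epsilon> *\<^sub>R ex (Some j))"
  define p where "p = [:bar x \<bullet> bar x, 2 * x $ Some i, 1:] * [:bar y \<bullet> bar y, 2 * y $ Some j, 1:]
     - [:bar x \<bullet> bar y, x $ Some j + y $ Some i:]\<^sup>2"
  have p: "poly p \<epsilon> = (bar (X \<epsilon>) \<bullet> bar (X \<epsilon>)) * (bar (Y \<epsilon>) \<bullet> bar (Y \<epsilon>)) - (bar (X \<epsilon>) \<bullet> bar (Y \<epsilon>))\<^sup>2" for \<epsilon>
    using axis_ij by (simp add: p_def X_def Y_def bar_line_Some inner_add_left inner_add_right inner_axis
      inner_axis' inner_axis_axis bar_nth algebra_simps power2_eq_square)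
  \<comment> \<open>Only the product of the two squared lengths reaches degree four; the inner
    product is affine in \<open>\<epsilon>\<close> because the axes are orthogonal.\<close>
  have "coeff p 4 = 1"
    by (simp add: p_def power2_eq_square numeral_eq_Suc)
  then have "p \<noteq> 0" by auto
  then have "finite {\<epsilon>. poly p \<epsilon> = 0}" by (rule poly_roots_finite)
  then have "\<forall>\<^sub>F \<epsilon> in at 0. poly p \<epsilon> \<noteq> 0"
    using islimpt_finite[of "{\<epsilon>. poly p \<epsilon> = 0}" 0] by (simp add: islimpt_iff_eventually)
  moreover have "\<forall>\<^sub>F \<epsilon> in at 0. X \<epsilon> \<in> cyl_domain I \<rho>"
    using eventually_line_in_open[OF _ x, of "ex (Some i)"] fins
    by (auto simp: finsler_metric_def X_def eventually_nhds_conv_at)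
  ultimately have "\<forall>\<^sub>F \<epsilon> in at 0. gen (X \<epsilon>) (Y \<epsilon>)"
  proof eventually_elim
    case (elim \<epsilon>)
    have "(bar (X \<epsilon>) \<bullet> bar (Y \<epsilon>))\<^sup>2 \<noteq> (norm (bar (X \<epsilon>)) * norm (bar (Y \<epsilon>)))\<^sup>2"
      using elim(1) by (simp add: p power_mult_distrib power2_norm_eq_inner)
    then have "\<bar>bar (X \<epsilon>) \<bullet> bar (Y \<epsilon>)\<bar> \<noteq> norm (bar (X \<epsilon>)) * norm (bar (Y \<epsilon>))"
      by (metis power2_abs)
    then show ?case
      using elim(2) Cauchy_Schwarz_ineq2[of "bar (X \<epsilon>)" "bar (Y \<epsilon>)"] by (simp add: gen_def)
  qed
  then show ?thesis using that unfolding X_def Y_def by blast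
qed

lemma vanishing_douglas_iff_gen:
  "vanishing_douglas (cyl_domain I \<rho>) F \<longleftrightarrow> (\<forall>x y A B C D. gen x y \<longrightarrow> douglas F A B C D x y = 0)"
proof (intro iffI allI impI)
  fix x y :: "'n pt" and A B C D
  assume "vanishing_douglas (cyl_domain I \<rho>) F" "gen x y"
  then show "douglas F A B C D x y = 0"
    using gen_y_nonzero[of x y] by (simp add: vanishing_douglas_def gen_def)
next
  assume gen: "\<forall>x y A B C D. gen x y \<longrightarrow> douglas F A B C D x y = 0"
  show "vanishing_douglas (cyl_domain I \<rho>) F"
    unfolding vanishing_douglas_def
  proof (intro ballI allI impI)
    fix x y :: "'n pt" and A B C D assume x: "x \<in> cyl_domain I \<rho>" and y: "y \<noteq> 0"
    obtain a b where ev: "\<forall>\<^sub>F \<epsilon> in at 0. gen (x + \<epsilon> *\<^sub>R a) (y + \<epsilon> *\<^sub>R b)"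
      by (rule gen_dense[OF x])
    let ?f = "\<lambda>p. douglas F A B C D (fst p) (snd p)"
    have "isCont ?f (x, y)"
      using smooth_on_continuous[OF smooth2_douglas] open_slit x y
      by (simp add: continuous_on_eq_continuous_at)
    moreover have "((\<lambda>\<epsilon>. (x + \<epsilon> *\<^sub>R a, y + \<epsilon> *\<^sub>R b)) \<longlongrightarrow> (x, y)) (at 0)"
      by (auto intro!: tendsto_eq_intros)
    ultimately have "((\<lambda>\<epsilon>. ?f (x + \<epsilon> *\<^sub>R a, y + \<epsilon> *\<^sub>R b)) \<longlongrightarrow> ?f (x, y)) (at 0)"
      by (rule isCont_tendsto_compose)
    moreover have "((\<lambda>\<epsilon>. ?f (x + \<epsilon> *\<^sub>R a, y + \<epsilon> *\<^sub>R b)) \<longlongrightarrow> 0) (at 0)"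
      by (rule tendsto_eventually, rule eventually_mono[OF ev]) (use gen in simp)
    ultimately show "douglas F A B C D x y = 0"
      using tendsto_unique[OF trivial_limit_at] by fastforce
  qed
qed

lemma vanishing_douglas_iff:
  "vanishing_douglas (cyl_domain I \<rho>) F \<longleftrightarrow> (\<forall>t r s z. (t, r, s, z) \<in> Reg \<longrightarrow>
     Omega (ds U) t r s z = 0 \<and> Omega (dz U) t r s z = 0 \<and> dz (dz (dz U)) t r s z = 0 \<and>
     Omega (ds R) t r s z = 0 \<and> Omega (dz R) t r s z = 0 \<and> dz (dz (dz R)) t r s z = 0 \<and>
     Omega T t r s z = 0 \<and> dz (dz T) t r s z = 0)"
  unfolding vanishing_douglas_iff_gen
proof (intro iffI allI impI)
  fix t r s z assume D: "\<forall>x y A B C D. gen x y \<longrightarrow> douglas F A B C D x y = 0" and p: "(t, r, s, z) \<in> Reg"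
  have D': "douglas F A B C D x y = 0" if "gen x y" for x y A B C D using D that by blast
  show "Omega (ds U) t r s z = 0 \<and> Omega (dz U) t r s z = 0 \<and> dz (dz (dz U)) t r s z = 0 \<and>
     Omega (ds R) t r s z = 0 \<and> Omega (dz R) t r s z = 0 \<and> dz (dz (dz R)) t r s z = 0 \<and>
     Omega T t r s z = 0 \<and> dz (dz T) t r s z = 0"
    using douglas_gen_zero_imp[OF D' p] by simp
qed (rule douglas_gen_zero, simp_all)

end

theorem mainTheorem4:
  fixes I :: "real set" and \<rho> :: real
    and F :: "'n::finite pt \<Rightarrow> 'n pt \<Rightarrow> real"
    and \<phi> :: "real \<Rightarrow> real \<Rightarrow> real \<Rightarrow> real \<Rightarrow> real"
  assumes n3: "CARD('n) \<ge> 3"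
    and rho: "\<rho> > 0"
    and I: "open I" "is_interval I" "I \<noteq> {}"
    and fins: "finsler_metric (cyl_domain I \<rho>) F"
    and phi_smooth: "smooth_on (phi_region I \<rho>) (\<lambda>(t, r, s, z). \<phi> t r s z)"
    and phi_pos: "\<forall>(t, r, s, z) \<in> phi_region I \<rho>. \<phi> t r s z > 0"
    and cyl: "\<forall>x\<in>cyl_domain I \<rho>. \<forall>y. bar y \<noteq> 0 \<longrightarrow>
                F x y = norm (bar y) * \<phi> (x $ None) (norm (bar x))
                          (inner (bar x) (bar y) / norm (bar y)) (y $ None / norm (bar y))"
  shows "vanishing_douglas (cyl_domain I \<rho>) F \<longleftrightarrow>
    (\<forall>(t, r, s, z) \<in> phi_region I \<rho>.
       (let n = real CARD('n); U = Uf \<phi>; R = Rf n \<phi>; T = Tf n \<phi> in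
        z * Psi (overz (ds U)) t r s z = 0 \<and>
        z * Psi (overz (dz U)) t r s z = 0 \<and>
        dz (dz (dz U)) t r s z = 0 \<and>
        z * Psi (overz (ds R)) t r s z = 0 \<and>
        z * Psi (overz (dz R)) t r s z = 0 \<and>
        dz (dz (dz R)) t r s z = 0 \<and>
        z * Psi (overz T) t r s z = 0 \<and>
        dz (dz T) t r s z = 0))"
proof -
  interpret cyl_finsler3 I \<rho> F \<phi> "real CARD('n)"
    using assms by unfold_locales auto
  note iffs = sm_U[THEN sm_d(3), THEN Psi_overz_iff] sm_U[THEN sm_d(4), THEN Psi_overz_iff]
    sm_R[THEN sm_d(3), THEN Psi_overz_iff] sm_R[THEN sm_d(4), THEN Psi_overz_iff]
    sm_T[THEN Psi_overz_iff]
  \<comment> \<open>\<open>iffs\<close> rewrites only equations quantified over the whole region, so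
    the quantifier over tuples is unfolded and distributed over the conjunction.\<close>
  have split: "(\<forall>(t, r, s, z)\<in>Reg. P t r s z) \<longleftrightarrow> (\<forall>t r s z. (t, r, s, z) \<in> Reg \<longrightarrow> P t r s z)" for P
    by auto
  show ?thesis
    unfolding vanishing_douglas_iff Let_def
    by (simp only: split imp_conjR all_conj_distrib iffs)
qed

end
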